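(* Let $f=(f_1,\ldots,f_n)$ be an $n$-tuple of formal power series with the model property and let $T=(T_1,\ldots,T_n)\in\mathbb B_f(\mathcal H)$ be such that $\operatorname{rank}_f(T)<\infty$. Then the limit defining $\operatorname{curv}_f(T)$ exists and $$\operatorname{curv}_f(T)=\operatorname{rank}_f(T)-\operatorname{trace}\big[\Theta_{f,T}(Q_0\otimes I_{\mathcal D_{f,T^*}})\Theta_{f,T}^*N\big],$$ where $\Theta_{f,T}$ is the characteristic function of $T$ and $N:=\sum_{k=0}^\infty\frac1{n^k}Q_k\otimes I_{\mathcal D_{f,T}}$.
   Context: Notation. $\mathbb F_n^+$ is the free semigroup on $g_1,\ldots,g_n$ with identity $g_0$ and length $|\cdot|$. For an $n$-tuple $X$ of elements of a unital algebra, $X_\alpha=X_{i_1}\cdots X_{i_k}$ if $\alpha=g_{i_1}\cdots g_{i_k}$, $X_{g_0}=I$; $[f(X)]_\alpha$ is the corresponding product of $f_1(X),\ldots,f_n(X)$. A tuple $X\in B(\mathcal H)^n$ is viewed as a row operator $\mathcal H^{(n)}\to\mathcal H$, so $\|X\|=\|\sum X_iX_i^*\|^{1/2}$; $[B(\mathcal H)^n]_\gamma=\{X:\|X\|<\gamma\}$. A free holomorphic function on $[B(\mathcal H)^n]_\gamma$ is a formal power series $\sum a_\alpha Z_\alpha$ in noncommuting indeterminates (complex coefficients) with radius of convergence $r$, $r^{-1}=\limsup_k(\sum_{|\alpha|=k}|a_\alpha|^2)^{1/2k}$, at least $\gamma$, identified with the map $X\mapsto\sum_k\sum_{|\alpha|=k}a_\alpha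 X_\alpha$ (norm convergence; $\mathcal H$ separable infinite-dimensional). $H^2_{\bf ball}$ is the Hilbert space of series with $\sum|a_\alpha|^2<\infty$ (the $Z_\alpha$ being orthonormal). Convergence sets. For an $n$-tuple $f$ of formal power series $f_j=\sum c^{(j)}_\alpha Z_\alpha$ and a Hilbert space $\mathcal H$: $\mathcal C_f^{SOT}(\mathcal H)$ is the set of $X\in B(\mathcal H)^n$ such that each series $f_j(X):=\sum_k\sum_{|\alpha|=k}c^{(j)}_\alpha X_\alpha$ is SOT-convergent; $\mathcal C_f^{rad}(\mathcal H)$ is the set of $X$ such that for some $\delta\in(0,1)$ these series converge in norm at $rX$ for all $r\in(\delta,1)$ and $f_j(X):=\text{SOT-}\lim_{r\to1}f_j(rX)$ exists for each $j$. Model property. $f=(f_1,\ldots,f_n)$ has the model property if one of the following holds. (A) $f$ is an $n$-tuple of noncommutative polynomials for which there is an $n$-tuple $g$ of noncommutative polynomials with $f\circ g=g\circ f=\mathrm{id}$. Then $\{f_\alpha\}$ is a linear basis of $\mathbb C[Z_1,\ldots,Z_n]$ and $\mathbb H^2(f)$ is the completion of $\mathbb C[Z_1,\ldots,Z_n]$ for the inner product $\langle f_\alpha,f_\beta\rangle=\delta_{\alpha\beta}$. (S) $f$ is an $n$-tuple of formal power series with $f(0)=0$, nonzero radius of convergence and $\det J_f(0)\neq0$ ($J_f(0)_{ij}$ is the coefficient of $Z_j$ in $f_i$); $\mathbb H^2(f)$ is the Hilbert space of formal power series $\sum a_\alpha f_\alpha$, $\sum|a_\alpha|^2<\infty$,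 with $\{f_\alpha\}$ orthonormal; $Z_1,\ldots,Z_n\in\mathbb H^2(f)$; left multiplication $M_{Z_i}$ by $Z_i$ is bounded on $\mathbb H^2(f)$; and $M_Z=(M_{Z_1},\ldots,M_{Z_n})$ belongs to $\mathcal C_f^{SOT}(\mathbb H^2(f))$ or $\mathcal C_f^{rad}(\mathbb H^2(f))$ with $f_j(M_Z)=M_{f_j}$ (left multiplication by $f_j$), $j=1,\ldots,n$. (F) $f$ is an $n$-tuple of free holomorphic functions on some $[B(\mathcal H)^n]_\gamma$, $\gamma>0$, with range in $[B(\mathcal H)^n]_1$, such that $G\circ f\not\equiv0$ for every nonzero free holomorphic $G$ on $[B(\mathcal H)^n]_1$; $\mathbb H^2(f)=\{G\circ f:G\in H^2_{\bf ball}\}$ with $\langle F\circ f,G\circ f\rangle=\langle F,G\rangle$; the coordinate functions $Z_1,\ldots,Z_n$ lie in $\mathbb H^2(f)$, left multiplications $M_{Z_i}$ by them are bounded on $\mathbb H^2(f)$, and $M_Z$ is in $\mathcal C_f^{SOT}(\mathbb H^2(f))$ or $\mathcal C_f^{rad}(\mathbb H^2(f))$ with $f_j(M_Z)=M_{f_j}$ for all $j$. In all cases $\{f_\alpha\}_{\alpha\in\mathbb F_n^+}$ is an orthonormal basis of $\mathbb H^2(f)$, and $M_Z$ is called the universal model. Writing $Z_i=\sum_\alpha a^{(i)}_\alpha f_\alpha$ in $\mathbb H^2(f)$, one has $M_{Z_i}f_\beta=\sum_\alpha a^{(i)}_\alpha f_{\alpha\beta}$, and $g_i:=\sum_\alpha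 a^{(i)}_\alpha Z_\alpha$ defines the inverse $g=(g_1,\ldots,g_n)$ of $f$ with respect to composition. Domain. $X\in B(\mathcal H)^n$ satisfies $g(f(X))=X$ if $X\in\mathcal C_f^{SOT}(\mathcal H)\cup\mathcal C_f^{rad}(\mathcal H)$ and either (for all $i$) $X_i=\sum_k\sum_{|\alpha|=k}a^{(i)}_\alpha[f(X)]_\alpha$ in the SOT, or (for all $i$) $X_i=\text{SOT-}\lim_{r\to1}\sum_k\sum_{|\alpha|=k}a^{(i)}_\alpha r^{|\alpha|}[f(X)]_\alpha$ (automatic in case (A)). Then $\mathbb B_f(\mathcal H):=\{X\in B(\mathcal H)^n:\ g(f(X))=X,\ \|f(X)\|\le1\}$; in particular $M_Z\in\mathbb B_f(\mathbb H^2(f))$. Defect, Poisson kernel, characteristic function. For $T\in\mathbb B_f(\mathcal H)$ let $f(T)=[f_1(T),\ldots,f_n(T)]:\mathcal H^{(n)}\to\mathcal H$, $\Delta_{f,T}:=(I_{\mathcal H}-\sum_if_i(T)f_i(T)^* )^{1/2}$, $\Delta_{f,T^*}:=(I-f(T)^*f(T))^{1/2}\in B(\mathcal H^{(n)})$, $\mathcal D_{f,T}:=\overline{\Delta_{f,T}\mathcal H}$, $\mathcal D_{f,T^*}:=\overline{\Delta_{f,T^*}\mathcal H^{(n)}}$, $\operatorname{rank}_f(T):=\operatorname{rank}\Delta_{f,T}$. The Poisson kernel is $K_{f,T}:\mathcal H\to\mathbb H^2(f)\otimes\mathcal D_{f,T}$, $K_{f,T}h:=\sum_{\alpha\in\mathbb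 F_n^+}f_\alpha\otimes\Delta_{f,T}[f(T)]_\alpha^*h$. Let $\Lambda_i$ be right multiplication by $f_i$ on $\mathbb H^2(f)$, $\Lambda_if_\alpha=f_{\alpha g_i}$. The characteristic function $\Theta_{f,T}:\mathbb H^2(f)\otimes\mathcal D_{f,T^*}\to\mathbb H^2(f)\otimes\mathcal D_{f,T}$ is the bounded operator (intertwining $M_{Z_i}\otimes I$ with $M_{Z_i}\otimes I$) with formal Fourier representation $$-I\otimes f(T)+(I\otimes\Delta_{f,T})\Big(I-\sum_{i=1}^n\Lambda_i\otimes f_i(T)^*\Big)^{-1}[\Lambda_1\otimes I_{\mathcal H},\ldots,\Lambda_n\otimes I_{\mathcal H}](I\otimes\Delta_{f,T^*}),$$ i.e. the SOT-limit as $r\to1$ of the operators obtained by replacing each $\Lambda_i$ by $r\Lambda_i$. Curvature. $Q_m$ (resp. $Q_{\le m}$) is the orthogonal projection of $\mathbb H^2(f)$ onto the span of the $f_\alpha$ with $|\alpha|=m$ (resp. $|\alpha|\le m$). If $\operatorname{rank}_f(T)<\infty$, $$\operatorname{curv}_f(T):=\lim_{m\to\infty}\frac{\operatorname{trace}[K_{f,T}^*(Q_{\le m}\otimes I_{\mathcal D_{f,T}})K_{f,T}]}{\operatorname{trace}[K_{f,M_Z}^*Q_{\le m}K_{f,M_Z}]},$$ where $\mathcal D_{f,M_Z}$ is one-dimensional and $\mathbb H^2(f)\otimes\mathcal D_{f,M_Z}$ is identified with $\mathbb H^2(f)$ (the denominator equals $1+n+\cdots+n^m$).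
   Formalization: For n ≥ 2 the operator Θ(Q_0⊗I)Θ*N need not be trace class, so its trace is taken as the common diagonal sum over orthonormal bases of homogeneous vectors (e.g. f_α⊗d_j); this equals the usual trace whenever the operator is trace class. *)

theory Defs
  imports "HOL-Analysis.Analysis"
begin

section \<open>Complex Hilbert spaces\<close>

text \<open>
  The complex inner product is linear in its first argument.  The library's real inner product is
  its real part, so that norm, topology and completeness are those of the library.
\<close>

class chilbert_space = real_inner + complete_space +
  fixes scaleC :: "complex \<Rightarrow> 'a \<Rightarrow> 'a" (infixr "*\<^sub>C" 75)
    and cinner :: "'a \<Rightarrow> 'a \<Rightarrow> complex"
  assumes scaleC_add_right: "a *\<^sub>C (x + y) = a *\<^sub>C x + a *\<^sub>C y"
    and scaleC_add_left: "(a + b) *\<^sub>C x = a *\<^sub>C x + b *\<^sub>C x"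
    and scaleC_scaleC: "a *\<^sub>C (b *\<^sub>C x) = (a * b) *\<^sub>C x"
    and scaleC_of_real: "of_real r *\<^sub>C x = r *\<^sub>R x"
    and cinner_commute: "cinner x y = cnj (cinner y x)"
    and cinner_add_left: "cinner (x + y) z = cinner x z + cinner y z"
    and cinner_scaleC_left: "cinner (a *\<^sub>C x) y = a * cinner x y"
    and inner_eq_Re_cinner: "inner x y = Re (cinner x y)"

lemma scaleC_one: "1 *\<^sub>C (x :: 'a :: chilbert_space) = x"
  using scaleC_of_real[of 1 x] by simp

lemma cinner_self: "cinner x x = of_real ((norm (x :: 'a :: chilbert_space))\<^sup>2)"
proof (rule complex_eqI)
  show "Re (cinner x x) = Re (complex_of_real ((norm x)\<^sup>2))"
    by (simp flip: inner_eq_Re_cinner add: power2_norm_eq_inner)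
  show "Im (cinner x x) = Im (complex_of_real ((norm x)\<^sup>2))"
    using arg_cong[OF cinner_commute[of x x], of Im] by simp
qed

lemma norm_scaleC: "norm (a *\<^sub>C x) = cmod a * norm (x :: 'a :: chilbert_space)"
proof -
  have "cinner (a *\<^sub>C x) (a *\<^sub>C x) = a * cnj (a * cinner x x)"
    by (metis cinner_commute cinner_scaleC_left)
  also have "\<dots> = (a * cnj a) * of_real ((norm x)\<^sup>2)"
    by (simp add: cinner_self)
  also have "\<dots> = of_real ((cmod a * norm x)\<^sup>2)"
    by (simp only: complex_norm_square[symmetric] power_mult_distrib of_real_mult)
  finally have "(norm (a *\<^sub>C x))\<^sup>2 = (cmod a * norm x)\<^sup>2"
    unfolding cinner_self of_real_eq_iff .
  thus ?thesis by (simp add: power2_eq_iff_nonneg)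
qed

lemma norm_cinner_le: "cmod (cinner x y) \<le> 2 * (norm x * norm (y :: 'a :: chilbert_space))"
proof -
  have 1: "\<bar>Re (cinner x y)\<bar> \<le> norm x * norm y"
    by (simp flip: inner_eq_Re_cinner add: Cauchy_Schwarz_ineq2)
  have "Im (cinner x y) = inner ((- \<i>) *\<^sub>C x) y"
    by (simp add: inner_eq_Re_cinner cinner_scaleC_left)
  also have "\<bar>\<dots>\<bar> \<le> norm ((- \<i>) *\<^sub>C x) * norm y"
    by (rule Cauchy_Schwarz_ineq2)
  finally have "\<bar>Im (cinner x y)\<bar> \<le> norm x * norm y"
    by (simp add: norm_scaleC)
  with 1 show ?thesis using cmod_le[of "cinner x y"] by linarith
qed

instantiation complex :: chilbert_space
begin
definition scaleC_complex :: "complex \<Rightarrow> complex \<Rightarrow> complex" where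
  "scaleC_complex a x = a * x"
definition cinner_complex :: "complex \<Rightarrow> complex \<Rightarrow> complex" where
  "cinner_complex x y = x * cnj y"
instance
  by standard
    (simp_all add: scaleC_complex_def cinner_complex_def algebra_simps scaleR_conv_of_real
      inner_complex_def)
end

global_interpretation complex_vector: vector_space "scaleC :: complex \<Rightarrow> 'a \<Rightarrow> 'a :: chilbert_space"
  defines cspan = complex_vector.span
    and cdim = complex_vector.dim
  by unfold_locales (simp_all add: scaleC_add_right scaleC_add_left scaleC_scaleC scaleC_one)

subsection \<open>Hilbert direct sums\<close>

text \<open>
  \<open>('i, 'h) hsum\<close> is the Hilbert space direct sum of copies of \<open>'h\<close> indexed by \<open>'i\<close>, i.e.
  \<open>\<ell>\<^sup>2('i) \<otimes> 'h\<close>.  With \<open>'i\<close> finite this is the space of \<open>'i\<close>-tuples; if \<open>(e\<^sub>i)\<close> is the canonical basis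
  of \<open>\<ell>\<^sup>2('i)\<close>, the family \<open>(v\<^sub>i)\<close> is the vector \<open>\<Sum>\<^sub>i e\<^sub>i \<otimes> v\<^sub>i\<close>.
\<close>

definition l2_summable :: "('i \<Rightarrow> 'h :: real_normed_vector) \<Rightarrow> bool" where
  "l2_summable x \<longleftrightarrow> (\<lambda>i. (norm (x i))\<^sup>2) summable_on UNIV"

lemma l2_summable_zero: "l2_summable (\<lambda>_. 0)"
  by (simp add: l2_summable_def)

lemma l2_summable_add:
  assumes "l2_summable x" "l2_summable y" shows "l2_summable (\<lambda>i. x i + y i)"
  unfolding l2_summable_def
proof (rule summable_on_comparison_test)
  show "(\<lambda>i. 2 * (norm (x i))\<^sup>2 + 2 * (norm (y i))\<^sup>2) summable_on UNIV"
    using assms unfolding l2_summable_def by (intro summable_on_add summable_on_cmult_right)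
  show "(norm (x i + y i))\<^sup>2 \<le> 2 * (norm (x i))\<^sup>2 + 2 * (norm (y i))\<^sup>2" for i
  proof -
    have "(norm (x i + y i))\<^sup>2 \<le> (norm (x i) + norm (y i))\<^sup>2"
      by (intro power_mono norm_triangle_ineq) simp
    also have "\<dots> \<le> 2 * (norm (x i))\<^sup>2 + 2 * (norm (y i))\<^sup>2"
      using sum_squares_bound[of "norm (x i)" "norm (y i)"] by (simp add: power2_sum)
    finally show ?thesis .
  qed
qed auto

lemma l2_summable_scaleC:
  assumes "l2_summable x" shows "l2_summable (\<lambda>i. a *\<^sub>C (x i :: 'h :: chilbert_space))"
  using assms unfolding l2_summable_def
  by (simp add: norm_scaleC power_mult_distrib summable_on_cmult_right)

lemma l2_summable_scaleR:
  assumes "l2_summable x" shows "l2_summable (\<lambda>i. r *\<^sub>R x i)"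
  using assms unfolding l2_summable_def
  by (simp add: power_mult_distrib summable_on_cmult_right)

lemma l2_summable_minus:
  assumes "l2_summable x" shows "l2_summable (\<lambda>i. - x i)"
  using assms by (simp add: l2_summable_def)

lemma l2_summable_diff:
  assumes "l2_summable x" "l2_summable y" shows "l2_summable (\<lambda>i. x i - y i)"
  using l2_summable_add[OF assms(1) l2_summable_minus[OF assms(2)]] by simp

typedef (overloaded) ('i, 'h :: chilbert_space) hsum = "{x :: 'i \<Rightarrow> 'h. l2_summable x}"
  morphisms hnth Abs_hsum
  using l2_summable_zero by blast

lemma hnth_l2 [simp]: "l2_summable (hnth x)"
  using hnth by blast

lemma hnth_Abs [simp]: "l2_summable x \<Longrightarrow> hnth (Abs_hsum x) = x"
  by (simp add: Abs_hsum_inverse)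

lemma hsum_eqI: "(\<And>i. hnth x i = hnth y i) \<Longrightarrow> x = y"
  by (metis ext hnth_inject)

instantiation hsum :: (type, chilbert_space) real_vector
begin
definition zero_hsum :: "('a, 'b) hsum" where "zero_hsum = Abs_hsum (\<lambda>_. 0)"
definition plus_hsum :: "('a, 'b) hsum \<Rightarrow> ('a, 'b) hsum \<Rightarrow> ('a, 'b) hsum" where
  "plus_hsum x y = Abs_hsum (\<lambda>i. hnth x i + hnth y i)"
definition minus_hsum :: "('a, 'b) hsum \<Rightarrow> ('a, 'b) hsum \<Rightarrow> ('a, 'b) hsum" where
  "minus_hsum x y = Abs_hsum (\<lambda>i. hnth x i - hnth y i)"
definition uminus_hsum :: "('a, 'b) hsum \<Rightarrow> ('a, 'b) hsum" where
  "uminus_hsum x = Abs_hsum (\<lambda>i. - hnth x i)"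
definition scaleR_hsum :: "real \<Rightarrow> ('a, 'b) hsum \<Rightarrow> ('a, 'b) hsum" where
  "scaleR_hsum r x = Abs_hsum (\<lambda>i. r *\<^sub>R hnth x i)"

lemma hnth_simps [simp]:
  fixes x y :: "('a, 'b) hsum"
  shows "hnth (0 :: ('a, 'b) hsum) i = 0"
    and "hnth (x + y) i = hnth x i + hnth y i"
    and "hnth (x - y) i = hnth x i - hnth y i"
    and "hnth (- x) i = - hnth x i"
    and "hnth (r *\<^sub>R x) i = r *\<^sub>R hnth x i"
  by (simp_all add: zero_hsum_def plus_hsum_def minus_hsum_def uminus_hsum_def scaleR_hsum_def
      l2_summable_zero l2_summable_add l2_summable_diff l2_summable_minus l2_summable_scaleR)

instance
  by standard (rule hsum_eqI, simp add: algebra_simps)+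
end

definition hcinner :: "('i, 'h :: chilbert_space) hsum \<Rightarrow> ('i, 'h) hsum \<Rightarrow> complex" where
  "hcinner x y = (\<Sum>\<^sub>\<infinity>i. cinner (hnth x i) (hnth y i))"

lemma hcinner_summable:
  "(\<lambda>i. cinner (hnth x i) (hnth (y :: ('i, 'h :: chilbert_space) hsum) i)) summable_on UNIV"
proof (rule abs_summable_summable, rule summable_on_comparison_test)
  show "(\<lambda>i. (norm (hnth x i))\<^sup>2 + (norm (hnth y i))\<^sup>2) summable_on UNIV"
    using hnth_l2[of x] hnth_l2[of y] unfolding l2_summable_def by (rule summable_on_add)
  show "norm (cinner (hnth x i) (hnth y i)) \<le> (norm (hnth x i))\<^sup>2 + (norm (hnth y i))\<^sup>2" for i
    using norm_cinner_le[of "hnth x i" "hnth y i"]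
      sum_squares_bound[of "norm (hnth x i)" "norm (hnth y i)"] by simp
qed auto

lemma hcinner_commute: "hcinner x y = cnj (hcinner y x)"
  unfolding hcinner_def infsum_cnj[symmetric] by (subst cinner_commute) simp

lemma hcinner_add_left: "hcinner (x + y) z = hcinner x z + hcinner y z"
  unfolding hcinner_def
  by (simp add: cinner_add_left infsum_add hcinner_summable)

lemma hcinner_self:
  "hcinner x x = of_real (\<Sum>\<^sub>\<infinity>i. (norm (hnth x i))\<^sup>2)"
proof -
  have "((\<lambda>i. complex_of_real ((norm (hnth x i))\<^sup>2)) has_sum
      of_real (\<Sum>\<^sub>\<infinity>i. (norm (hnth x i))\<^sup>2)) UNIV"
    using hnth_l2[of x] unfolding l2_summable_def
    by (intro has_sum_of_real has_sum_infsum)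
  thus ?thesis unfolding hcinner_def cinner_self by (rule infsumI)
qed

instantiation hsum :: (type, chilbert_space) real_inner
begin
definition inner_hsum :: "('a, 'b) hsum \<Rightarrow> ('a, 'b) hsum \<Rightarrow> real" where
  "inner_hsum x y = Re (hcinner x y)"
definition norm_hsum :: "('a, 'b) hsum \<Rightarrow> real" where
  "norm_hsum x = sqrt (inner x x)"
definition sgn_hsum :: "('a, 'b) hsum \<Rightarrow> ('a, 'b) hsum" where
  "sgn_hsum x = x /\<^sub>R norm x"
definition dist_hsum :: "('a, 'b) hsum \<Rightarrow> ('a, 'b) hsum \<Rightarrow> real" where
  "dist_hsum x y = norm (x - y)"
definition uniformity_hsum :: "(('a, 'b) hsum \<times> ('a, 'b) hsum) filter" where
  "uniformity_hsum = (INF e\<in>{0<..}. principal {(x, y). dist x y < e})"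
definition open_hsum :: "('a, 'b) hsum set \<Rightarrow> bool" where
  "open_hsum U \<longleftrightarrow> (\<forall>x\<in>U. \<forall>\<^sub>F (x', y) in uniformity. x' = x \<longrightarrow> y \<in> U)"

instance
proof
  fix x y z :: "('a, 'b) hsum" and r :: real
  show "sgn x = x /\<^sub>R norm x" by (rule sgn_hsum_def)
  show "dist x y = norm (x - y)" by (rule dist_hsum_def)
  show "uniformity = (INF e\<in>{0<..}. principal {(x :: ('a, 'b) hsum, y). dist x y < e})"
    by (rule uniformity_hsum_def)
  show "open U \<longleftrightarrow> (\<forall>x\<in>U. \<forall>\<^sub>F (x', y) in uniformity. x' = x \<longrightarrow> y \<in> U)"
    for U :: "('a, 'b) hsum set" by (rule open_hsum_def)
  show "norm x = sqrt (inner x x)" by (rule norm_hsum_def)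
  show "inner x y = inner y x"
    unfolding inner_hsum_def by (subst hcinner_commute) simp
  show "inner (x + y) z = inner x z + inner y z"
    by (simp add: inner_hsum_def hcinner_add_left)
  have "hcinner (r *\<^sub>R x) y = of_real r * hcinner x y"
    unfolding hcinner_def
    by (simp add: cinner_scaleC_left infsum_cmult_right' flip: scaleC_of_real)
  thus "inner (r *\<^sub>R x) y = r * inner x y" by (simp add: inner_hsum_def)
  show "0 \<le> inner x x"
    by (simp add: inner_hsum_def hcinner_self infsum_nonneg)
  show "(inner x x = 0) = (x = 0)"
  proof
    assume "inner x x = 0"
    hence "(\<Sum>\<^sub>\<infinity>i. (norm (hnth x i))\<^sup>2) = 0" by (simp add: inner_hsum_def hcinner_self)
    hence "(norm (hnth x i))\<^sup>2 = 0" for i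
      using hnth_l2[of x] nonneg_infsum_le_0D[of "\<lambda>i. (norm (hnth x i))\<^sup>2" UNIV i]
      unfolding l2_summable_def by auto
    thus "x = 0" by (intro hsum_eqI) simp
  qed (simp add: inner_hsum_def hcinner_self)
qed
end

lemma hnorm_sq: "(norm (x :: ('i, 'h :: chilbert_space) hsum))\<^sup>2 = (\<Sum>\<^sub>\<infinity>i. (norm (hnth x i))\<^sup>2)"
  by (simp add: power2_norm_eq_inner inner_hsum_def hcinner_self)

lemma hnorm_finite_le:
  "finite F \<Longrightarrow> (\<Sum>i\<in>F. (norm (hnth x i))\<^sup>2) \<le> (norm (x :: ('i, 'h :: chilbert_space) hsum))\<^sup>2"
  unfolding hnorm_sq using hnth_l2[of x] unfolding l2_summable_def
  by (intro finite_sum_le_infsum) auto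

lemma hnth_norm_le: "norm (hnth x i) \<le> norm (x :: ('i, 'h :: chilbert_space) hsum)"
  using hnorm_finite_le[of "{i}" x] by (simp add: power2_le_iff_abs_le)

lemma hnorm_le_finite:
  assumes "\<And>F. finite F \<Longrightarrow> (\<Sum>i\<in>F. (norm (y i))\<^sup>2) \<le> e\<^sup>2" and "0 \<le> e"
  shows "l2_summable y" and "norm (Abs_hsum y :: ('i, 'h :: chilbert_space) hsum) \<le> e"
proof -
  show *: "l2_summable y"
    unfolding l2_summable_def
    by (rule nonneg_bdd_above_summable_on) (auto intro!: bdd_aboveI[of _ "e\<^sup>2"] assms)
  have "(norm (Abs_hsum y :: ('i, 'h) hsum))\<^sup>2 \<le> e\<^sup>2"
    unfolding hnorm_sq hnth_Abs[OF *]
    using * unfolding l2_summable_def by (rule infsum_le_finite_sums) (use assms in auto)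
  thus "norm (Abs_hsum y :: ('i, 'h) hsum) \<le> e"
    using assms(2) by (simp add: power2_le_iff_abs_le)
qed

instance hsum :: (type, chilbert_space) complete_space
proof
  fix X :: "nat \<Rightarrow> ('a, 'b) hsum"
  assume X: "Cauchy X"
  have "Cauchy (\<lambda>n. hnth (X n) i)" for i
  proof (rule metric_CauchyI)
    fix e :: real assume "0 < e"
    then obtain M where M: "\<And>m n. m \<ge> M \<Longrightarrow> n \<ge> M \<Longrightarrow> dist (X m) (X n) < e"
      using X unfolding Cauchy_def by blast
    have "dist (hnth (X m) i) (hnth (X n) i) < e" if "m \<ge> M" "n \<ge> M" for m n
      using hnth_norm_le[of "X m - X n" i] M[OF that] by (simp add: dist_norm)
    thus "\<exists>M. \<forall>m\<ge>M. \<forall>n\<ge>M. dist (hnth (X m) i) (hnth (X n) i) < e" by blast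
  qed
  then obtain L where L: "\<And>i. (\<lambda>n. hnth (X n) i) \<longlonglongrightarrow> L i"
    unfolding Cauchy_convergent_iff convergent_def by metis
  have main: "l2_summable (\<lambda>i. hnth (X m) i - L i) \<and>
      norm (Abs_hsum (\<lambda>i. hnth (X m) i - L i)) \<le> e"
    if M: "\<And>m n. m \<ge> M \<Longrightarrow> n \<ge> M \<Longrightarrow> dist (X m) (X n) < e" and "0 < e" and "m \<ge> M" for M m e
  proof -
    have "(\<Sum>i\<in>F. (norm (hnth (X m) i - L i))\<^sup>2) \<le> e\<^sup>2" if "finite F" for F
    proof (rule tendsto_upperbound)
      show "(\<lambda>n. \<Sum>i\<in>F. (norm (hnth (X m) i - hnth (X n) i))\<^sup>2)
          \<longlonglongrightarrow> (\<Sum>i\<in>F. (norm (hnth (X m) i - L i))\<^sup>2)"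
        by (intro tendsto_intros L)
      have "(\<Sum>i\<in>F. (norm (hnth (X m) i - hnth (X n) i))\<^sup>2) \<le> e\<^sup>2" if "n \<ge> M" for n
      proof -
        have "(\<Sum>i\<in>F. (norm (hnth (X m) i - hnth (X n) i))\<^sup>2) \<le> (norm (X m - X n))\<^sup>2"
          using hnorm_finite_le[OF \<open>finite F\<close>, of "X m - X n"] by simp
        also have "\<dots> \<le> e\<^sup>2"
          using M[OF \<open>m \<ge> M\<close> that] by (intro power_mono) (simp_all add: dist_norm)
        finally show ?thesis .
      qed
      thus "\<forall>\<^sub>F n in sequentially. (\<Sum>i\<in>F. (norm (hnth (X m) i - hnth (X n) i))\<^sup>2) \<le> e\<^sup>2"
        by (rule eventually_sequentiallyI)
    qed simp
    with \<open>0 < e\<close> show ?thesis by (auto intro!: hnorm_le_finite)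
  qed
  obtain M where "\<And>m n. m \<ge> M \<Longrightarrow> n \<ge> M \<Longrightarrow> dist (X m) (X n) < 1"
    using X zero_less_one unfolding Cauchy_def by blast
  from main[OF this, of M] have "l2_summable (\<lambda>i. hnth (X M) i - L i)" by simp
  from l2_summable_diff[OF hnth_l2[of "X M"] this] have L2: "l2_summable L" by simp
  have "X \<longlonglongrightarrow> Abs_hsum L"
  proof (rule metric_LIMSEQ_I)
    fix e :: real assume "0 < e"
    hence "0 < e / 2" by simp
    then obtain M where M: "\<And>m n. m \<ge> M \<Longrightarrow> n \<ge> M \<Longrightarrow> dist (X m) (X n) < e / 2"
      using X unfolding Cauchy_def by blast
    have "dist (X m) (Abs_hsum L) < e" if "m \<ge> M" for m
    proof -
      have "X m - Abs_hsum L = Abs_hsum (\<lambda>i. hnth (X m) i - L i)"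
        using L2 by (simp add: minus_hsum_def)
      with main[OF M \<open>0 < e / 2\<close> that] \<open>0 < e\<close> show ?thesis by (simp add: dist_norm)
    qed
    thus "\<exists>M. \<forall>m\<ge>M. dist (X m) (Abs_hsum L) < e" by blast
  qed
  thus "convergent X" by (rule convergentI)
qed

instantiation hsum :: (type, chilbert_space) chilbert_space
begin
definition scaleC_hsum :: "complex \<Rightarrow> ('a, 'b) hsum \<Rightarrow> ('a, 'b) hsum" where
  "scaleC_hsum a x = Abs_hsum (\<lambda>i. a *\<^sub>C hnth x i)"
definition cinner_hsum :: "('a, 'b) hsum \<Rightarrow> ('a, 'b) hsum \<Rightarrow> complex" where
  "cinner_hsum x y = (\<Sum>\<^sub>\<infinity>i. cinner (hnth x i) (hnth y i))"

lemma hnth_scaleC [simp]: "hnth (a *\<^sub>C (x :: ('a, 'b) hsum)) i = a *\<^sub>C hnth x i"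
  by (simp add: scaleC_hsum_def l2_summable_scaleC)

instance
proof
  fix x y z :: "('a, 'b) hsum" and a b :: complex and r :: real
  have *: "cinner = (hcinner :: ('a, 'b) hsum \<Rightarrow> _)"
    by (intro ext) (simp add: cinner_hsum_def hcinner_def)
  show "a *\<^sub>C (x + y) = a *\<^sub>C x + a *\<^sub>C y"
    by (rule hsum_eqI) (simp add: scaleC_add_right)
  show "(a + b) *\<^sub>C x = a *\<^sub>C x + b *\<^sub>C x"
    by (rule hsum_eqI) (simp add: scaleC_add_left)
  show "a *\<^sub>C (b *\<^sub>C x) = (a * b) *\<^sub>C x"
    by (rule hsum_eqI) (simp add: scaleC_scaleC)
  show "of_real r *\<^sub>C x = r *\<^sub>R x"
    by (rule hsum_eqI) (simp add: scaleC_of_real)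
  show "cinner x y = cnj (cinner y x)" unfolding * by (rule hcinner_commute)
  show "cinner (x + y) z = cinner x z + cinner y z" unfolding * by (rule hcinner_add_left)
  show "cinner (a *\<^sub>C x) y = a * cinner x y"
    unfolding cinner_hsum_def by (simp add: cinner_scaleC_left infsum_cmult_right')
  show "inner x y = Re (cinner x y)" unfolding * by (rule inner_hsum_def)
qed
end

section \<open>Operators\<close>

definition bounded_clinear :: "('a :: chilbert_space \<Rightarrow> 'b :: chilbert_space) \<Rightarrow> bool" where
  "bounded_clinear A \<longleftrightarrow> bounded_linear A \<and> (\<forall>c x. A (c *\<^sub>C x) = c *\<^sub>C A x)"

text \<open>
  Adjoint of an operator between closed subspaces \<open>S\<close> and \<open>S'\<close>: the values of \<open>A\<close> outside \<open>S\<close>, and those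
  of its adjoint outside \<open>S'\<close>, are irrelevant.
\<close>

definition cadj_on :: "'a set \<Rightarrow> 'b set \<Rightarrow> ('a :: chilbert_space \<Rightarrow> 'b :: chilbert_space) \<Rightarrow> 'b \<Rightarrow> 'a" where
  "cadj_on S S' A = (SOME B. (\<forall>y\<in>S'. B y \<in> S) \<and> (\<forall>x\<in>S. \<forall>y\<in>S'. cinner (A x) y = cinner x (B y)))"

abbreviation cadj :: "('a :: chilbert_space \<Rightarrow> 'b :: chilbert_space) \<Rightarrow> 'b \<Rightarrow> 'a" where
  "cadj \<equiv> cadj_on UNIV UNIV"

definition positive_op :: "('a :: chilbert_space \<Rightarrow> 'a) \<Rightarrow> bool" where
  "positive_op A \<longleftrightarrow> bounded_clinear A \<and> (\<forall>x y. cinner (A x) y = cinner x (A y)) \<and>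
     (\<forall>x. 0 \<le> Re (cinner (A x) x))"

text \<open>The positive square root of a positive operator is unique.\<close>

definition sqrt_op :: "('a :: chilbert_space \<Rightarrow> 'a) \<Rightarrow> 'a \<Rightarrow> 'a" where
  "sqrt_op A = (SOME B. positive_op B \<and> B \<circ> B = A)"

definition finite_rank :: "('a :: chilbert_space \<Rightarrow> 'b :: chilbert_space) \<Rightarrow> bool" where
  "finite_rank A \<longleftrightarrow> (\<exists>B. finite B \<and> range A \<subseteq> cspan B)"

text \<open>Orthonormal basis (maximal orthonormal system) of a closed subspace \<open>S\<close>.\<close>

definition is_onb :: "'a :: chilbert_space set \<Rightarrow> 'a set \<Rightarrow> bool" where
  "is_onb S E \<longleftrightarrow> E \<subseteq> S \<and> (\<forall>e\<in>E. \<forall>e'\<in>E. cinner e e' = (if e = e' then 1 else 0)) \<and>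
     (\<forall>x\<in>S. (\<forall>e\<in>E. cinner x e = 0) \<longrightarrow> x = 0)"

definition has_diagonal_sum :: "('a :: chilbert_space \<Rightarrow> 'a) \<Rightarrow> 'a set \<Rightarrow> complex \<Rightarrow> bool" where
  "has_diagonal_sum A E t \<longleftrightarrow> ((\<lambda>e. cinner (A e) e) has_sum t) E"

definition optrace :: "('a :: chilbert_space \<Rightarrow> 'a) \<Rightarrow> complex" where
  "optrace A = (THE t. \<forall>E. is_onb UNIV E \<longrightarrow> has_diagonal_sum A E t)"

section \<open>Noncommutative formal power series\<close>

text \<open>
  The free semigroup on \<open>n\<close> generators is the type of words \<open>'n list\<close> with \<open>n = CARD('n)\<close>; a formal
  power series is the family of its coefficients.
\<close>

type_synonym 'n ncfps = "'n list \<Rightarrow> complex"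

definition words :: "nat \<Rightarrow> 'n list set" where
  "words k = {\<alpha>. length \<alpha> = k}"

definition nc_one :: "'n ncfps" where
  "nc_one \<alpha> = (if \<alpha> = [] then 1 else 0)"

definition nc_var :: "'n \<Rightarrow> 'n ncfps" where
  "nc_var i \<alpha> = (if \<alpha> = [i] then 1 else 0)"

definition nc_mult :: "'n ncfps \<Rightarrow> 'n ncfps \<Rightarrow> 'n ncfps" where
  "nc_mult \<phi> \<psi> \<gamma> = (\<Sum>k\<le>length \<gamma>. \<phi> (take k \<gamma>) * \<psi> (drop k \<gamma>))"

definition nc_power :: "('n \<Rightarrow> 'n ncfps) \<Rightarrow> 'n list \<Rightarrow> 'n ncfps" where
  "nc_power f \<alpha> = foldr (\<lambda>i. nc_mult (f i)) \<alpha> nc_one"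

definition nc_polynomial :: "'n ncfps \<Rightarrow> bool" where
  "nc_polynomial \<phi> \<longleftrightarrow> finite {\<alpha>. \<phi> \<alpha> \<noteq> 0}"

text \<open>
  The formal composition \<open>a \<circ> f = \<Sum>\<^sub>\<alpha> a\<^sub>\<alpha> f\<^sub>\<alpha>\<close>, computed coefficientwise.  It is only used when \<open>a\<close> is a
  polynomial or all \<open>f\<^sub>i\<close> have zero constant term; each coefficient is then a finite sum.
\<close>

definition nc_compose :: "'n ncfps \<Rightarrow> ('n \<Rightarrow> 'n ncfps) \<Rightarrow> 'n ncfps" where
  "nc_compose a f \<beta> = (\<Sum>\<^sub>\<infinity>\<alpha>. a \<alpha> * nc_power f \<alpha> \<beta>)"

definition nc_radius :: "'n :: finite ncfps \<Rightarrow> ereal" where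
  "nc_radius \<phi> =
     inverse (limsup (\<lambda>k. ereal ((\<Sum>\<alpha>\<in>words k. (cmod (\<phi> \<alpha>))\<^sup>2) powr (1 / (2 * real k)))))"

definition jacobian0 :: "('n \<Rightarrow> 'n ncfps) \<Rightarrow> complex ^ 'n ^ 'n :: finite" where
  "jacobian0 f = (\<chi> i j. f i [j])"

subsection \<open>Evaluation at tuples of operators\<close>

definition op_power :: "('n \<Rightarrow> 'h \<Rightarrow> 'h) \<Rightarrow> 'n list \<Rightarrow> 'h \<Rightarrow> 'h" where
  "op_power X \<alpha> = foldr (\<lambda>i A. X i \<circ> A) \<alpha> id"

definition row_op :: "('n :: finite \<Rightarrow> 'h \<Rightarrow> 'h) \<Rightarrow> ('n, 'h :: chilbert_space) hsum \<Rightarrow> 'h" where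
  "row_op X x = (\<Sum>i\<in>UNIV. X i (hnth x i))"

definition row_ball :: "real \<Rightarrow> ('n :: finite \<Rightarrow> 'h :: chilbert_space \<Rightarrow> 'h) set" where
  "row_ball \<gamma> = {X. (\<forall>i. bounded_clinear (X i)) \<and> onorm (row_op X) < \<gamma>}"

definition nc_homog :: "'n :: finite ncfps \<Rightarrow> ('n \<Rightarrow> 'h \<Rightarrow> 'h) \<Rightarrow> nat \<Rightarrow> 'h \<Rightarrow> 'h :: chilbert_space" where
  "nc_homog \<phi> X k h = (\<Sum>\<alpha>\<in>words k. \<phi> \<alpha> *\<^sub>C op_power X \<alpha> h)"

text \<open>
  The sum of the series by homogeneous degree, taken pointwise; it is also the value of the series
  whenever it converges in norm.
\<close>

definition nc_eval :: "'n :: finite ncfps \<Rightarrow> ('n \<Rightarrow> 'h \<Rightarrow> 'h) \<Rightarrow> 'h \<Rightarrow> 'h :: chilbert_space" where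
  "nc_eval \<phi> X h = (\<Sum>k. nc_homog \<phi> X k h)"

definition scale_tuple :: "real \<Rightarrow> ('n \<Rightarrow> 'h \<Rightarrow> 'h) \<Rightarrow> 'n \<Rightarrow> 'h \<Rightarrow> 'h :: chilbert_space" where
  "scale_tuple r X i h = r *\<^sub>R X i h"

definition SOT_convergent :: "'n :: finite ncfps \<Rightarrow> ('n \<Rightarrow> 'h \<Rightarrow> 'h :: chilbert_space) \<Rightarrow> bool" where
  "SOT_convergent \<phi> X \<longleftrightarrow> (\<exists>A. bounded_clinear A \<and> (\<forall>h. (\<lambda>k. nc_homog \<phi> X k h) sums A h))"

definition norm_convergent :: "'n :: finite ncfps \<Rightarrow> ('n \<Rightarrow> 'h \<Rightarrow> 'h :: chilbert_space) \<Rightarrow> bool" where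
  "norm_convergent \<phi> X \<longleftrightarrow> (\<exists>A. bounded_clinear A \<and>
     (\<lambda>m. onorm (\<lambda>h. (\<Sum>k<m. nc_homog \<phi> X k h) - A h)) \<longlonglongrightarrow> 0)"

definition C_SOT :: "('n :: finite \<Rightarrow> 'n ncfps) \<Rightarrow> ('n \<Rightarrow> 'h :: chilbert_space \<Rightarrow> 'h) set" where
  "C_SOT f = {X. (\<forall>i. bounded_clinear (X i)) \<and> (\<forall>j. SOT_convergent (f j) X)}"

definition C_rad :: "('n :: finite \<Rightarrow> 'n ncfps) \<Rightarrow> ('n \<Rightarrow> 'h :: chilbert_space \<Rightarrow> 'h) set" where
  "C_rad f = {X. (\<forall>i. bounded_clinear (X i)) \<and>
     (\<exists>\<delta>\<in>{0<..<1}. \<forall>r\<in>{\<delta><..<1}. \<forall>j. norm_convergent (f j) (scale_tuple r X)) \<and>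
     (\<forall>j. \<exists>A. bounded_clinear A \<and>
        (\<forall>h. ((\<lambda>r. nc_eval (f j) (scale_tuple r X) h) \<longlongrightarrow> A h) (at_left 1)))}"

text \<open>
  The operators \<open>f\<^sub>j(X)\<close> for \<open>X \<in> C_SOT f \<union> C_rad f\<close>.  By Abel's theorem both definitions agree on the
  intersection.
\<close>

definition tuple_eval :: "('n :: finite \<Rightarrow> 'n ncfps) \<Rightarrow> ('n \<Rightarrow> 'h \<Rightarrow> 'h) \<Rightarrow> 'n \<Rightarrow> 'h \<Rightarrow> 'h :: chilbert_space" where
  "tuple_eval f X j h = (if X \<in> C_SOT f then nc_eval (f j) X h
     else Lim (at_left 1) (\<lambda>r. nc_eval (f j) (scale_tuple r X) h))"

section \<open>The model property\<close>

text \<open>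
  A vector of \<open>H\<^sup>2(f)\<close> is represented by the family \<open>(a\<^sub>\<alpha>)\<close> of its coordinates with respect to the
  orthonormal basis \<open>(f\<^sub>\<alpha>)\<close>, so the underlying Hilbert space is \<open>\<ell>\<^sup>2\<close> of the free semigroup, and
  \<open>H\<^sup>2(f) \<otimes> 'k\<close> is \<open>('n list, 'k) hsum\<close>.  The three cases below differ in the object represented by \<open>a\<close>.

  \<open>model f g M\<close> says that \<open>f\<close> has the model property, that \<open>Z\<^sub>i = \<Sum>\<^sub>\<alpha> (g i)\<^sub>\<alpha> f\<^sub>\<alpha>\<close> in \<open>H\<^sup>2(f)\<close>, and that \<open>M i\<close>
  is the operator of left multiplication by \<open>Z\<^sub>i\<close>.  Both \<open>g\<close> and \<open>M\<close> are determined by \<open>f\<close>.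
\<close>

type_synonym 'n H2 = "('n list, complex) hsum"

text \<open>
  Polynomial automorphisms: a finitely supported \<open>a\<close> represents the polynomial \<open>\<Sum>\<^sub>\<alpha> a\<^sub>\<alpha> f\<^sub>\<alpha>\<close>.  These are
  dense, so the condition on polynomials determines the bounded operator \<open>M i\<close> on the completion.
\<close>

definition model_poly ::
  "('n :: finite \<Rightarrow> 'n ncfps) \<Rightarrow> ('n \<Rightarrow> 'n ncfps) \<Rightarrow> ('n \<Rightarrow> 'n H2 \<Rightarrow> 'n H2) \<Rightarrow> bool" where
  "model_poly f g M \<longleftrightarrow>
     (\<forall>i. nc_polynomial (f i)) \<and> (\<forall>i. nc_polynomial (g i)) \<and>
     (\<forall>i. nc_compose (f i) g = nc_var i) \<and> (\<forall>i. nc_compose (g i) f = nc_var i) \<and>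
     (\<forall>i. bounded_clinear (M i)) \<and>
     (\<forall>i x. nc_polynomial (hnth x) \<longrightarrow> nc_polynomial (hnth (M i x)) \<and>
        nc_compose (hnth (M i x)) f = nc_mult (nc_var i) (nc_compose (hnth x) f))"

text \<open>Formal power series: \<open>a\<close> represents the formal power series \<open>\<Sum>\<^sub>\<alpha> a\<^sub>\<alpha> f\<^sub>\<alpha>\<close>.\<close>

definition model_series ::
  "('n :: finite \<Rightarrow> 'n ncfps) \<Rightarrow> ('n \<Rightarrow> 'n ncfps) \<Rightarrow> ('n \<Rightarrow> 'n H2 \<Rightarrow> 'n H2) \<Rightarrow> bool" where
  "model_series f g M \<longleftrightarrow>
     (\<forall>i. f i [] = 0) \<and> (\<forall>i. nc_radius (f i) > 0) \<and> det (jacobian0 f) \<noteq> 0 \<and>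
     (\<forall>i. l2_summable (g i) \<and> nc_compose (g i) f = nc_var i) \<and>
     (\<forall>i. bounded_clinear (M i)) \<and>
     (\<forall>i x. nc_compose (hnth (M i x)) f = nc_mult (nc_var i) (nc_compose (hnth x) f)) \<and>
     M \<in> C_SOT f \<union> C_rad f \<and>
     (\<forall>j x. nc_compose (hnth (tuple_eval f M j x)) f = nc_mult (f j) (nc_compose (hnth x) f))"

text \<open>
  Free holomorphic functions: \<open>a\<close> represents \<open>G \<circ> f\<close> with \<open>G = \<Sum>\<^sub>\<alpha> a\<^sub>\<alpha> Z\<^sub>\<alpha>\<close>, a function on the row ball
  of radius \<open>\<gamma>\<close> over a separable infinite-dimensional Hilbert space, for which \<open>\<ell>\<^sup>2(\<nat>)\<close> is taken.
\<close>

definition free_image ::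
  "('n :: finite \<Rightarrow> 'n ncfps) \<Rightarrow> ('n \<Rightarrow> 'h \<Rightarrow> 'h) \<Rightarrow> 'n \<Rightarrow> 'h \<Rightarrow> 'h :: chilbert_space" where
  "free_image f X j = nc_eval (f j) X"

definition model_free ::
  "('n :: finite \<Rightarrow> 'n ncfps) \<Rightarrow> ('n \<Rightarrow> 'n ncfps) \<Rightarrow> ('n \<Rightarrow> 'n H2 \<Rightarrow> 'n H2) \<Rightarrow> bool" where
  "model_free f g M \<longleftrightarrow> (\<exists>\<gamma>>0.
     let Ball = row_ball \<gamma> :: ('n \<Rightarrow> (nat, complex) hsum \<Rightarrow> (nat, complex) hsum) set in
     (\<forall>j. nc_radius (f j) \<ge> ereal \<gamma>) \<and>
     (\<forall>X\<in>Ball. free_image f X \<in> row_ball 1) \<and>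
     (\<forall>G. nc_radius G \<ge> 1 \<and> G \<noteq> (\<lambda>_. 0) \<longrightarrow> (\<exists>X\<in>Ball. nc_eval G (free_image f X) \<noteq> (\<lambda>_. 0))) \<and>
     (\<forall>i. l2_summable (g i) \<and> (\<forall>X\<in>Ball. nc_eval (g i) (free_image f X) = X i)) \<and>
     (\<forall>i. bounded_clinear (M i)) \<and>
     (\<forall>i x. \<forall>X\<in>Ball. nc_eval (hnth (M i x)) (free_image f X) =
        X i \<circ> nc_eval (hnth x) (free_image f X)) \<and>
     M \<in> C_SOT f \<union> C_rad f \<and>
     (\<forall>j x. \<forall>X\<in>Ball. nc_eval (hnth (tuple_eval f M j x)) (free_image f X) =
        free_image f X j \<circ> nc_eval (hnth x) (free_image f X)))"

definition model ::
  "('n :: finite \<Rightarrow> 'n ncfps) \<Rightarrow> ('n \<Rightarrow> 'n ncfps) \<Rightarrow> ('n \<Rightarrow> 'n H2 \<Rightarrow> 'n H2) \<Rightarrow> bool" where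
  "model f g M \<longleftrightarrow> model_poly f g M \<or> model_series f g M \<or> model_free f g M"

definition nc_domain ::
  "('n :: finite \<Rightarrow> 'n ncfps) \<Rightarrow> ('n \<Rightarrow> 'n ncfps) \<Rightarrow> ('n \<Rightarrow> 'h :: chilbert_space \<Rightarrow> 'h) set" where
  "nc_domain f g = {X. X \<in> C_SOT f \<union> C_rad f \<and>
     ((\<forall>i h. (\<lambda>k. nc_homog (g i) (tuple_eval f X) k h) sums X i h) \<or>
      (\<forall>i h. ((\<lambda>r. nc_eval (g i) (scale_tuple r (tuple_eval f X)) h) \<longlongrightarrow> X i h) (at_left 1))) \<and>
     onorm (row_op (tuple_eval f X)) \<le> 1}"

section \<open>Defect operators, Poisson kernel and characteristic function\<close>

definition defect :: "('n :: finite \<Rightarrow> 'n ncfps) \<Rightarrow> ('n \<Rightarrow> 'h \<Rightarrow> 'h) \<Rightarrow> 'h \<Rightarrow> 'h :: chilbert_space" where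
  "defect f T = sqrt_op (\<lambda>h. h - (\<Sum>i\<in>UNIV. tuple_eval f T i (cadj (tuple_eval f T i) h)))"

definition defect_star ::
  "('n :: finite \<Rightarrow> 'n ncfps) \<Rightarrow> ('n \<Rightarrow> 'h \<Rightarrow> 'h) \<Rightarrow> ('n, 'h :: chilbert_space) hsum \<Rightarrow> ('n, 'h) hsum" where
  "defect_star f T = sqrt_op (\<lambda>x. x - cadj (row_op (tuple_eval f T)) (row_op (tuple_eval f T) x))"

definition defect_space :: "('n :: finite \<Rightarrow> 'n ncfps) \<Rightarrow> ('n \<Rightarrow> 'h \<Rightarrow> 'h) \<Rightarrow> 'h :: chilbert_space set" where
  "defect_space f T = closure (range (defect f T))"

definition defect_star_space ::
  "('n :: finite \<Rightarrow> 'n ncfps) \<Rightarrow> ('n \<Rightarrow> 'h \<Rightarrow> 'h) \<Rightarrow> ('n, 'h :: chilbert_space) hsum set" where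
  "defect_star_space f T = closure (range (defect_star f T))"

definition rank_f :: "('n :: finite \<Rightarrow> 'n ncfps) \<Rightarrow> ('n \<Rightarrow> 'h \<Rightarrow> 'h :: chilbert_space) \<Rightarrow> nat" where
  "rank_f f T = cdim (range (defect f T))"

text \<open>\<open>H\<^sup>2(f) \<otimes> D\<close> for a closed subspace \<open>D\<close>, and the operator \<open>I \<otimes> A\<close>.\<close>

definition H2_tensor :: "'k :: chilbert_space set \<Rightarrow> ('n list, 'k) hsum set" where
  "H2_tensor D = {x. \<forall>\<alpha>. hnth x \<alpha> \<in> D}"

definition ampl ::
  "('k \<Rightarrow> 'l) \<Rightarrow> ('n list, 'k :: chilbert_space) hsum \<Rightarrow> ('n list, 'l :: chilbert_space) hsum" where
  "ampl A x = Abs_hsum (\<lambda>\<alpha>. A (hnth x \<alpha>))"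

text \<open>\<open>Q\<^sub>m \<otimes> I\<close>, \<open>Q\<^sub>\<le>\<^sub>m \<otimes> I\<close> and \<open>\<Lambda>\<^sub>i \<otimes> I\<close>, where \<open>\<Lambda>\<^sub>i\<close> maps \<open>f\<^sub>\<alpha>\<close> to \<open>f\<^sub>\<beta>\<close> with \<open>\<beta> = \<alpha> g\<^sub>i\<close>.\<close>

definition Q_eq :: "nat \<Rightarrow> ('n list, 'k :: chilbert_space) hsum \<Rightarrow> ('n list, 'k) hsum" where
  "Q_eq m x = Abs_hsum (\<lambda>\<alpha>. if length \<alpha> = m then hnth x \<alpha> else 0)"

definition Q_le :: "nat \<Rightarrow> ('n list, 'k :: chilbert_space) hsum \<Rightarrow> ('n list, 'k) hsum" where
  "Q_le m x = Abs_hsum (\<lambda>\<alpha>. if length \<alpha> \<le> m then hnth x \<alpha> else 0)"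

definition right_mult :: "'n \<Rightarrow> ('n list, 'k :: chilbert_space) hsum \<Rightarrow> ('n list, 'k) hsum" where
  "right_mult i x = Abs_hsum (\<lambda>\<beta>. if \<beta> \<noteq> [] \<and> last \<beta> = i then hnth x (butlast \<beta>) else 0)"

definition poisson_kernel ::
  "('n :: finite \<Rightarrow> 'n ncfps) \<Rightarrow> ('n \<Rightarrow> 'h \<Rightarrow> 'h) \<Rightarrow> 'h \<Rightarrow> ('n list, 'h :: chilbert_space) hsum" where
  "poisson_kernel f T h =
     Abs_hsum (\<lambda>\<alpha>. defect f T (cadj (op_power (tuple_eval f T) \<alpha>) h))"

text \<open>
  The Fourier representation with \<open>\<Lambda>\<^sub>i\<close> replaced by \<open>r \<Lambda>\<^sub>i\<close>; the characteristic function is its limit.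
  It is used as an operator from \<open>H2_tensor (defect_star_space f T)\<close> to \<open>H2_tensor (defect_space f T)\<close>.
\<close>

definition char_fun_r ::
  "('n :: finite \<Rightarrow> 'n ncfps) \<Rightarrow> ('n \<Rightarrow> 'h \<Rightarrow> 'h) \<Rightarrow> real \<Rightarrow>
     ('n list, ('n, 'h :: chilbert_space) hsum) hsum \<Rightarrow> ('n list, 'h) hsum" where
  "char_fun_r f T r x =
     - ampl (row_op (tuple_eval f T)) x +
     ampl (defect f T)
       (inv (\<lambda>y. y - (\<Sum>i\<in>UNIV. r *\<^sub>R right_mult i (ampl (cadj (tuple_eval f T i)) y)))
         (\<Sum>i\<in>UNIV. r *\<^sub>R right_mult i (ampl (\<lambda>v. hnth v i) (ampl (defect_star f T) x))))"

definition char_fun ::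
  "('n :: finite \<Rightarrow> 'n ncfps) \<Rightarrow> ('n \<Rightarrow> 'h \<Rightarrow> 'h) \<Rightarrow>
     ('n list, ('n, 'h :: chilbert_space) hsum) hsum \<Rightarrow> ('n list, 'h) hsum" where
  "char_fun f T x = Lim (at_left 1) (\<lambda>r. char_fun_r f T r x)"

definition char_fun_adj ::
  "('n :: finite \<Rightarrow> 'n ncfps) \<Rightarrow> ('n \<Rightarrow> 'h \<Rightarrow> 'h) \<Rightarrow>
     ('n list, 'h :: chilbert_space) hsum \<Rightarrow> ('n list, ('n, 'h) hsum) hsum" where
  "char_fun_adj f T =
     cadj_on (H2_tensor (defect_star_space f T)) (H2_tensor (defect_space f T)) (char_fun f T)"

section \<open>Curvature\<close>

definition poisson_trace :: "('n :: finite \<Rightarrow> 'n ncfps) \<Rightarrow> ('n \<Rightarrow> 'h \<Rightarrow> 'h :: chilbert_space) \<Rightarrow> nat \<Rightarrow> complex" where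
  "poisson_trace f T m =
     optrace (\<lambda>h. cadj_on UNIV (H2_tensor (defect_space f T)) (poisson_kernel f T)
       (Q_le m (poisson_kernel f T h)))"

definition curv_seq ::
  "('n :: finite \<Rightarrow> 'n ncfps) \<Rightarrow> ('n \<Rightarrow> 'n H2 \<Rightarrow> 'n H2) \<Rightarrow> ('n \<Rightarrow> 'h \<Rightarrow> 'h :: chilbert_space) \<Rightarrow> nat \<Rightarrow> complex" where
  "curv_seq f M T m = poisson_trace f T m / poisson_trace f M m"

definition curv ::
  "('n :: finite \<Rightarrow> 'n ncfps) \<Rightarrow> ('n \<Rightarrow> 'n H2 \<Rightarrow> 'n H2) \<Rightarrow> ('n \<Rightarrow> 'h \<Rightarrow> 'h :: chilbert_space) \<Rightarrow> complex" where
  "curv f M T = lim (curv_seq f M T)"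

definition weight_N :: "('n :: finite list, 'k :: chilbert_space) hsum \<Rightarrow> ('n list, 'k) hsum" where
  "weight_N x = (\<Sum>k. (1 / real CARD('n) ^ k) *\<^sub>R Q_eq k x)"

text \<open>
  The trace of an operator on the graded space \<open>H\<^sup>2(f) \<otimes> D = \<Oplus>\<^sub>k Q\<^sub>k H\<^sup>2(f) \<otimes> D\<close>, computed in
  orthonormal bases of homogeneous vectors, such as \<open>(f\<^sub>\<alpha> \<otimes> d\<^sub>j)\<close>.  For the characteristic function
  \<open>\<Theta>\<close> the operator \<open>\<Theta> (Q\<^sub>0 \<otimes> I) \<Theta>\<^sup>* N\<close> need not be trace class, so arbitrary orthonormal bases cannot be
  allowed here; in homogeneous ones all its diagonal entries are nonnegative.
\<close>

definition has_graded_trace ::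
  "'k set \<Rightarrow> (('n list, 'k :: chilbert_space) hsum \<Rightarrow> ('n list, 'k) hsum) \<Rightarrow> complex \<Rightarrow> bool" where
  "has_graded_trace D A t \<longleftrightarrow>
     (\<forall>E. is_onb (H2_tensor D) E \<and> (\<forall>e\<in>E. \<exists>k. Q_eq k e = e) \<longrightarrow> has_diagonal_sum A E t)"

end

theory Submission
  imports Defs
begin

text \<open>
  Let \<open>A\<^sub>i = f\<^sub>i(T)\<close>, a row contraction with defect operator \<open>\<Delta>\<close> of finite rank, let \<open>(d\<^sub>j)\<close> be an
  orthonormal basis of the range of \<open>\<Delta>\<close>, and let \<open>\<tau>\<^sub>k\<close> be the sum of \<open>\<parallel>A\<^sub>\<alpha> \<Delta> d\<^sub>j\<parallel>\<^sup>2\<close> over \<open>j\<close> and the words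
  \<open>\<alpha>\<close> of length \<open>k\<close>.  By Parseval's identity the trace in the numerator of the curvature is
  \<open>\<tau>\<^sub>0 + \<dots> + \<tau>\<^sub>m\<close>; for the universal model the \<open>A\<^sub>i\<close> are the left creation operators and \<open>\<tau>\<^sub>k = n\<^sup>k\<close>.  Since
  \<open>\<tau>\<^sub>k\<^sub>+\<^sub>1 \<le> n \<tau>\<^sub>k\<close>, the numbers \<open>\<tau>\<^sub>k / n\<^sup>k\<close> decrease to a limit, which is the curvature.
  On the component of degree \<open>k + 1\<close> the operator \<open>\<Theta> (Q\<^sub>0 \<otimes> I) \<Theta>\<^sup>*\<close> has trace \<open>n \<tau>\<^sub>k - \<tau>\<^sub>k\<^sub>+\<^sub>1\<close>, and on
  that of degree \<open>0\<close> it has trace \<open>rank - \<tau>\<^sub>0\<close>, so the weights of \<open>N\<close> make the graded trace telescope.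
\<close>

section \<open>Hilbert spaces\<close>

text \<open>Square roots, adjoints and traces are given by choice or description, so nothing can be
  computed before existence and uniqueness are known. The obstacle in the characteristic function
  \<Theta> is the limit r \<rightarrow> 1: at r = 1 the inverse in its Fourier representation need
  not exist. It is therefore treated as the transfer function of an isometric operator matrix built
  from f(T) and the two defect operators, which bounds its coordinates uniformly in r \<le> 1. A
  diagonal entry of the operator in the trace at a homogeneous vector is a weighted squared norm, so
  sums over infinite bases may be regrouped by degree. The three forms of the model property differ
  in what a coordinate family represents, but in each the family is determined by the represented
  object: through the invertible Jacobian, the nondegeneracy of f, or substitution of g. This forces
  f_j(M_Z) to be the shift that prepends the letter j.\<close>

instance chilbert_space \<subseteq> banach
  by standard

lemma cinner_add_right: "cinner x (y + z) = cinner x y + cinner x (z :: 'a :: chilbert_space)"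
  by (metis cinner_add_left cinner_commute complex_cnj_add)

lemma cinner_scaleC_right: "cinner x (a *\<^sub>C y) = cnj a * cinner x (y :: 'a :: chilbert_space)"
  by (metis cinner_commute cinner_scaleC_left complex_cnj_mult)

lemma cinner_scaleR_left: "cinner (r *\<^sub>R x) y = of_real r * cinner x (y :: 'a :: chilbert_space)"
  by (metis cinner_scaleC_left scaleC_of_real)

lemma cinner_scaleR_right: "cinner x (r *\<^sub>R y) = of_real r * cinner x (y :: 'a :: chilbert_space)"
  by (metis cinner_scaleC_right complex_cnj_complex_of_real scaleC_of_real)

lemma cinner_zero [simp]:
  "cinner 0 x = 0" "cinner x 0 = 0" for x :: "'a :: chilbert_space"
  using cinner_scaleR_left[of 0 0 x] cinner_scaleR_right[of x 0 0] by simp_all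

lemma cinner_minus_left [simp]: "cinner (- x) y = - cinner x (y :: 'a :: chilbert_space)"
  using cinner_scaleR_left[of "-1" x y] by simp

lemma cinner_minus_right [simp]: "cinner x (- y) = - cinner x (y :: 'a :: chilbert_space)"
  using cinner_scaleR_right[of x "-1" y] by simp

lemma cinner_diff_left: "cinner (x - y) z = cinner x z - cinner y (z :: 'a :: chilbert_space)"
  using cinner_add_left[of x "- y" z] by simp

lemma cinner_diff_right: "cinner x (y - z) = cinner x y - cinner x (z :: 'a :: chilbert_space)"
  using cinner_add_right[of x y "- z"] by simp

lemma cinner_sum_left: "cinner (\<Sum>i\<in>I. u i) y = (\<Sum>i\<in>I. cinner (u i) (y :: 'a :: chilbert_space))"
  by (induction I rule: infinite_finite_induct) (auto simp: cinner_add_left)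

lemma cinner_sum_right: "cinner y (\<Sum>i\<in>I. u i) = (\<Sum>i\<in>I. cinner (y :: 'a :: chilbert_space) (u i))"
  by (induction I rule: infinite_finite_induct) (auto simp: cinner_add_right)

lemmas cinner_simps = cinner_add_left cinner_add_right cinner_diff_left cinner_diff_right
  cinner_scaleC_left cinner_scaleC_right cinner_sum_left cinner_sum_right

text \<open>Multiplying \<open>u\<close> by the imaginary unit turns the imaginary part of the inner
  product into a real part, so facts on the real inner product lift to the complex one.\<close>

lemma cinner_eq_iff_inner: 
  fixes u v :: "'a :: chilbert_space" and u' v' :: "'b :: chilbert_space"
  assumes "inner u v = inner u' v'" "inner (\<i> *\<^sub>C u) v = inner (\<i> *\<^sub>C u') v'"
  shows "cinner u v = cinner u' v'"
  using assms by (intro complex_eqI) (simp_all add: inner_eq_Re_cinner cinner_scaleC_left)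

lemma cinner_ext:
  fixes x y :: "'a :: chilbert_space"
  assumes "\<And>z. cinner z x = cinner z y" shows "x = y"
proof -
  have "cinner (x - y) (x - y) = 0" using assms by (simp add: cinner_diff_right)
  thus ?thesis by (simp add: cinner_self)
qed

lemma bounded_bilinear_cinner: "bounded_bilinear (cinner :: 'a :: chilbert_space \<Rightarrow> 'a \<Rightarrow> complex)"
proof
  show "\<exists>K. \<forall>a b :: 'a. cmod (cinner a b) \<le> norm a * norm b * K"
  proof (intro exI allI)
    show "cmod (cinner a b) \<le> norm a * norm b * 2" for a b :: 'a
      using norm_cinner_le[of a b] by simp
  qed
qed (auto simp: cinner_simps cinner_scaleR_left cinner_scaleR_right scaleR_conv_of_real)

lemma Re_cinner_self: "Re (cinner x x) = (norm (x :: 'a :: chilbert_space))\<^sup>2"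
  by (simp add: cinner_self)

lemma cmod_cinner_commute: "cmod (cinner x y) = cmod (cinner y (x :: 'a :: chilbert_space))"
  by (metis cinner_commute complex_mod_cnj)

lemma complex_scaleC [simp]: "a *\<^sub>C (x :: complex) = a * x"
  by (simp add: scaleC_complex_def)

subsection \<open>Bounded operators\<close>

lemma bounded_clinear_linear: "bounded_clinear A \<Longrightarrow> bounded_linear A"
  by (simp add: bounded_clinear_def)

lemma bounded_clinear_simps:
  assumes "bounded_clinear A"
  shows "A (x + y) = A x + A y" "A (x - y) = A x - A y" "A 0 = 0" "A (- x) = - A x"
    "A (r *\<^sub>R x) = r *\<^sub>R A x" "A (c *\<^sub>C x) = c *\<^sub>C A x"
    "A (\<Sum>i\<in>I. u i) = (\<Sum>i\<in>I. A (u i))"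
proof -
  interpret bounded_linear A by (rule bounded_clinear_linear[OF assms])
  show "A (x + y) = A x + A y" "A (x - y) = A x - A y" "A 0 = 0" "A (- x) = - A x"
    "A (r *\<^sub>R x) = r *\<^sub>R A x" "A (\<Sum>i\<in>I. u i) = (\<Sum>i\<in>I. A (u i))"
    by (fact add diff zero neg scaleR sum)+
  show "A (c *\<^sub>C x) = c *\<^sub>C A x" using assms by (simp add: bounded_clinear_def)
qed

lemma bounded_clinearI:
  assumes "\<And>x y. A (x + y) = A x + A y" "\<And>c x. A (c *\<^sub>C x) = c *\<^sub>C A x"
    "\<And>x. norm (A x) \<le> norm x * K"
  shows "bounded_clinear A"
  unfolding bounded_clinear_def
proof
  show "bounded_linear A"
    by (rule bounded_linear_intro[where K = K])
      (use assms in \<open>auto simp flip: scaleC_of_real\<close>)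
qed (use assms in auto)

lemma bounded_clinear_compose:
  "bounded_clinear A \<Longrightarrow> bounded_clinear B \<Longrightarrow> bounded_clinear (\<lambda>x. A (B x))"
  unfolding bounded_clinear_def by (auto intro: bounded_linear_compose)

lemma bounded_clinear_id: "bounded_clinear (\<lambda>x. x)"
  unfolding bounded_clinear_def by (auto intro: bounded_linear_ident)

lemma bounded_clinear_zero: "bounded_clinear (\<lambda>x. 0)"
  unfolding bounded_clinear_def by (auto intro: bounded_linear_zero)

lemma bounded_clinear_diff:
  "bounded_clinear A \<Longrightarrow> bounded_clinear B \<Longrightarrow> bounded_clinear (\<lambda>x. A x - B x)"
  unfolding bounded_clinear_def
  by (auto intro: bounded_linear_sub simp: complex_vector.scale_right_diff_distrib)

lemma bounded_clinear_add:
  "bounded_clinear A \<Longrightarrow> bounded_clinear B \<Longrightarrow> bounded_clinear (\<lambda>x. A x + B x)"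
  unfolding bounded_clinear_def
  by (auto intro: bounded_linear_add simp: scaleC_add_right)

lemma bounded_clinear_sum:
  "(\<And>i. i \<in> I \<Longrightarrow> bounded_clinear (A i)) \<Longrightarrow> bounded_clinear (\<lambda>x. \<Sum>i\<in>I. A i x)"
  by (induction I rule: infinite_finite_induct)
    (auto intro: bounded_clinear_zero bounded_clinear_add)

lemma bounded_clinear_scaleC:
  assumes "bounded_clinear A" shows "bounded_clinear (\<lambda>x. c *\<^sub>C A x)"
proof (rule bounded_clinear_compose[OF _ assms])
  show "bounded_clinear (\<lambda>x. c *\<^sub>C (x :: 'b))"
    by (rule bounded_clinearI[where K = "cmod c"])
      (auto simp: scaleC_add_right scaleC_scaleC norm_scaleC mult.commute)
qed

lemma bounded_clinear_bound:
  assumes "bounded_clinear A" obtains K where "K > 0" "\<And>x. norm (A x) \<le> norm x * K"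
  using bounded_linear.pos_bounded[OF bounded_clinear_linear[OF assms]] by blast

lemma bounded_clinear_continuous_on: "bounded_clinear A \<Longrightarrow> continuous_on S A"
  by (simp add: bounded_clinear_linear linear_continuous_on)

lemma bounded_clinear_tendsto:
  "bounded_clinear A \<Longrightarrow> (u \<longlongrightarrow> x) F \<Longrightarrow> ((\<lambda>t. A (u t)) \<longlongrightarrow> A x) F"
  by (rule bounded_linear.tendsto[OF bounded_clinear_linear])

subsection \<open>Riesz representation and adjoints\<close>

text \<open>The representing vector minimises \<open>\<parallel>x\<parallel>\<^sup>2 - 2 \<phi> x\<close>; minimising sequences are Cauchy by the
  parallelogram law.\<close>

lemma riesz_on_subspace:
  fixes \<phi> :: "'a :: {real_inner, complete_space} \<Rightarrow> real"
  assumes S: "closed S" "subspace S" and \<phi>: "bounded_linear \<phi>"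
  shows "\<exists>y\<in>S. \<forall>x\<in>S. \<phi> x = inner x y"
proof -
  interpret bounded_linear \<phi> by fact
  define J where "J x = (norm x)\<^sup>2 - 2 * \<phi> x" for x
  define m where "m = Inf (J ` S)"
  obtain K where K: "K > 0" "\<And>x. \<bar>\<phi> x\<bar> \<le> norm x * K"
    using pos_bounded by (auto simp: real_norm_def)
  have lower: "- K\<^sup>2 \<le> J x" for x
  proof -
    have "0 \<le> (norm x - K)\<^sup>2" by simp
    also have "\<dots> = (norm x)\<^sup>2 - 2 * (norm x * K) + K\<^sup>2" by (simp add: power2_diff)
    finally show ?thesis using K(2)[of x] unfolding J_def by linarith
  qed
  have bdd: "bdd_below (J ` S)" by (rule bdd_belowI2[OF lower])
  have m_le: "m \<le> J x" if "x \<in> S" for x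
    unfolding m_def using bdd that by (intro cInf_lower) auto
  have ne: "J ` S \<noteq> {}" using S(2) subspace_0 by blast
  have "\<exists>x\<in>S. J x < m + 1 / (real n + 1)" for n
    using cInf_lessD[OF ne, of "m + 1 / (real n + 1)"] by (auto simp: m_def[symmetric])
  then obtain u where u: "\<And>n. u n \<in> S" "\<And>n. J (u n) < m + 1 / (real n + 1)" by metis
  have para: "(norm (x - y))\<^sup>2 = 2 * J x + 2 * J y - 4 * J ((1/2) *\<^sub>R (x + y))" for x y
    unfolding J_def power2_norm_eq_inner
    by (simp add: scaleR add inner_simps inner_commute algebra_simps)
  have dist: "(norm (u i - u j))\<^sup>2 \<le> 2 / (real i + 1) + 2 / (real j + 1)" for i j
  proof -
    have "m \<le> J ((1/2) *\<^sub>R (u i + u j))"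
      using S(2) u(1) by (intro m_le subspace_mul subspace_add)
    with u(2)[of i] u(2)[of j] show ?thesis unfolding para by simp
  qed
  have "Cauchy u"
  proof (rule metric_CauchyI)
    fix e :: real assume e: "0 < e"
    obtain N where N: "4 / e\<^sup>2 < real N" using reals_Archimedean2 by blast
    have "dist (u i) (u j) < e" if "i \<ge> N" "j \<ge> N" for i j
    proof -
      have N1: "real N + 1 > 0" by simp
      have "2 / (real i + 1) \<le> 2 / (real N + 1)" "2 / (real j + 1) \<le> 2 / (real N + 1)"
        using that by (auto intro!: divide_left_mono)
      hence "(norm (u i - u j))\<^sup>2 \<le> 4 / (real N + 1)" using dist[of i j] by simp
      also have "\<dots> < e\<^sup>2"
      proof -
        have "4 < real N * e\<^sup>2" using N e by (simp add: pos_divide_less_eq)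
        also have "\<dots> \<le> (real N + 1) * e\<^sup>2" by (simp add: algebra_simps)
        finally show ?thesis using N1 by (simp add: pos_divide_less_eq mult.commute)
      qed
      finally show ?thesis using e by (simp add: dist_norm power2_less_imp_less)
    qed
    thus "\<exists>N. \<forall>i\<ge>N. \<forall>j\<ge>N. dist (u i) (u j) < e" by blast
  qed
  then obtain y where y: "u \<longlonglongrightarrow> y" unfolding Cauchy_convergent_iff convergent_def by blast
  have yS: "y \<in> S" using S(1) u(1) y closed_sequentially by blast
  have "(\<lambda>n. J (u n)) \<longlonglongrightarrow> J y"
    unfolding J_def by (intro tendsto_intros y tendsto)
  moreover have "(\<lambda>n. m + 1 / (real n + 1)) \<longlonglongrightarrow> m + 0"
    by (intro tendsto_add tendsto_const)
      (use LIMSEQ_inverse_real_of_nat in \<open>simp add: inverse_eq_divide add.commute\<close>)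
  ultimately have "J y \<le> m + 0"
    by (rule LIMSEQ_le) (use u(2) less_imp_le in blast)
  hence Jy: "J y \<le> J x" if "x \<in> S" for x using m_le[OF that] by simp
  have "\<phi> x = inner x y" if x: "x \<in> S" for x
  proof (rule ccontr)
    assume neq: "\<phi> x \<noteq> inner x y"
    define c where "c = \<phi> x - inner x y"
    have pos: "0 \<le> - 2 * t * c + t\<^sup>2 * (norm x)\<^sup>2" for t
    proof -
      have "J y \<le> J (y + t *\<^sub>R x)" using S(2) yS x by (intro Jy subspace_add subspace_mul)
      also have "\<dots> = J y + (- 2 * t * c + t\<^sup>2 * (norm x)\<^sup>2)"
        unfolding J_def c_def power2_norm_eq_inner
        by (simp add: add scaleR inner_simps inner_commute power2_eq_square algebra_simps)
      finally show ?thesis by simp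
    qed
    \<comment> \<open>The quadratic in \<open>t\<close> is least at c / |x|^2; the summand 1 keeps
      the denominator positive in all cases.\<close>
    define d where "d = (norm x)\<^sup>2 + 1"
    have d: "d > 0" "(norm x)\<^sup>2 \<le> d" unfolding d_def by (auto simp: add_nonneg_pos)
    have "- 2 * (c / d) * c + (c / d)\<^sup>2 * (norm x)\<^sup>2 \<le> - 2 * (c / d) * c + (c / d)\<^sup>2 * d"
      using d by (intro add_left_mono mult_left_mono) auto
    also have "\<dots> = - (c\<^sup>2 / d)" using d by (simp add: field_simps power2_eq_square)
    also have "\<dots> < 0" using neq d by (simp add: c_def)
    finally show False using pos[of "c / d"] by simp
  qed
  with yS show ?thesis by blast
qed

abbreviation csubspace :: "'a :: chilbert_space set \<Rightarrow> bool" where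
  "csubspace \<equiv> complex_vector.subspace"

lemma csubspace_imp_subspace: "csubspace S \<Longrightarrow> subspace S"
  unfolding subspace_def
  by (metis complex_vector.subspace_0 complex_vector.subspace_add complex_vector.subspace_scale
      scaleC_of_real)

lemma csubspace_UNIV [simp]: "csubspace UNIV"
  by (simp add: complex_vector.subspace_def)

text \<open>The real Riesz theorem represents the real part of the functional; as \<open>S\<close>
  is a complex subspace, testing at \<open>\<i> *\<^sub>C x\<close> shows that the same vector
  represents the imaginary part.\<close>

lemma adjoint_on_subspace_exists:
  assumes A: "bounded_clinear A" and S: "closed S" "csubspace S"
  shows "\<exists>z\<in>S. \<forall>x\<in>S. cinner (A x) y = cinner x z"
proof -
  have "bounded_linear (\<lambda>x. inner (A x) y)"
    using bounded_linear_compose[OF bounded_linear_inner_left bounded_clinear_linear[OF A]]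
    by simp
  from riesz_on_subspace[OF S(1) csubspace_imp_subspace[OF S(2)] this]
  obtain z where z: "z \<in> S" "\<And>x. x \<in> S \<Longrightarrow> inner (A x) y = inner x z" by blast
  have "cinner (A x) y = cinner x z" if "x \<in> S" for x
    using z(2)[OF that] z(2)[OF complex_vector.subspace_scale[OF S(2) that, of \<i>]]
    by (intro cinner_eq_iff_inner) (simp_all add: bounded_clinear_simps[OF A])
  with z(1) show ?thesis by blast
qed

text \<open>\<open>cadj_on\<close> is a choice, so its property rests on a witness. One Riesz vector
  for each \<open>y\<close> provides it, as the description asks for no linearity in
  \<open>y\<close>.\<close>

lemma
  assumes A: "bounded_clinear A" and S: "closed S" "csubspace S" and y: "y \<in> S'"
  shows cadj_on_mem: "cadj_on S S' A y \<in> S"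
    and cadj_on: "x \<in> S \<Longrightarrow> cinner (A x) y = cinner x (cadj_on S S' A y)"
proof -
  obtain B where "\<And>y. B y \<in> S \<and> (\<forall>x\<in>S. cinner (A x) y = cinner x (B y))"
    using adjoint_on_subspace_exists[OF A S] by metis
  hence "\<exists>B. (\<forall>y\<in>S'. B y \<in> S) \<and> (\<forall>x\<in>S. \<forall>y\<in>S'. cinner (A x) y = cinner x (B y))" by blast
  from someI_ex[OF this, folded cadj_on_def] y
  show "cadj_on S S' A y \<in> S"
    and "x \<in> S \<Longrightarrow> cinner (A x) y = cinner x (cadj_on S S' A y)" by blast+
qed

lemma cadj: "bounded_clinear A \<Longrightarrow> cinner (A x) y = cinner x (cadj A y)"
  by (rule cadj_on) auto

lemma cadj': "bounded_clinear A \<Longrightarrow> cinner (cadj A x) y = cinner x (A y)"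
  by (metis cadj cinner_commute)

lemma cadj_eqI:
  assumes "\<And>x y. cinner (A x) y = cinner x (B y)" and "bounded_clinear A"
  shows "cadj A = B"
  by (rule ext, rule cinner_ext) (use assms cadj in metis)

lemma cadj_id [simp]: "cadj (\<lambda>x. x) = (\<lambda>x. x)"
  by (rule cadj_eqI[OF refl bounded_clinear_id])

lemma cadj_norm_le:
  assumes A: "bounded_clinear A" and K: "\<And>x. norm (A x) \<le> norm x * K" and K0: "0 \<le> K"
  shows "norm (cadj A y) \<le> norm y * K"
proof (cases "cadj A y = 0")
  case True
  thus ?thesis using K0 by simp
next
  case False
  have "norm (cadj A y) * norm (cadj A y) = Re (cinner (A (cadj A y)) y)"
    by (simp add: cadj[OF A] Re_cinner_self power2_eq_square)
  also have "\<dots> \<le> norm (A (cadj A y)) * norm y"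
    unfolding inner_eq_Re_cinner[symmetric] by (rule norm_cauchy_schwarz)
  also have "\<dots> \<le> norm (cadj A y) * K * norm y" by (intro mult_right_mono K) auto
  also have "\<dots> = norm (cadj A y) * (norm y * K)" by simp
  finally show ?thesis using False by (simp add: mult_le_cancel_left)
qed

lemma bounded_clinear_cadj:
  assumes A: "bounded_clinear A" shows "bounded_clinear (cadj A)"
proof -
  obtain K where "0 < K" "\<And>x. norm (A x) \<le> norm x * K" using bounded_clinear_bound[OF A] by blast
  note K = cadj_norm_le[OF A this(2) less_imp_le[OF this(1)]]
  show ?thesis
    by (rule bounded_clinearI[OF _ _ K])
      (rule cinner_ext, simp add: cinner_simps flip: cadj[OF A])+
qed

lemma csubspace_closure: "csubspace S \<Longrightarrow> csubspace (closure (S :: 'a :: chilbert_space set))"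
  unfolding complex_vector.subspace_def
proof (intro conjI ballI allI)
  assume S: "0 \<in> S \<and> (\<forall>x\<in>S. \<forall>y\<in>S. x + y \<in> S) \<and> (\<forall>c. \<forall>x\<in>S. c *\<^sub>C x \<in> S)"
  show "0 \<in> closure S" using S closure_subset by blast
  show "x + y \<in> closure S" if xy: "x \<in> closure S" "y \<in> closure S" for x y
  proof -
    obtain u v where "\<And>n. u n \<in> S" "u \<longlonglongrightarrow> x" "\<And>n. v n \<in> S" "v \<longlonglongrightarrow> y"
      using xy unfolding closure_sequential by blast
    with S have "\<forall>n. u n + v n \<in> S" "(\<lambda>n. u n + v n) \<longlonglongrightarrow> x + y" by (auto intro: tendsto_add)
    thus ?thesis unfolding closure_sequential by (intro exI[of _ "\<lambda>n. u n + v n"] conjI)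
  qed
  show "c *\<^sub>C x \<in> closure S" if x: "x \<in> closure S" for c x
  proof -
    obtain u where u: "\<And>n. u n \<in> S" "u \<longlonglongrightarrow> x" using x unfolding closure_sequential by blast
    have "(\<lambda>n. c *\<^sub>C u n) \<longlonglongrightarrow> c *\<^sub>C x"
      by (rule bounded_clinear_tendsto[OF bounded_clinear_scaleC[OF bounded_clinear_id] u(2)])
    with S u(1) show ?thesis unfolding closure_sequential
      by (intro exI[of _ "\<lambda>n. c *\<^sub>C u n"]) blast
  qed
qed

lemma csubspace_range: "bounded_clinear A \<Longrightarrow> csubspace (range A)"
  unfolding complex_vector.subspace_def
  by (auto simp: image_iff) (metis bounded_clinear_simps(3), metis bounded_clinear_simps(1),
      metis bounded_clinear_simps(6))

subsection \<open>Orthonormal bases\<close>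

text \<open>Zorn's lemma gives a maximal orthonormal system; a nonzero vector orthogonal to it could
  be normalised and added.\<close>

lemma onb_exists:
  assumes S: "csubspace (S :: 'a :: chilbert_space set)"
  shows "\<exists>E. is_onb S E"
proof -
  define P where "P = {E. E \<subseteq> S \<and> (\<forall>e\<in>E. \<forall>e'\<in>E. cinner e e' = (if e = e' then 1 else 0))}"
  have "\<exists>M\<in>P. \<forall>X\<in>P. M \<subseteq> X \<longrightarrow> X = M"
  proof (rule subset_Zorn)
    fix C assume C: "subset.chain P C"
    have "\<Union>C \<in> P"
      unfolding P_def
    proof (intro CollectI conjI ballI)
      show "\<Union>C \<subseteq> S" using C unfolding subset.chain_def P_def by blast
      fix e e' assume "e \<in> \<Union>C" "e' \<in> \<Union>C"
      then obtain X Y where XY: "X \<in> C" "Y \<in> C" "e \<in> X" "e' \<in> Y" by blast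
      hence "X \<subseteq> Y \<or> Y \<subseteq> X" using C unfolding subset_chain_def by blast
      with XY obtain X where "X \<in> C" "e \<in> X" "e' \<in> X" by blast
      thus "cinner e e' = (if e = e' then 1 else 0)"
        using C unfolding subset.chain_def P_def by blast
    qed
    thus "\<exists>U\<in>P. \<forall>X\<in>C. X \<subseteq> U" by blast
  qed
  then obtain M where M: "M \<in> P" "\<And>X. X \<in> P \<Longrightarrow> M \<subseteq> X \<Longrightarrow> X = M" by blast
  have "x = 0" if x: "x \<in> S" "\<forall>e\<in>M. cinner x e = 0" for x
  proof (rule ccontr)
    assume "x \<noteq> 0"
    define u where "u = of_real (1 / norm x) *\<^sub>C x"
    have uu: "cinner u u = 1"
      using \<open>x \<noteq> 0\<close> by (simp add: u_def cinner_self norm_scaleC norm_divide)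
    have ue: "cinner u e = 0" "cinner e u = 0" if "e \<in> M" for e
      using x(2) that cinner_commute[of e u] by (simp_all add: u_def cinner_simps)
    have "u \<in> S" unfolding u_def by (rule complex_vector.subspace_scale[OF S x(1)])
    hence "insert u M \<in> P" using M(1) ue uu unfolding P_def by auto
    hence "u \<in> M" using M(2)[of "insert u M"] by blast
    thus False using ue(1) uu by fastforce
  qed
  with M(1) show ?thesis unfolding is_onb_def P_def by blast
qed

lemma is_onbD:
  assumes "is_onb S E"
  shows "E \<subseteq> S" "e \<in> E \<Longrightarrow> e' \<in> E \<Longrightarrow> cinner e e' = (if e = e' then 1 else 0)"
    "x \<in> S \<Longrightarrow> (\<And>e. e \<in> E \<Longrightarrow> cinner x e = 0) \<Longrightarrow> x = 0"
proof -
  note * = assms[unfolded is_onb_def]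
  show "E \<subseteq> S" by (rule conjunct1[OF *])
  show "e \<in> E \<Longrightarrow> e' \<in> E \<Longrightarrow> cinner e e' = (if e = e' then 1 else 0)"
    by (rule bspec[OF bspec[OF conjunct1[OF conjunct2[OF *]]]])
  show "x \<in> S \<Longrightarrow> (\<And>e. e \<in> E \<Longrightarrow> cinner x e = 0) \<Longrightarrow> x = 0"
    using conjunct2[OF conjunct2[OF *]] by simp
qed

lemma onb_norm: "is_onb S E \<Longrightarrow> e \<in> E \<Longrightarrow> norm e = 1"
  using is_onbD(2)[of S E e e] Re_cinner_self[of e] norm_ge_zero[of e]
  by (auto simp: power2_eq_1_iff)

lemma onb_finite_expansion:
  assumes E: "is_onb S E" "finite E" and S: "csubspace S" and x: "x \<in> S"
  shows "(\<Sum>e\<in>E. cinner x e *\<^sub>C e) = x"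
proof -
  let ?y = "x - (\<Sum>e\<in>E. cinner x e *\<^sub>C e)"
  have "?y = 0"
  proof (rule is_onbD(3)[OF E(1)])
    show "?y \<in> S" using is_onbD(1)[OF E(1)]
      by (intro complex_vector.subspace_diff S x complex_vector.subspace_sum
          complex_vector.subspace_scale) auto
    fix e assume e: "e \<in> E"
    have "(\<Sum>e'\<in>E. cinner x e' * cinner e' e) = (\<Sum>e'\<in>E. if e' = e then cinner x e else 0)"
      using is_onbD(2)[OF E(1)] e by (intro sum.cong) auto
    thus "cinner ?y e = 0" using e E(2) by (simp add: cinner_simps)
  qed
  thus ?thesis by simp
qed

lemma onb_finite_parseval:
  assumes E: "is_onb S E" "finite E" and S: "csubspace S" and x: "x \<in> S"
  shows "(norm x)\<^sup>2 = (\<Sum>e\<in>E. (cmod (cinner x e))\<^sup>2)"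
proof -
  have "complex_of_real ((norm x)\<^sup>2) = cinner (\<Sum>e\<in>E. cinner x e *\<^sub>C e) x"
    unfolding onb_finite_expansion[OF assms] by (simp add: cinner_self)
  also have "\<dots> = (\<Sum>e\<in>E. cinner x e * cnj (cinner x e))"
    unfolding cinner_sum_left cinner_scaleC_left by (simp flip: cinner_commute)
  also have "\<dots> = of_real (\<Sum>e\<in>E. (cmod (cinner x e))\<^sup>2)"
    unfolding complex_norm_square[symmetric] by simp
  finally show ?thesis unfolding of_real_eq_iff .
qed

text \<open>\<open>is_onb\<close> asserts maximality only, so density of the span has to be derived.
  Completing the square (\<open>pyth\<close>) gives Bessel's inequality when \<open>c\<close> are
  the Fourier coefficients and, for other coefficients, the comparison with an approximating finite
  combination.\<close>

lemma parseval:
  fixes S :: "'a :: chilbert_space set"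
  assumes E: "is_onb S E" and S: "closed S" "csubspace S" and x: "x \<in> S"
  shows "((\<lambda>e. (cmod (cinner x e))\<^sup>2) has_sum (norm x)\<^sup>2) E"
proof -
  have pyth: "(norm (x - (\<Sum>e\<in>F. c e *\<^sub>C e)))\<^sup>2 =
      (norm x)\<^sup>2 - (\<Sum>e\<in>F. (cmod (cinner x e))\<^sup>2) + (\<Sum>e\<in>F. (cmod (cinner x e - c e))\<^sup>2)"
    if F: "finite F" "F \<subseteq> E" for F c
  proof -
    let ?z = "\<Sum>e\<in>F. c e *\<^sub>C e"
    have inn: "cinner ?z ?z = (\<Sum>e\<in>F. c e * cnj (c e))"
    proof -
      have "(\<Sum>e'\<in>F. c e' * (cnj (c e) * cinner e' e)) = c e * cnj (c e)" if "e \<in> F" for e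
      proof -
        have "(\<Sum>e'\<in>F. c e' * (cnj (c e) * cinner e' e)) = (\<Sum>e'\<in>F. if e' = e then c e * cnj (c e) else 0)"
          using is_onbD(2)[OF E subsetD[OF F(2)] subsetD[OF F(2)]] that by (intro sum.cong) auto
        thus ?thesis using that F(1) by simp
      qed
      thus ?thesis unfolding cinner_sum_left cinner_sum_right cinner_scaleC_left cinner_scaleC_right
        by (intro sum.cong) (auto simp: sum_distrib_left mult.left_commute mult.assoc)
    qed
    have zx: "cinner ?z x = (\<Sum>e\<in>F. c e * cnj (cinner x e))"
      unfolding cinner_sum_left cinner_scaleC_left by (simp flip: cinner_commute)
    have "complex_of_real ((norm (x - ?z))\<^sup>2) = cinner x x - (\<Sum>e\<in>F. cnj (c e) * cinner x e)
        - (\<Sum>e\<in>F. c e * cnj (cinner x e)) + (\<Sum>e\<in>F. c e * cnj (c e))"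
      unfolding cinner_self[symmetric] inn[symmetric] zx[symmetric]
      by (simp add: cinner_diff_left cinner_diff_right cinner_sum_right cinner_scaleC_right
          right_diff_distrib sum_subtractf)
    also have "\<dots> = cinner x x - (\<Sum>e\<in>F. cinner x e * cnj (cinner x e))
        + (\<Sum>e\<in>F. (cinner x e - c e) * cnj (cinner x e - c e))"
      by (simp add: algebra_simps sum.distrib sum_subtractf)
    also have "\<dots> = of_real ((norm x)\<^sup>2 - (\<Sum>e\<in>F. (cmod (cinner x e))\<^sup>2)
        + (\<Sum>e\<in>F. (cmod (cinner x e - c e))\<^sup>2))"
      unfolding complex_norm_square[symmetric] by (simp add: cinner_self)
    finally show ?thesis unfolding of_real_eq_iff .
  qed
  have bessel: "(\<Sum>e\<in>F. (cmod (cinner x e))\<^sup>2) \<le> (norm x)\<^sup>2" if "finite F" "F \<subseteq> E" for F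
    using pyth[OF that, of "cinner x"] zero_le_power2[of "norm (x - (\<Sum>e\<in>F. cinner x e *\<^sub>C e))"] by simp
  define V where "V = closure (cspan E)"
  have V: "closed V" "csubspace V" unfolding V_def by (auto intro: csubspace_closure)
  have VS: "V \<subseteq> S" unfolding V_def
    using is_onbD(1)[OF E] S by (intro closure_minimal complex_vector.span_minimal)
  \<comment> \<open>The adjoint of the identity on \<open>V\<close> is the orthogonal projection; x
    - y is orthogonal to \<open>E\<close>, hence 0 by maximality.\<close>
  obtain y where y: "y \<in> V" "\<And>z. z \<in> V \<Longrightarrow> cinner z x = cinner z y"
    using adjoint_on_subspace_exists[OF bounded_clinear_id V] by blast
  have "x - y = 0"
  proof (rule is_onbD(3)[OF E])
    show "x - y \<in> S" using x y(1) VS S(2) by (auto intro: complex_vector.subspace_diff)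
    fix e assume "e \<in> E"
    hence "e \<in> V" unfolding V_def using complex_vector.span_base closure_subset by blast
    from y(2)[OF this] show "cinner (x - y) e = 0"
      by (metis cinner_commute cinner_diff_left diff_self)
  qed
  hence xV: "x \<in> closure (cspan E)" using y(1) by (simp add: V_def)
  have approx: "\<exists>F. finite F \<and> F \<subseteq> E \<and> (norm x)\<^sup>2 - d < (\<Sum>e\<in>F. (cmod (cinner x e))\<^sup>2)" if d: "d > 0" for d
  proof -
    obtain z where z: "z \<in> cspan E" "dist z x < sqrt d"
      using xV d unfolding closure_approachable by (meson real_sqrt_gt_zero)
    then obtain F c where F: "finite F" "F \<subseteq> E" "z = (\<Sum>e\<in>F. c e *\<^sub>C e)"
      unfolding complex_vector.span_explicit by blast
    have "(norm (x - z))\<^sup>2 < d"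
      using z(2) d by (metis dist_commute dist_norm norm_ge_zero real_less_rsqrt real_sqrt_less_iff real_sqrt_abs abs_norm_cancel)
    moreover have "0 \<le> (\<Sum>e\<in>F. (cmod (cinner x e - c e))\<^sup>2)" by (intro sum_nonneg) auto
    ultimately show ?thesis using pyth[OF F(1,2), of c] F by (intro exI[of _ F]) auto
  qed
  show ?thesis
    unfolding has_sum_def tendsto_iff eventually_finite_subsets_at_top
  proof (intro allI impI)
    fix d :: real assume "0 < d"
    from approx[OF this] obtain F where F: "finite F" "F \<subseteq> E"
      "(norm x)\<^sup>2 - d < (\<Sum>e\<in>F. (cmod (cinner x e))\<^sup>2)" by blast
    have "dist (\<Sum>e\<in>G. (cmod (cinner x e))\<^sup>2) ((norm x)\<^sup>2) < d" if G: "finite G" "F \<subseteq> G" "G \<subseteq> E" for G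
    proof -
      have "(\<Sum>e\<in>F. (cmod (cinner x e))\<^sup>2) \<le> (\<Sum>e\<in>G. (cmod (cinner x e))\<^sup>2)"
        using G by (intro sum_mono2) auto
      with bessel[OF G(1,3)] F(3) show ?thesis by (simp add: dist_real_def)
    qed
    with F show "\<exists>F. finite F \<and> F \<subseteq> E \<and> (\<forall>G. finite G \<and> F \<subseteq> G \<and> G \<subseteq> E \<longrightarrow>
        dist (\<Sum>e\<in>G. (cmod (cinner x e))\<^sup>2) ((norm x)\<^sup>2) < d)" by blast
  qed
qed

lemma onb_independent:
  assumes E: "is_onb S E" shows "complex_vector.independent E"
proof
  assume "complex_vector.dependent E"
  then obtain F c e where F: "finite F" "F \<subseteq> E" "(\<Sum>e\<in>F. c e *\<^sub>C e) = 0" "e \<in> F" "c e \<noteq> 0"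
    unfolding complex_vector.dependent_explicit by blast
  have "(\<Sum>e'\<in>F. c e' * cinner e' e) = (\<Sum>e'\<in>F. if e' = e then c e else 0)"
    using is_onbD(2)[OF E subsetD[OF F(2)] subsetD[OF F(2)]] F(4) by (intro sum.cong) auto
  also have "\<dots> = c e" using F by simp
  finally have "cinner (\<Sum>e\<in>F. c e *\<^sub>C e) e = c e" by (simp add: cinner_simps)
  thus False using F by simp
qed

lemma finite_dim_onb:
  assumes E: "is_onb S E" and S: "csubspace S" and B: "finite B" "S \<subseteq> cspan B"
  shows "finite E" and "card E = cdim S"
proof -
  show fin: "finite E"
    using complex_vector.independent_span_bound[OF B(1) onb_independent[OF E]] is_onbD(1)[OF E] B(2)
    by auto
  have "S \<subseteq> cspan E"
  proof
    fix x assume "x \<in> S"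
    from onb_finite_expansion[OF E fin S this, symmetric] show "x \<in> cspan E"
      by (metis (mono_tags, lifting) complex_vector.span_base complex_vector.span_scale complex_vector.span_sum)
  qed
  thus "card E = cdim S"
    using complex_vector.dim_unique[OF is_onbD(1)[OF E] _ onb_independent[OF E] refl] by simp
qed

section \<open>Basis independence of traces and null vectors of positive operators\<close>

text \<open>Expand e in \<open>C\<close> and move the coefficient to the other argument, where it
  becomes the coefficient of c in \<open>E\<close>. This later allows any homogeneous basis to be
  replaced by the basis of words.\<close>

lemma hilbert_schmidt_basis_independent:
  assumes E: "is_onb S E" "finite E" and C: "is_onb S C" "finite C"
    and S: "csubspace S" and F: "bounded_clinear F"
  shows "(\<Sum>e\<in>E. (norm (F e))\<^sup>2) = (\<Sum>c\<in>C. (norm (F c))\<^sup>2)"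
proof -
  note Fs = bounded_clinear_simps[OF F]
  have ES: "e \<in> S" if "e \<in> E" for e using is_onbD(1)[OF E(1)] that by blast
  have CS: "c \<in> S" if "c \<in> C" for c using is_onbD(1)[OF C(1)] that by blast
  have "(\<Sum>e\<in>E. cinner (F e) (F e)) = (\<Sum>e\<in>E. cinner (F (\<Sum>c\<in>C. cinner e c *\<^sub>C c)) (F e))"
    by (simp add: onb_finite_expansion[OF C S] ES)
  also have "\<dots> = (\<Sum>e\<in>E. \<Sum>c\<in>C. cinner (F c) (F (cinner c e *\<^sub>C e)))"
    unfolding Fs by (simp add: cinner_simps flip: cinner_commute)
  also have "\<dots> = (\<Sum>c\<in>C. cinner (F c) (F (\<Sum>e\<in>E. cinner c e *\<^sub>C e)))"
    unfolding Fs(7) cinner_sum_right by (rule sum.swap)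
  also have "\<dots> = (\<Sum>c\<in>C. cinner (F c) (F c))"
    by (simp add: onb_finite_expansion[OF E S] CS)
  finally have "complex_of_real (\<Sum>e\<in>E. (norm (F e))\<^sup>2) = of_real (\<Sum>c\<in>C. (norm (F c))\<^sup>2)"
    by (simp add: cinner_self)
  thus ?thesis unfolding of_real_eq_iff .
qed

text \<open>The definite description needs uniqueness of the value, hence the existence of at least
  one orthonormal basis.\<close>

lemma optrace_eqI:
  assumes "\<And>E. is_onb UNIV E \<Longrightarrow> has_diagonal_sum A E t"
  shows "optrace A = t"
  unfolding optrace_def
proof (rule the_equality)
  fix t' assume t': "\<forall>E. is_onb UNIV E \<longrightarrow> has_diagonal_sum A E t'"
  obtain E where "is_onb (UNIV :: 'a set) E" using onb_exists[OF csubspace_UNIV] by blast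
  with assms t' show "t' = t" unfolding has_diagonal_sum_def by (blast intro: has_sum_unique)
qed (use assms in blast)

text \<open>Along y + t P y the quadratic form of \<open>P\<close> is a nonnegative polynomial in t
  without constant term, so its linear coefficient, twice the square of |P y|, must vanish.\<close>

lemma positive_op_null:
  assumes P: "positive_op P" and y: "Re (cinner (P y) y) = 0"
  shows "P y = 0"
proof -
  have bP: "bounded_clinear P" and sa: "cinner (P u) v = cinner u (P v)"
    and pos: "0 \<le> Re (cinner (P u) u)" for u v
    using P by (auto simp: positive_op_def)
  note Ps = bounded_clinear_simps[OF bP]
  define a where "a = (norm (P y))\<^sup>2"
  define c where "c = Re (cinner (P (P y)) (P y))"
  have quad: "0 \<le> 2 * t * a + t\<^sup>2 * c" for t
  proof -
    have "0 \<le> Re (cinner (P (y + t *\<^sub>R P y)) (y + t *\<^sub>R P y))" by (rule pos)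
    also have "\<dots> = 2 * t * a + t\<^sup>2 * c"
      using y by (simp add: a_def c_def Ps cinner_simps cinner_scaleR_left cinner_scaleR_right
          sa[of "P y" y] Re_cinner_self power2_eq_square[of t] algebra_simps)
    finally show ?thesis .
  qed
  \<comment> \<open>The minimiser would be - a / c; with c + 1 there is no division by zero.\<close>
  define d where "d = c + 1"
  have d: "d > 0" "c \<le> d" using pos[of "P y"] by (auto simp: c_def d_def)
  have "2 * (- a / d) * a + (- a / d)\<^sup>2 * c \<le> 2 * (- a / d) * a + (- a / d)\<^sup>2 * d"
    using d by (intro add_left_mono mult_left_mono) auto
  also have "\<dots> = - (a\<^sup>2 / d)" using d by (simp add: field_simps power2_eq_square)
  finally have "a\<^sup>2 / d \<le> 0" using quad[of "- a / d"] by linarith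
  hence "a = 0" using d by (simp add: divide_le_0_iff)
  thus ?thesis by (simp add: a_def)
qed

section \<open>Square roots of positive operators\<close>

text \<open>The positive square root of \<open>I - R\<close> is the binomial series \<open>(1 - x)\<^sup>1\<^sup>/\<^sup>2 = \<Sum> b\<^sub>k x\<^sup>k\<close>
  evaluated at \<open>R\<close>; it converges absolutely on the closed unit ball.\<close>

definition sqrt_coeff :: "nat \<Rightarrow> real" where
  "sqrt_coeff k = (-1) ^ k * ((1/2) gchoose k)"

lemma sqrt_coeff_0 [simp]: "sqrt_coeff 0 = 1"
  by (simp add: sqrt_coeff_def)

lemma sqrt_coeff_Suc: "sqrt_coeff (Suc k) = sqrt_coeff k * ((real k - 1/2) / (real k + 1))"
proof -
  have "((1/2 :: real) gchoose Suc k) = (1/2 gchoose k) * (1/2 - real k) / (real k + 1)"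
    by (simp add: gbinomial_prod_rev field_simps)
  thus ?thesis unfolding sqrt_coeff_def by (simp only: power_Suc) (simp add: field_simps)
qed

lemma sqrt_coeff_Suc_nonpos: "sqrt_coeff (Suc k) \<le> 0"
proof (induction k)
  case 0
  show ?case by (simp add: sqrt_coeff_Suc)
next
  case (Suc k)
  show ?case unfolding sqrt_coeff_Suc[of "Suc k"]
    by (rule mult_nonpos_nonneg[OF Suc.IH]) simp
qed

text \<open>Partial sums of the coefficients of (1 - x)^(1/2) are the coefficients of (1 - x)^(1/2)
  / (1 - x) = (1 - x)^(-1/2), which is the product in \<open>closed\<close>. Its second half gives
  the next coefficient, without which the induction does not close.\<close>

lemma sqrt_coeff_partial_sum: "0 \<le> (\<Sum>k\<le>n. sqrt_coeff k)"
proof -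
  have closed: "(\<Sum>k\<le>n. sqrt_coeff k) = (\<Prod>k<n. (real k + 1/2) / (real k + 1)) \<and>
    sqrt_coeff (Suc n) * (2 * (real n + 1)) = - (\<Prod>k<n. (real k + 1/2) / (real k + 1))" for n
  proof (induction n)
    case 0
    show ?case by (simp add: sqrt_coeff_Suc)
  next
    case (Suc n)
    define p where "p = (\<Prod>k<n. (real k + 1/2) / (real k + 1))"
    note IH = Suc[folded p_def]
    have c: "sqrt_coeff (Suc n) = - p / (2 * (real n + 1))"
      using IH by (simp add: field_simps)
    have "(\<Sum>k\<le>Suc n. sqrt_coeff k) = p - p / (2 * (real n + 1))"
      using IH c by simp
    also have "\<dots> = p * ((real n + 1/2) / (real n + 1))" by (simp add: field_simps)
    finally have 1: "(\<Sum>k\<le>Suc n. sqrt_coeff k) = p * ((real n + 1/2) / (real n + 1))" .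
    have "- p / (2 * a) * ((a - 1/2) / (a + 1)) * (2 * (a + 1)) = - (p * ((a - 1/2) / a))" if "a > 0" for a :: real
      using that by (simp add: divide_simps)
    from this[of "real n + 1"]
    have "sqrt_coeff (Suc (Suc n)) * (2 * (real (Suc n) + 1)) = - (p * ((real n + 1/2) / (real n + 1)))"
      unfolding sqrt_coeff_Suc[of "Suc n"] c by (simp add: add.commute)
    with 1 show ?case unfolding prod.lessThan_Suc p_def[symmetric] by simp
  qed
  thus ?thesis by (simp add: prod_nonneg)
qed

text \<open>All coefficients after the first are nonpositive, so nonnegative partial sums bound
  their absolute values. This yields absolute convergence up to the boundary, as contractions of
  norm 1 require.\<close>

lemma sum_sqrt_coeff_Suc: "(\<Sum>k<n. \<bar>sqrt_coeff (Suc k)\<bar>) \<le> 1"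
proof -
  have "(\<Sum>k\<le>n. sqrt_coeff k) = 1 - (\<Sum>k<n. \<bar>sqrt_coeff (Suc k)\<bar>)"
    by (simp add: sum.atMost_shift sqrt_coeff_Suc_nonpos sum_negf)
  thus ?thesis using sqrt_coeff_partial_sum[of n] by linarith
qed

lemma summable_sqrt_coeff: "summable (\<lambda>k. \<bar>sqrt_coeff k\<bar>)"
proof (subst summable_Suc_iff[symmetric], rule summableI_nonneg_bounded)
  show "(\<Sum>k<n. \<bar>sqrt_coeff (Suc k)\<bar>) \<le> 1" for n by (rule sum_sqrt_coeff_Suc)
qed simp

text \<open>Vandermonde's identity at 1/2 + 1/2 = 1: the square of the binomial series is 1 -
  x.\<close>

lemma sqrt_coeff_convolution:
  "(\<Sum>k\<le>n. sqrt_coeff k * sqrt_coeff (n - k)) = (if n = 0 then 1 else if n = 1 then -1 else 0)"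
proof -
  have "(\<Sum>k\<le>n. sqrt_coeff k * sqrt_coeff (n - k)) =
      (\<Sum>k\<le>n. (-1) ^ n * (((1/2) gchoose k) * ((1/2) gchoose (n - k))))"
    by (intro sum.cong) (auto simp: sqrt_coeff_def simp flip: power_add)
  also have "\<dots> = (-1) ^ n * ((1/2 + 1/2) gchoose n)"
    by (simp only: gbinomial_Vandermonde sum_distrib_left[symmetric] atLeast0AtMost[symmetric])
  also have "(1/2 + 1/2 :: real) gchoose n = of_nat (1 choose n)"
    by (simp add: binomial_gbinomial)
  also have "(-1) ^ n * real (1 choose n) = (if n = 0 then 1 else if n = 1 then -1 else 0)"
    by (cases n rule: nat.exhaust; cases "n = 1") auto
  finally show ?thesis .
qed

definition sqrt_series :: "('a :: chilbert_space \<Rightarrow> 'a) \<Rightarrow> 'a \<Rightarrow> 'a" where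
  "sqrt_series R x = (\<Sum>k. sqrt_coeff k *\<^sub>R (R ^^ k) x)"

locale selfadjoint_contraction =
  fixes R :: "'a :: chilbert_space \<Rightarrow> 'a"
  assumes bcl: "bounded_clinear R"
    and selfadj: "cinner (R x) y = cinner x (R y)"
    and contr: "norm (R x) \<le> norm x"
begin

lemma pow_norm: "norm ((R ^^ k) x) \<le> norm x"
  by (induction k) (auto intro: order_trans[OF contr])

lemma pow_selfadj: "cinner ((R ^^ k) x) y = cinner x ((R ^^ k) y)"
  by (induction k arbitrary: y) (simp_all add: selfadj funpow_swap1[symmetric])

lemma pow_linear: 
  "(R ^^ k) (x + y) = (R ^^ k) x + (R ^^ k) y" "(R ^^ k) (c *\<^sub>C x) = c *\<^sub>C (R ^^ k) x"
  by (induction k) (simp_all add: bounded_clinear_simps[OF bcl])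

lemma sqrt_series_summable: "summable (\<lambda>k. norm (sqrt_coeff k *\<^sub>R (R ^^ k) x))"
  by (rule summable_comparison_test'[OF summable_mult2[OF summable_sqrt_coeff, of "norm x"], of 0])
    (simp add: mult_left_mono pow_norm)

lemma sqrt_series_sums: "(\<lambda>k. sqrt_coeff k *\<^sub>R (R ^^ k) x) sums sqrt_series R x"
  unfolding sqrt_series_def
  by (rule summable_sums[OF summable_norm_cancel[OF sqrt_series_summable]])

lemma sqrt_series_norm_le: "norm (sqrt_series R x) \<le> norm x * (\<Sum>k. \<bar>sqrt_coeff k\<bar>)"
proof -
  have "norm (sqrt_series R x) \<le> (\<Sum>k. norm (sqrt_coeff k *\<^sub>R (R ^^ k) x))"
    unfolding sqrt_series_def by (rule summable_norm[OF sqrt_series_summable])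
  also have "\<dots> \<le> (\<Sum>k. norm x * \<bar>sqrt_coeff k\<bar>)"
    by (rule suminf_le[OF _ sqrt_series_summable summable_mult[OF summable_sqrt_coeff]])
      (auto simp: mult.commute[of "norm x"] intro: mult_left_mono pow_norm)
  also have "\<dots> = norm x * (\<Sum>k. \<bar>sqrt_coeff k\<bar>)" by (rule suminf_mult[OF summable_sqrt_coeff])
  finally show ?thesis .
qed

lemma bounded_clinear_sqrt_series: "bounded_clinear (sqrt_series R)"
proof (rule bounded_clinearI[OF _ _ sqrt_series_norm_le])
  fix x y :: 'a and c
  have "(\<lambda>k. sqrt_coeff k *\<^sub>R (R ^^ k) x + sqrt_coeff k *\<^sub>R (R ^^ k) y) sums (sqrt_series R x + sqrt_series R y)"
    by (intro sums_add sqrt_series_sums)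
  thus "sqrt_series R (x + y) = sqrt_series R x + sqrt_series R y"
    using sqrt_series_sums[of "x + y"] by (auto simp: pow_linear scaleR_add_right intro: sums_unique2)
  have "(\<lambda>k. c *\<^sub>C (sqrt_coeff k *\<^sub>R (R ^^ k) x)) sums (c *\<^sub>C sqrt_series R x)"
    by (rule bounded_linear.sums[OF bounded_clinear_linear[OF bounded_clinear_scaleC[OF bounded_clinear_id]]
        sqrt_series_sums])
  thus "sqrt_series R (c *\<^sub>C x) = c *\<^sub>C sqrt_series R x"
    using sqrt_series_sums[of "c *\<^sub>C x"]
    by (auto simp: pow_linear bounded_clinear_simps(5)[OF bounded_clinear_scaleC[OF bounded_clinear_id]]
        intro: sums_unique2)
qed

lemma sqrt_series_selfadj: "cinner (sqrt_series R x) y = cinner x (sqrt_series R y)"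
proof -
  have 1: "(\<lambda>k. cinner (sqrt_coeff k *\<^sub>R (R ^^ k) x) y) sums cinner (sqrt_series R x) y"
    by (rule bounded_linear.sums[OF bounded_bilinear.bounded_linear_left[OF bounded_bilinear_cinner]
        sqrt_series_sums])
  have 2: "(\<lambda>k. cinner x (sqrt_coeff k *\<^sub>R (R ^^ k) y)) sums cinner x (sqrt_series R y)"
    by (rule bounded_linear.sums[OF bounded_bilinear.bounded_linear_right[OF bounded_bilinear_cinner]
        sqrt_series_sums])
  show ?thesis
    using 1 2 by (auto simp: cinner_scaleR_left cinner_scaleR_right pow_selfadj intro: sums_unique2)
qed

text \<open>Only the coefficient of the identity is positive. Replacing the inner product of R^k x
  and x by its upper bound |x|^2 in the other terms can only lower the partial sum, to |x|^2 times a
  nonnegative partial sum of coefficients.\<close>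

lemma sqrt_series_pos: "0 \<le> Re (cinner (sqrt_series R x) x)"
proof (rule LIMSEQ_le_const)
  have "(\<lambda>k. cinner (sqrt_coeff k *\<^sub>R (R ^^ k) x) x) sums cinner (sqrt_series R x) x"
    by (rule bounded_linear.sums[OF bounded_bilinear.bounded_linear_left[OF bounded_bilinear_cinner]
        sqrt_series_sums])
  hence "(\<lambda>k. Re (cinner (sqrt_coeff k *\<^sub>R (R ^^ k) x) x)) sums Re (cinner (sqrt_series R x) x)"
    by (rule sums_Re)
  thus "(\<lambda>n. \<Sum>k<Suc n. Re (cinner (sqrt_coeff k *\<^sub>R (R ^^ k) x) x)) \<longlonglongrightarrow> Re (cinner (sqrt_series R x) x)"
    unfolding sums_def by (rule LIMSEQ_Suc)
  have "0 \<le> (\<Sum>k<Suc n. Re (cinner (sqrt_coeff k *\<^sub>R (R ^^ k) x) x))" for n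
  proof -
    have "0 \<le> (norm x)\<^sup>2 * (\<Sum>k\<le>n. sqrt_coeff k)"
      by (intro mult_nonneg_nonneg sqrt_coeff_partial_sum) simp
    also have "\<dots> = (\<Sum>k<Suc n. sqrt_coeff k * (norm x)\<^sup>2)"
      by (simp add: sum_distrib_right lessThan_Suc_atMost mult.commute[of "(norm x)\<^sup>2"])
    also have "\<dots> \<le> (\<Sum>k<Suc n. sqrt_coeff k * inner ((R ^^ k) x) x)"
    proof (rule sum_mono)
      fix k
      have "inner ((R ^^ k) x) x \<le> norm ((R ^^ k) x) * norm x" by (rule norm_cauchy_schwarz)
      also have "\<dots> \<le> norm x * norm x" by (intro mult_right_mono pow_norm) auto
      finally have le: "inner ((R ^^ k) x) x \<le> (norm x)\<^sup>2" by (simp add: power2_eq_square)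
      show "sqrt_coeff k * (norm x)\<^sup>2 \<le> sqrt_coeff k * inner ((R ^^ k) x) x"
      proof (cases k)
        case 0
        thus ?thesis by (simp add: power2_norm_eq_inner)
      next
        case (Suc j)
        thus ?thesis using le sqrt_coeff_Suc_nonpos[of j] by (simp add: mult_left_mono_neg)
      qed
    qed
    finally show ?thesis by (simp add: cinner_scaleR_left inner_eq_Re_cinner)
  qed
  thus "\<exists>N. \<forall>n\<ge>N. 0 \<le> (\<Sum>k<Suc n. Re (cinner (sqrt_coeff k *\<^sub>R (R ^^ k) x) x))" by blast
qed

text \<open>Powers of \<open>R\<close> pass through \<open>X\<close>, hence so does the series. A
  different operator \<open>R'\<close> on the target covers the relations between the two defect
  operators.\<close>

lemma sqrt_series_commute:
  assumes X: "bounded_linear X" and comm: "\<And>x. X (R x) = R' (X x)"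
    and R': "selfadjoint_contraction R'"
  shows "X (sqrt_series R x) = sqrt_series R' (X x)"
proof -
  have "X ((R ^^ k) x) = (R' ^^ k) (X x)" for k
    by (induction k) (simp_all add: comm)
  hence "(\<lambda>k. sqrt_coeff k *\<^sub>R (R' ^^ k) (X x)) sums X (sqrt_series R x)"
    using bounded_linear.sums[OF X sqrt_series_sums[of x]] by (simp add: linear_cmul[OF bounded_linear.linear[OF X]])
  thus ?thesis using selfadjoint_contraction.sqrt_series_sums[OF R'] sums_unique2 by blast
qed

text \<open>A Cauchy product: absolute convergence allows the double family \<open>h\<close> to be
  summed by rows, giving the iterated root, and by diagonals, where the convolution of coefficients
  leaves x - R x.\<close>

lemma sqrt_series_square: "sqrt_series R (sqrt_series R x) = x - R x"
proof -
  let ?B = "sqrt_series R"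
  let ?b = sqrt_coeff
  define h where "h = (\<lambda>(j, k). (?b j * ?b k) *\<^sub>R (R ^^ (j + k)) x)"
  have abs: "(\<lambda>k. \<bar>?b k\<bar>) summable_on UNIV"
    using summable_sqrt_coeff by (intro norm_summable_imp_summable_on) auto
  have "(\<lambda>p. \<bar>?b (fst p)\<bar> * \<bar>?b (snd p)\<bar>) summable_on UNIV \<times> UNIV"
  proof (rule summable_on_SigmaI[where g = "\<lambda>j. \<bar>?b j\<bar> * infsum (\<lambda>k. \<bar>?b k\<bar>) UNIV"])
    show "((\<lambda>y. \<bar>?b (fst (x, y))\<bar> * \<bar>?b (snd (x, y))\<bar>) has_sum \<bar>?b x\<bar> * infsum (\<lambda>k. \<bar>?b k\<bar>) UNIV) UNIV" for x
      using has_sum_cmult_right[OF has_sum_infsum[OF abs]] by simp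
    show "(\<lambda>j. \<bar>?b j\<bar> * infsum (\<lambda>k. \<bar>?b k\<bar>) UNIV) summable_on UNIV"
      by (rule summable_on_cmult_left[OF abs])
  qed auto
  hence "(\<lambda>p. \<bar>?b (fst p)\<bar> * \<bar>?b (snd p)\<bar> * norm x) summable_on UNIV"
    by (intro summable_on_cmult_left) simp
  hence "(\<lambda>p. norm (h p)) summable_on UNIV"
  proof (rule summable_on_comparison_test)
    show "norm (h p) \<le> \<bar>?b (fst p)\<bar> * \<bar>?b (snd p)\<bar> * norm x" for p
      by (cases p) (simp add: h_def abs_mult mult_left_mono pow_norm)
  qed simp
  hence hsum: "h summable_on UNIV" by (rule abs_summable_summable)
  have row: "((\<lambda>k. h (j, k)) has_sum (?b j *\<^sub>R (R ^^ j) (?B x))) UNIV" for j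
  proof -
    have lin: "bounded_linear (\<lambda>y. ?b j *\<^sub>R (R ^^ j) y)"
      by (rule bounded_linear_intro[where K = "\<bar>?b j\<bar>"])
        (use pow_linear(2)[of j "complex_of_real _"] in
          \<open>auto simp: pow_linear scaleR_add_right scaleC_of_real mult.commute[of "norm _"]
            intro: mult_left_mono pow_norm\<close>)
    have "((\<lambda>k. ?b k *\<^sub>R (R ^^ k) x) has_sum ?B x) UNIV"
      using sqrt_series_summable sqrt_series_sums by (rule norm_summable_imp_has_sum)
    from has_sum_bounded_linear[OF lin this]
    have "((\<lambda>k. ?b j *\<^sub>R (R ^^ j) (?b k *\<^sub>R (R ^^ k) x)) has_sum (?b j *\<^sub>R (R ^^ j) (?B x))) UNIV"
      by (simp add: o_def)
    moreover have "(R ^^ j) (r *\<^sub>R y) = r *\<^sub>R (R ^^ j) y" for r y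
      using pow_linear(2)[of j "complex_of_real r" y] by (simp add: scaleC_of_real)
    ultimately show ?thesis by (simp add: h_def funpow_add)
  qed
  obtain S where S: "(h has_sum S) (UNIV \<times> UNIV)" using hsum unfolding summable_on_def by auto
  have "((\<lambda>j. ?b j *\<^sub>R (R ^^ j) (?B x)) has_sum S) UNIV"
    by (rule has_sum_SigmaD[OF S row])
  moreover have "((\<lambda>j. ?b j *\<^sub>R (R ^^ j) (?B x)) has_sum ?B (?B x)) UNIV"
    using sqrt_series_summable sqrt_series_sums by (rule norm_summable_imp_has_sum)
  ultimately have SB: "S = ?B (?B x)" by (rule has_sum_unique)
  have "((\<lambda>(n, k). h (k, n - k)) has_sum S) (SIGMA n:UNIV. {..n})"
    using S by (subst has_sum_reindex_bij_witness[where T = "UNIV \<times> UNIV" and h = h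
        and i = "\<lambda>(j, k). (j + k, j)" and j = "\<lambda>(n, k). (k, n - k)"]) auto
  hence "((\<lambda>n. \<Sum>k\<le>n. h (k, n - k)) has_sum S) UNIV"
    by (rule has_sum_SigmaD) (simp add: has_sum_finite)
  moreover have "(\<Sum>k\<le>n. h (k, n - k)) = (if n = 0 then x else if n = 1 then - R x else 0)" for n
  proof -
    have "(\<Sum>k\<le>n. h (k, n - k)) = (\<Sum>k\<le>n. ?b k * ?b (n - k)) *\<^sub>R (R ^^ n) x"
      by (simp add: h_def scaleR_sum_left)
    thus ?thesis unfolding sqrt_coeff_convolution by auto
  qed
  ultimately have "((\<lambda>n :: nat. if n = 0 then x else if n = 1 then - R x else 0) has_sum S) UNIV" by simp
  moreover have "((\<lambda>n :: nat. if n = 0 then x else if n = 1 then - R x else 0) has_sum (x - R x)) UNIV"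
    by (rule has_sum_finite_neutralI[of "{0, 1 :: nat}"]) auto
  ultimately have "S = x - R x" by (rule has_sum_unique)
  thus ?thesis using SB by simp
qed

lemma positive_op_sqrt_series: "positive_op (sqrt_series R)"
  unfolding positive_op_def
  using bounded_clinear_sqrt_series sqrt_series_selfadj sqrt_series_pos by blast

text \<open>\<open>B\<close> commutes with R = I - B^2 and so with the series C. For y = (B - C) x
  this gives (B + C) y = B^2 x - C^2 x = 0; both operators are positive, so B y = C y = 0, and |y|^2
  is the inner product of x with (B - C) y.\<close>

lemma sqrt_series_unique:
  assumes B: "positive_op B" "B \<circ> B = (\<lambda>x. x - R x)"
  shows "B = sqrt_series R"
proof
  fix x
  let ?C = "sqrt_series R"
  have bB: "bounded_clinear B" using B(1) by (simp add: positive_op_def)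
  note Bs = bounded_clinear_simps[OF bB]
  note Cs = bounded_clinear_simps[OF bounded_clinear_sqrt_series]
  have BB: "B (B u) = u - R u" for u using fun_cong[OF B(2), of u] by simp
  have "B (R u) = R (B u)" for u
    using BB[of "B u"] arg_cong[OF BB[of u], of B] by (simp add: Bs)
  hence comm: "B (?C u) = ?C (B u)" for u
    by (rule sqrt_series_commute[OF bounded_clinear_linear[OF bB] _ selfadjoint_contraction_axioms])
  define y where "y = B x - ?C x"
  have "B y + ?C y = 0" unfolding y_def by (simp add: Bs Cs BB sqrt_series_square comm)
  hence "Re (cinner (B y) y) + Re (cinner (?C y) y) = 0"
    by (simp flip: plus_complex.simps(1) cinner_add_left)
  hence "Re (cinner (B y) y) = 0 \<and> Re (cinner (?C y) y) = 0"
    using sqrt_series_pos[of y] B(1) unfolding positive_op_def by (metis add_nonneg_eq_0_iff)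
  hence z: "B y = 0" "?C y = 0" using positive_op_null B(1) positive_op_sqrt_series by blast+
  have "cinner y y = cinner x (B y) - cinner x (?C y)"
    using B(1) unfolding positive_op_def y_def by (simp add: cinner_diff_left cinner_diff_right sqrt_series_selfadj Bs Cs)
  hence "y = 0" by (simp add: z cinner_self)
  thus "B x = ?C x" by (simp add: y_def)
qed

lemma sqrt_op_eq: "sqrt_op (\<lambda>x. x - R x) = sqrt_series R"
  unfolding sqrt_op_def
proof (rule some_equality)
  show "positive_op (sqrt_series R) \<and> sqrt_series R \<circ> sqrt_series R = (\<lambda>x. x - R x)"
    using positive_op_sqrt_series by (simp add: fun_eq_iff sqrt_series_square)
qed (auto intro: sqrt_series_unique)

end

lemma selfadjoint_contraction_adj:
  assumes C: "bounded_clinear C" and le: "\<And>x. norm (C x) \<le> norm x"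
  shows "selfadjoint_contraction (\<lambda>x. C (cadj C x))" "selfadjoint_contraction (\<lambda>x. cadj C (C x))"
proof -
  note C' = bounded_clinear_cadj[OF C]
  have le': "norm (cadj C x) \<le> norm x" for x
    using cadj_norm_le[OF C, of 1] le by simp
  show "selfadjoint_contraction (\<lambda>x. C (cadj C x))" "selfadjoint_contraction (\<lambda>x. cadj C (C x))"
    by unfold_locales
      (auto intro: bounded_clinear_compose C C' order_trans[OF le le'] order_trans[OF le' le]
        simp: cadj[OF C] cadj'[OF C])
qed

section \<open>Hilbert direct sums\<close>

lemma hnth_sum [simp]: "hnth (\<Sum>i\<in>I. x i) a = (\<Sum>i\<in>I. hnth (x i) a)"
  by (induction I rule: infinite_finite_induct) auto

lemma bounded_clinear_hnth: "bounded_clinear (\<lambda>x. hnth x i)"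
  by (rule bounded_clinearI[where K = 1]) (auto simp: hnth_norm_le)

lemma l2_summable_finite [simp]: "l2_summable (x :: 'i :: finite \<Rightarrow> _)"
  by (simp add: l2_summable_def)

lemma has_sum_finite_sum:
  fixes h :: "'i \<Rightarrow> 'a \<Rightarrow> 'b :: topological_comm_monoid_add"
  assumes "\<And>i. i \<in> I \<Longrightarrow> (h i has_sum s i) X"
  shows "((\<lambda>x. \<Sum>i\<in>I. h i x) has_sum (\<Sum>i\<in>I. s i)) X"
  using assms by (induction I rule: infinite_finite_induct) (auto intro: has_sum_add)

lemma l2_summable_mono:
  assumes "l2_summable x" "\<And>i. norm (y i) \<le> norm (x i)"
  shows "l2_summable y"
  using assms(1) unfolding l2_summable_def
  by (rule summable_on_comparison_test) (auto intro: power_mono assms)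

lemma hnorm_sq_finite:
  "(norm (x :: ('i :: finite, 'h :: chilbert_space) hsum))\<^sup>2 = (\<Sum>i\<in>UNIV. (norm (hnth x i))\<^sup>2)"
  by (simp add: hnorm_sq)

lemma hsum_cinner:
  "((\<lambda>i. cinner (hnth x i) (hnth y i)) has_sum cinner x y) UNIV"
  unfolding cinner_hsum_def by (rule has_sum_infsum[OF hcinner_summable])

lemma hsum_cinner_finite:
  "cinner (x :: ('i :: finite, 'h :: chilbert_space) hsum) y = (\<Sum>i\<in>UNIV. cinner (hnth x i) (hnth y i))"
  by (simp add: cinner_hsum_def)

text \<open>The elementary tensor of the basis vector at \<open>a\<close> with
  \<open>v\<close>.\<close>

definition hsingle :: "'i \<Rightarrow> 'h \<Rightarrow> ('i, 'h :: chilbert_space) hsum" where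
  "hsingle a v = Abs_hsum (\<lambda>b. if b = a then v else 0)"

lemma hnth_hsingle [simp]: "hnth (hsingle a v) b = (if b = a then v else 0)"
proof -
  have "((\<lambda>b. (norm (if b = a then v else 0))\<^sup>2) has_sum (norm v)\<^sup>2) UNIV"
    by (rule has_sum_finite_neutralI[of "{a}"]) auto
  thus ?thesis by (simp add: hsingle_def l2_summable_def has_sum_imp_summable)
qed

lemma cinner_hsingle_left: "cinner (hsingle a v) x = cinner v (hnth x a)"
proof (rule has_sum_unique[OF hsum_cinner])
  show "((\<lambda>i. cinner (hnth (hsingle a v) i) (hnth x i)) has_sum cinner v (hnth x a)) UNIV"
    by (rule has_sum_finite_neutralI[of "{a}"]) auto
qed

lemma cinner_hsingle_right: "cinner x (hsingle a v) = cinner (hnth x a) v"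
  by (metis cinner_commute cinner_hsingle_left)

lemma norm_hsingle [simp]: "norm (hsingle a v) = norm v"
proof -
  have "complex_of_real ((norm (hsingle a v))\<^sup>2) = of_real ((norm v)\<^sup>2)"
    unfolding cinner_self[symmetric] by (simp add: cinner_hsingle_left)
  thus ?thesis unfolding of_real_eq_iff by simp
qed

lemma bounded_clinear_hsingle: "bounded_clinear (hsingle a)"
  by (rule bounded_clinearI[where K = 1]) (auto intro: hsum_eqI)

lemma hsum_finite_expansion: "(\<Sum>i\<in>UNIV. hsingle i (hnth x i)) = (x :: ('i :: finite, 'h :: chilbert_space) hsum)"
  by (rule hsum_eqI) simp

lemma H2_tensor_subspace:
  assumes D: "csubspace D" shows "csubspace (H2_tensor D)"
  unfolding complex_vector.subspace_def H2_tensor_def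
  using complex_vector.subspace_0[OF D] complex_vector.subspace_add[OF D]
    complex_vector.subspace_scale[OF D] by simp

lemma closed_H2_tensor:
  assumes D: "closed D" shows "closed (H2_tensor D :: ('n list, 'k :: chilbert_space) hsum set)"
proof -
  have "(H2_tensor D :: ('n list, 'k) hsum set) = (\<Inter>\<alpha>. (\<lambda>x. hnth x \<alpha>) -` D)" by (auto simp: H2_tensor_def)
  thus ?thesis
    by (simp only:) (intro closed_INT ballI closed_vimage D bounded_clinear_continuous_on[OF bounded_clinear_hnth])
qed

lemma hnth_if:
  "hnth (Abs_hsum (\<lambda>a. if P a then hnth x a else 0)) b = (if P b then hnth x b else 0)"
proof -
  have "l2_summable (\<lambda>a. if P a then hnth x a else 0)"
    by (rule l2_summable_mono[OF hnth_l2[of x]]) auto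
  thus ?thesis by simp
qed

lemma hnth_Q_eq [simp]: "hnth (Q_eq m x) \<alpha> = (if length \<alpha> = m then hnth x \<alpha> else 0)"
  unfolding Q_eq_def by (rule hnth_if)

lemma hnth_Q_le [simp]: "hnth (Q_le m x) \<alpha> = (if length \<alpha> \<le> m then hnth x \<alpha> else 0)"
  unfolding Q_le_def by (rule hnth_if)

subsection \<open>Sums over words\<close>

lemma finite_words [simp]: "finite (words k :: 'n :: finite list set)"
  using finite_lists_length_eq[of "UNIV :: 'n set" k] by (simp add: words_def)

lemma words_0 [simp]: "words 0 = {[]}"
  by (auto simp: words_def)

lemma length_words: "\<alpha> \<in> words k \<Longrightarrow> length \<alpha> = k"
  by (simp add: words_def)

lemma sum_words_Suc:
  "(\<Sum>\<alpha>\<in>words (Suc k). F \<alpha>) = (\<Sum>i\<in>(UNIV :: 'n :: finite set). \<Sum>\<alpha>\<in>words k. F (i # \<alpha>))"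
proof -
  have "(\<Sum>\<alpha>\<in>words (Suc k). F \<alpha>) = (\<Sum>(i, \<alpha>)\<in>(UNIV :: 'n set) \<times> words k. F (i # \<alpha>))"
    by (rule sum.reindex_bij_witness[of _ "\<lambda>(i, \<alpha>). i # \<alpha>" "\<lambda>\<alpha>. (hd \<alpha>, tl \<alpha>)"])
      (auto simp: words_def length_Suc_conv)
  also note sum.cartesian_product[symmetric]
  finally show ?thesis .
qed

text \<open>Splitting off the last letter suits adjoints, because the adjoint of A_\<alpha> A_i
  applies that of A_i last, and also right multiplication by f_i.\<close>

lemma sum_words_snoc:
  "(\<Sum>\<alpha>\<in>words (Suc k). F \<alpha>) = (\<Sum>\<alpha>\<in>words k. \<Sum>i\<in>(UNIV :: 'n :: finite set). F (\<alpha> @ [i]))"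
proof -
  have "(\<Sum>\<alpha>\<in>words (Suc k). F \<alpha>) = (\<Sum>(\<alpha>, i)\<in>words k \<times> (UNIV :: 'n set). F (\<alpha> @ [i]))"
    by (rule sum.reindex_bij_witness[of _ "\<lambda>(\<alpha>, i). \<alpha> @ [i]" "\<lambda>\<alpha>. (butlast \<alpha>, last \<alpha>)"])
      (auto simp: words_def length_Suc_conv_rev)
  also note sum.cartesian_product[symmetric]
  finally show ?thesis .
qed

lemma sum_words_le:
  "(\<Sum>\<alpha> | length \<alpha> \<le> m. F (\<alpha> :: 'n :: finite list)) = (\<Sum>k\<le>m. \<Sum>\<alpha>\<in>words k. F \<alpha>)"
proof -
  have "{\<alpha> :: 'n list. length \<alpha> \<le> m} = (\<Union>k\<le>m. words k)" by (auto simp: words_def)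
  thus ?thesis by (simp only:) (rule sum.UNION_disjoint; auto dest: length_words)
qed

lemma finite_length_le [simp]: "finite {\<alpha> :: 'n :: finite list. length \<alpha> \<le> m}"
  using finite_lists_length_le[of "UNIV :: 'n set" m] by simp

text \<open>A finite set of words has bounded length, so it suffices to control the full sums up to
  each length. Bounds proved by induction on the degree enter through this lemma.\<close>

lemma words_hnorm_le:
  fixes x :: "'n :: finite list \<Rightarrow> 'h :: chilbert_space"
  assumes "\<And>m. (\<Sum>k\<le>m. \<Sum>\<alpha>\<in>words k. (norm (x \<alpha>))\<^sup>2) \<le> e\<^sup>2" "0 \<le> e"
  shows "l2_summable x" "norm (Abs_hsum x) \<le> e"
proof -
  have "(\<Sum>\<alpha>\<in>F. (norm (x \<alpha>))\<^sup>2) \<le> e\<^sup>2" if F: "finite F" for F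
  proof -
    obtain m where m: "\<And>\<alpha>. \<alpha> \<in> F \<Longrightarrow> length \<alpha> \<le> m"
      using finite_nat_set_iff_bounded_le[of "length ` F"] F by auto
    have "(\<Sum>\<alpha>\<in>F. (norm (x \<alpha>))\<^sup>2) \<le> (\<Sum>\<alpha> | length \<alpha> \<le> m. (norm (x \<alpha>))\<^sup>2)"
      using m by (intro sum_mono2) auto
    also have "\<dots> \<le> e\<^sup>2" using assms(1)[of m] by (simp add: sum_words_le)
    finally show ?thesis .
  qed
  from hnorm_le_finite[OF this assms(2)] show "l2_summable x" "norm (Abs_hsum x) \<le> e" by blast+
qed

section \<open>Row contractions\<close>

lemma op_power_Nil [simp]: "op_power X [] h = h"
  by (simp add: op_power_def)

lemma op_power_Cons [simp]: "op_power X (i # \<alpha>) h = X i (op_power X \<alpha> h)"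
  by (simp add: op_power_def)

lemma op_power_append: "op_power X (\<alpha> @ \<beta>) h = op_power X \<alpha> (op_power X \<beta> h)"
  by (induction \<alpha>) auto

lemma bounded_clinear_op_power:
  assumes "\<And>i. bounded_clinear (X i)" shows "bounded_clinear (op_power X \<alpha>)"
proof (induction \<alpha>)
  case Nil
  show ?case using bounded_clinear_id by (simp add: op_power_def id_def)
next
  case (Cons i \<alpha>)
  from bounded_clinear_compose[OF assms[of i] this] show ?case by (simp add: op_power_def o_def)
qed

lemma bounded_clinear_row_op:
  assumes "\<And>i. bounded_clinear (X i)" shows "bounded_clinear (row_op X)"
  unfolding row_op_def[abs_def]
  by (intro bounded_clinear_sum bounded_clinear_compose[OF assms bounded_clinear_hnth])

section \<open>Defect operators and Poisson kernel of a row contraction\<close>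

text \<open>The assumptions concern the operators f_i(T) alone, so that the results apply both to
  the given tuple and to the universal model.\<close>

locale contractive_tuple =
  fixes f :: "'n :: finite \<Rightarrow> 'n ncfps" and T :: "'n \<Rightarrow> 'h \<Rightarrow> 'h :: chilbert_space"
  assumes bounded_clinear_eval: "bounded_clinear (tuple_eval f T i)"
    and onorm_row: "onorm (row_op (tuple_eval f T)) \<le> 1"
begin

abbreviation "A \<equiv> tuple_eval f T"
abbreviation "Ar \<equiv> row_op (tuple_eval f T)"
abbreviation "D \<equiv> defect f T"
abbreviation "Ds \<equiv> defect_star f T"

lemma bounded_clinear_row: "bounded_clinear Ar"
  by (rule bounded_clinear_row_op[OF bounded_clinear_eval])

lemma norm_row: "norm (Ar x) \<le> norm x"
proof -
  have "norm (Ar x) \<le> onorm Ar * norm x"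
    by (rule onorm[OF bounded_clinear_linear[OF bounded_clinear_row]])
  also have "\<dots> \<le> 1 * norm x" by (rule mult_right_mono[OF onorm_row]) simp
  finally show ?thesis by simp
qed

lemma row_hsingle: "Ar (hsingle i u) = A i u"
proof -
  have "Ar (hsingle i u) = (\<Sum>j\<in>UNIV. if j = i then A i u else 0)"
    unfolding row_op_def by (intro sum.cong) (auto simp: bounded_clinear_simps[OF bounded_clinear_eval])
  thus ?thesis by simp
qed

lemma norm_eval: "norm (A i u) \<le> norm u"
  using norm_row[of "hsingle i u"] by (simp add: row_hsingle)

lemma hnth_cadj_row: "hnth (cadj Ar h) i = cadj (A i) h"
proof -
  have "cadj Ar = (\<lambda>h. Abs_hsum (\<lambda>i. cadj (A i) h))"
    by (rule cadj_eqI[OF _ bounded_clinear_row])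
      (simp add: row_op_def cinner_sum_left hsum_cinner_finite cadj[OF bounded_clinear_eval])
  thus ?thesis by simp
qed

lemma defect_eq: "D = sqrt_series (\<lambda>h. Ar (cadj Ar h))"
proof -
  have "(\<Sum>i\<in>UNIV. A i (cadj (A i) h)) = Ar (cadj Ar h)" for h
    by (simp add: row_op_def hnth_cadj_row)
  thus ?thesis unfolding defect_def
    using selfadjoint_contraction.sqrt_op_eq[OF selfadjoint_contraction_adj(1)[OF bounded_clinear_row norm_row]]
    by simp
qed

lemma defect_star_eq: "Ds = sqrt_series (\<lambda>x. cadj Ar (Ar x))"
  unfolding defect_star_def
  by (rule selfadjoint_contraction.sqrt_op_eq[OF selfadjoint_contraction_adj(2)[OF bounded_clinear_row norm_row]])

sublocale R: selfadjoint_contraction "\<lambda>h. Ar (cadj Ar h)"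
  by (rule selfadjoint_contraction_adj(1)[OF bounded_clinear_row norm_row])

sublocale Rs: selfadjoint_contraction "\<lambda>x. cadj Ar (Ar x)"
  by (rule selfadjoint_contraction_adj(2)[OF bounded_clinear_row norm_row])

lemmas bounded_clinear_defect = R.bounded_clinear_sqrt_series[folded defect_eq]
lemmas bounded_clinear_defect_star = Rs.bounded_clinear_sqrt_series[folded defect_star_eq]
lemmas defect_selfadj = R.sqrt_series_selfadj[folded defect_eq]
lemmas defect_star_selfadj = Rs.sqrt_series_selfadj[folded defect_star_eq]
lemmas defect_square = R.sqrt_series_square[folded defect_eq]
lemmas defect_star_square = Rs.sqrt_series_square[folded defect_star_eq]

text \<open>With A the row operator and B its adjoint, A (B A) = (A B) A; such an intertwining
  passes to the square roots of I - B A and I - A B.\<close>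

lemma row_defect_star: "Ar (Ds x) = D (Ar x)"
  unfolding defect_eq defect_star_eq
  by (rule Rs.sqrt_series_commute[OF bounded_clinear_linear[OF bounded_clinear_row] refl
        R.selfadjoint_contraction_axioms])

lemma cadj_row_defect: "cadj Ar (D h) = Ds (cadj Ar h)"
  unfolding defect_eq defect_star_eq
  by (rule R.sqrt_series_commute[OF bounded_clinear_linear[OF bounded_clinear_cadj[OF bounded_clinear_row]] refl
        Rs.selfadjoint_contraction_axioms])

lemma norm_defect: "(norm (D h))\<^sup>2 = (norm h)\<^sup>2 - (norm (cadj Ar h))\<^sup>2"
proof -
  have "(norm (D h))\<^sup>2 = Re (cinner (D (D h)) h)" by (subst defect_selfadj) (simp add: Re_cinner_self)
  also have "\<dots> = (norm h)\<^sup>2 - (norm (cadj Ar h))\<^sup>2"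
    unfolding defect_square cinner_diff_left cadj[OF bounded_clinear_row] by (simp add: Re_cinner_self)
  finally show ?thesis .
qed

lemma norm_defect_star: "(norm (Ds x))\<^sup>2 = (norm x)\<^sup>2 - (norm (Ar x))\<^sup>2"
proof -
  have "(norm (Ds x))\<^sup>2 = Re (cinner (Ds (Ds x)) x)" by (subst defect_star_selfadj) (simp add: Re_cinner_self)
  also have "\<dots> = (norm x)\<^sup>2 - (norm (Ar x))\<^sup>2"
    unfolding defect_star_square cinner_diff_left cadj'[OF bounded_clinear_row] by (simp add: Re_cinner_self)
  finally show ?thesis .
qed

lemma norm_cadj_row: "(norm (cadj Ar h))\<^sup>2 = (\<Sum>i\<in>UNIV. (norm (cadj (A i) h))\<^sup>2)"
  by (simp add: hnorm_sq_finite hnth_cadj_row)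

lemma cadj_op_power_Nil: "cadj (op_power A []) h = h"
  using cadj_id by (simp add: op_power_def id_def)

lemma cadj_op_power_snoc: "cadj (op_power A (\<alpha> @ [i])) h = cadj (A i) (cadj (op_power A \<alpha>) h)"
  by (subst cadj_eqI[where B = "\<lambda>h. cadj (A i) (cadj (op_power A \<alpha>) h)"])
    (auto intro: bounded_clinear_op_power bounded_clinear_eval
      simp: op_power_append cadj[OF bounded_clinear_op_power[OF bounded_clinear_eval]] cadj[OF bounded_clinear_eval])

text \<open>With u the value of the adjoint of A_\<alpha> at h, each term is |u|^2 minus the sum
  over i of |A_i^* u|^2, and the subtracted part leads the next degree. The nonnegative remainder
  makes the Poisson kernel a contraction.\<close>

lemma poisson_telescope:
  "(\<Sum>k\<le>m. \<Sum>\<alpha>\<in>words k. (norm (D (cadj (op_power A \<alpha>) h)))\<^sup>2) =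
   (norm h)\<^sup>2 - (\<Sum>\<alpha>\<in>words (Suc m). (norm (cadj (op_power A \<alpha>) h))\<^sup>2)"
proof (induction m)
  case 0
  have "cadj (op_power A [i]) h = cadj (A i) h" for i
    using cadj_op_power_snoc[of "[]" i h] by (simp add: cadj_op_power_Nil)
  thus ?case
    by (simp add: sum_words_Suc cadj_op_power_Nil norm_defect norm_cadj_row)
next
  case (Suc m)
  have "(\<Sum>\<alpha>\<in>words (Suc m). (norm (D (cadj (op_power A \<alpha>) h)))\<^sup>2) =
    (\<Sum>\<alpha>\<in>words (Suc m). (norm (cadj (op_power A \<alpha>) h))\<^sup>2) -
    (\<Sum>\<alpha>\<in>words (Suc (Suc m)). (norm (cadj (op_power A \<alpha>) h))\<^sup>2)"
    unfolding sum_words_snoc[of _ "Suc m"] by (simp add: norm_defect norm_cadj_row sum_subtractf cadj_op_power_snoc)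
  thus ?case using Suc by simp
qed

lemma
  shows hnth_poisson_kernel: "hnth (poisson_kernel f T h) \<alpha> = D (cadj (op_power A \<alpha>) h)"
    and norm_poisson_kernel: "norm (poisson_kernel f T h) \<le> norm h"
proof -
  have "(\<Sum>k\<le>m. \<Sum>\<alpha>\<in>words k. (norm (D (cadj (op_power A \<alpha>) h)))\<^sup>2) \<le> (norm h)\<^sup>2" for m
    unfolding poisson_telescope by (simp add: sum_nonneg)
  from words_hnorm_le[OF this] show "hnth (poisson_kernel f T h) \<alpha> = D (cadj (op_power A \<alpha>) h)"
    and "norm (poisson_kernel f T h) \<le> norm h"
    by (simp_all add: poisson_kernel_def)
qed

lemma bounded_clinear_poisson_kernel: "bounded_clinear (poisson_kernel f T)"
  by (rule bounded_clinearI[where K = 1])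
    (auto intro!: hsum_eqI simp: hnth_poisson_kernel norm_poisson_kernel
      bounded_clinear_simps[OF bounded_clinear_defect]
      bounded_clinear_simps[OF bounded_clinear_cadj[OF bounded_clinear_op_power[OF bounded_clinear_eval]]])

lemma defect_mem: "D h \<in> defect_space f T" "Ds x \<in> defect_star_space f T"
  unfolding defect_space_def defect_star_space_def by (rule subsetD[OF closure_subset rangeI])+

lemma poisson_diagonal:
  "cinner (cadj_on UNIV (H2_tensor (defect_space f T)) (poisson_kernel f T)
     (Q_le m (poisson_kernel f T h))) h =
   of_real (\<Sum>k\<le>m. \<Sum>\<alpha>\<in>words k. (norm (D (cadj (op_power A \<alpha>) h)))\<^sup>2)"
proof -
  let ?K = "poisson_kernel f T"
  \<comment> \<open>Truncation inserts zeros, and the adjoint of the kernel is specified only on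
    H^2(f) tensored with the defect space.\<close>
  have "0 \<in> defect_space f T"
    using defect_mem(1)[of 0] by (simp add: bounded_clinear_simps[OF bounded_clinear_defect])
  hence mem: "Q_le m (?K h) \<in> H2_tensor (defect_space f T)"
    by (simp add: H2_tensor_def hnth_poisson_kernel defect_mem)
  have "cinner (cadj_on UNIV (H2_tensor (defect_space f T)) ?K (Q_le m (?K h))) h =
      cinner (Q_le m (?K h)) (?K h)"
    using cadj_on[OF bounded_clinear_poisson_kernel closed_UNIV csubspace_UNIV mem, of h]
    by (metis UNIV_I cinner_commute)
  also have "\<dots> = (\<Sum>\<alpha> | length \<alpha> \<le> m. cinner (hnth (?K h) \<alpha>) (hnth (?K h) \<alpha>))"
    by (rule has_sum_unique[OF hsum_cinner])
      (rule has_sum_finite_neutralI[of "{\<alpha>. length \<alpha> \<le> m}"]; auto)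
  finally show ?thesis by (simp add: sum_words_le cinner_self hnth_poisson_kernel)
qed

end

section \<open>Traces for a defect operator of finite rank\<close>

locale finite_defect_tuple = contractive_tuple +
  fixes C assumes onb: "is_onb (range (defect f T)) C" and fin: "finite C"
begin

text \<open>The squared Hilbert-Schmidt norms of A_\<alpha> \<Delta>, summed over words of length
  \<open>k\<close>; \<Delta> vanishes on the orthogonal complement of its range, so the finite basis
  \<open>C\<close> suffices.\<close>

definition defect_trace :: "nat \<Rightarrow> real" where
  "defect_trace k = (\<Sum>\<alpha>\<in>words k. \<Sum>d\<in>C. (norm (op_power A \<alpha> (D d)))\<^sup>2)"

lemma defect_trace_nonneg: "0 \<le> defect_trace k"
  unfolding defect_trace_def by (intro sum_nonneg) auto

lemma defect_trace_Suc:
  "defect_trace (Suc k) = (\<Sum>i\<in>UNIV. \<Sum>\<alpha>\<in>words k. \<Sum>d\<in>C. (norm (A i (op_power A \<alpha> (D d))))\<^sup>2)"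
  by (simp add: defect_trace_def sum_words_Suc)

lemma defect_trace_Suc_le: "defect_trace (Suc k) \<le> CARD('a) * defect_trace k"
proof -
  have "defect_trace (Suc k) \<le> (\<Sum>i\<in>(UNIV :: 'a set). defect_trace k)"
    unfolding defect_trace_Suc unfolding defect_trace_def
    by (intro sum_mono power_mono norm_eval) auto
  thus ?thesis by simp
qed

text \<open>Expanding \<Delta> A_\<alpha>^* e in \<open>C\<close> produces the coefficients of the
  vectors A_\<alpha> \<Delta> d in the basis \<open>E\<close>, which Parseval sums over e. The sums
  over words and over \<open>C\<close> are finite, so no limits are interchanged.\<close>

lemma poisson_trace_eq: "poisson_trace f T m = of_real (\<Sum>k\<le>m. defect_trace k)"
  unfolding poisson_trace_def
proof (rule optrace_eqI)
  fix E :: "'b set" assume E: "is_onb UNIV E"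
  have "((\<lambda>e. \<Sum>k\<le>m. \<Sum>\<alpha>\<in>words k. (norm (D (cadj (op_power A \<alpha>) e)))\<^sup>2) has_sum
     (\<Sum>k\<le>m. defect_trace k)) E"
    unfolding defect_trace_def
  proof (intro has_sum_finite_sum)
    fix \<alpha> :: "'a list"
    have eq: "(norm (D (cadj (op_power A \<alpha>) e)))\<^sup>2 = (\<Sum>d\<in>C. (cmod (cinner (op_power A \<alpha> (D d)) e))\<^sup>2)" for e
    proof -
      have "cmod (cinner (D (cadj (op_power A \<alpha>) e)) d) = cmod (cinner (op_power A \<alpha> (D d)) e)" for d
        unfolding defect_selfadj cadj'[OF bounded_clinear_op_power[OF bounded_clinear_eval]]
        by (rule cmod_cinner_commute)
      thus ?thesis
        using onb_finite_parseval[OF onb fin csubspace_range[OF bounded_clinear_defect] rangeI] by simp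
    qed
    show "((\<lambda>e. (norm (D (cadj (op_power A \<alpha>) e)))\<^sup>2) has_sum (\<Sum>d\<in>C. (norm (op_power A \<alpha> (D d)))\<^sup>2)) E"
      unfolding eq by (intro has_sum_finite_sum parseval[OF E closed_UNIV csubspace_UNIV UNIV_I])
  qed
  thus "has_diagonal_sum (\<lambda>h. cadj_on UNIV (H2_tensor (defect_space f T)) (poisson_kernel f T)
      (Q_le m (poisson_kernel f T h))) E (of_real (\<Sum>k\<le>m. defect_trace k))"
    unfolding has_diagonal_sum_def poisson_diagonal by (rule has_sum_of_real)
qed

text \<open>A range with a finite orthonormal basis is the zero set of the identity minus a finite
  sum of continuous maps, hence closed. Elements of the defect space can then be written as \<Delta>
  h.\<close>

lemma defect_space_eq: "defect_space f T = range D"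
proof -
  let ?P = "\<lambda>x. x - (\<Sum>d\<in>C. cinner x d *\<^sub>C d)"
  have "continuous_on UNIV ?P"
  proof (intro continuous_on_diff continuous_on_id continuous_on_sum)
    have "bounded_clinear (\<lambda>x. cinner x d *\<^sub>C d)" for d
      by (rule bounded_clinearI[where K = "2 * norm d * norm d"])
        (use mult_right_mono[OF norm_cinner_le[of _ d] norm_ge_zero[of d]] in
          \<open>auto simp: cinner_simps scaleC_add_left scaleC_scaleC norm_scaleC algebra_simps\<close>)
    thus "continuous_on UNIV (\<lambda>x. cinner x d *\<^sub>C d)" for d by (rule bounded_clinear_continuous_on)
  qed
  hence cl: "closed {x. ?P x = 0}" by (intro closed_Collect_eq continuous_on_const)
  have "closure (range D) \<subseteq> {x. ?P x = 0}"
    using onb_finite_expansion[OF onb fin csubspace_range[OF bounded_clinear_defect]]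
    by (intro closure_minimal cl) auto
  also have "\<dots> \<subseteq> range D"
  proof clarify
    fix x assume "?P x = 0"
    hence "x = (\<Sum>d\<in>C. cinner x d *\<^sub>C d)" by simp
    also have "\<dots> \<in> range D"
      using is_onbD(1)[OF onb] csubspace_range[OF bounded_clinear_defect]
      by (intro complex_vector.subspace_sum complex_vector.subspace_scale) auto
    finally show "x \<in> range D" .
  qed
  finally show ?thesis unfolding defect_space_def using closure_subset by blast
qed

end

section \<open>The characteristic function\<close>

lemma hnth_ampl [simp]:
  assumes "bounded_clinear X" shows "hnth (ampl X x) \<alpha> = X (hnth x \<alpha>)"
proof -
  obtain K where K: "K > 0" "\<And>v. norm (X v) \<le> norm v * K" using bounded_clinear_bound[OF assms] by blast
  have "l2_summable (\<lambda>\<alpha>. X (hnth x \<alpha>))"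
    by (rule l2_summable_mono[OF l2_summable_scaleR[OF hnth_l2[of x], of K]])
      (use K in \<open>auto simp: mult.commute\<close>)
  thus ?thesis by (simp add: ampl_def)
qed

lemma words_sum_le_norm: "(\<Sum>k\<le>m. \<Sum>\<alpha>\<in>words k. (norm (hnth x \<alpha>))\<^sup>2) \<le> (norm x)\<^sup>2"
  for x :: "('n :: finite list, 'k :: chilbert_space) hsum"
  unfolding sum_words_le[symmetric] by (rule hnorm_finite_le) simp

lemma hnth_right_mult:
  "hnth (right_mult i x) \<beta> = (if \<beta> \<noteq> [] \<and> last \<beta> = i then hnth x (butlast \<beta>) else 0)"
  for x :: "('n :: finite list, 'k :: chilbert_space) hsum"
proof -
  let ?y = "\<lambda>\<beta>. if \<beta> \<noteq> [] \<and> last \<beta> = i then hnth x (butlast \<beta>) else 0"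
  have "(\<Sum>k\<le>m. \<Sum>\<alpha>\<in>words k. (norm (?y \<alpha>))\<^sup>2) \<le> (norm x)\<^sup>2" for m
  proof -
    have shift: "(\<Sum>\<alpha>\<in>words (Suc k). (norm (?y \<alpha>))\<^sup>2) = (\<Sum>\<alpha>\<in>words k. (norm (hnth x \<alpha>))\<^sup>2)" for k
      by (simp add: sum_words_snoc if_distrib[of norm] if_distrib[of "\<lambda>t. t\<^sup>2"] cong: if_cong)
    have "(\<Sum>k\<le>m. \<Sum>\<alpha>\<in>words k. (norm (?y \<alpha>))\<^sup>2) \<le> (\<Sum>k\<le>Suc m. \<Sum>\<alpha>\<in>words k. (norm (?y \<alpha>))\<^sup>2)"
      by (simp add: sum_nonneg)
    also have "\<dots> = (\<Sum>k\<le>m. \<Sum>\<alpha>\<in>words k. (norm (hnth x \<alpha>))\<^sup>2)"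
      unfolding sum.atMost_Suc_shift shift by simp
    also have "\<dots> \<le> (norm x)\<^sup>2" by (rule words_sum_le_norm)
    finally show ?thesis .
  qed
  from words_hnorm_le(1)[OF this] show ?thesis by (simp add: right_mult_def)
qed

subsection \<open>Radial scaling\<close>

text \<open>Moving this dilation past right multiplication by f_i produces a factor
  \<open>r\<close>, which is how the limit r \<rightarrow> 1 becomes accessible.\<close>

definition radial :: "real \<Rightarrow> ('n list, 'k :: chilbert_space) hsum \<Rightarrow> ('n list, 'k) hsum" where
  "radial r x = Abs_hsum (\<lambda>\<alpha>. r ^ length \<alpha> *\<^sub>R hnth x \<alpha>)"

lemma hnth_radial: "0 \<le> r \<Longrightarrow> r \<le> 1 \<Longrightarrow> hnth (radial r x) \<alpha> = r ^ length \<alpha> *\<^sub>R hnth x \<alpha>"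
proof -
  assume r: "0 \<le> r" "r \<le> 1"
  have "l2_summable (\<lambda>\<alpha>. r ^ length \<alpha> *\<^sub>R hnth x \<alpha>)"
    by (rule l2_summable_mono[OF hnth_l2[of x]]) (use r in \<open>auto simp: power_le_one mult_left_le_one_le\<close>)
  thus ?thesis by (simp add: radial_def)
qed

text \<open>A finite set \<open>F\<close> carries all but \<open>e\<close> of the squared norm of x.
  On \<open>F\<close> the factors 1 - r^k tend to 0, and off \<open>F\<close> they are at most
  1.\<close>

lemma radial_tendsto: "((\<lambda>r. radial r x) \<longlongrightarrow> x) (at_left 1)"
proof (rule Lim_null[THEN iffD2], rule tendsto_norm_zero_cancel, rule order_tendstoI)
  fix a :: real assume "a < 0"
  thus "\<forall>\<^sub>F r in at_left 1. a < norm (radial r x - x)" by (simp add: less_le_trans[OF _ norm_ge_zero])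
next
  fix a :: real assume a: "0 < a"
  \<comment> \<open>One half of a^2 is for the words in \<open>F\<close>, the other for the
    rest.\<close>
  define e where "e = a\<^sup>2 / 2"
  have e: "e > 0" using a by (simp add: e_def)
  have "((\<lambda>\<alpha>. (norm (hnth x \<alpha>))\<^sup>2) has_sum (norm x)\<^sup>2) UNIV"
    unfolding hnorm_sq using hnth_l2[of x] unfolding l2_summable_def by (rule has_sum_infsum)
  from this[unfolded has_sum_def tendsto_iff eventually_finite_subsets_at_top] e
  obtain F where F: "finite F" "dist (\<Sum>\<alpha>\<in>F. (norm (hnth x \<alpha>))\<^sup>2) ((norm x)\<^sup>2) < e" by blast
  define q where "q r = (\<Sum>\<alpha>\<in>F. ((1 - r ^ length \<alpha>) * norm (hnth x \<alpha>))\<^sup>2)" for r :: real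
  have "(q \<longlongrightarrow> (\<Sum>\<alpha>\<in>F. ((1 - 1 ^ length \<alpha>) * norm (hnth x \<alpha>))\<^sup>2)) (at_left 1)"
    unfolding q_def by (intro tendsto_intros)
  hence "\<forall>\<^sub>F r in at_left 1. q r < e" using e by (intro order_tendstoD(2)) auto
  moreover have "\<forall>\<^sub>F r in at_left 1. 0 < r \<and> r < (1 :: real)"
    using eventually_at_left_real[of 0 1] by simp
  ultimately show "\<forall>\<^sub>F r in at_left 1. norm (radial r x - x) < a"
  proof eventually_elim
    case (elim r)
    let ?z = "radial r x - x"
    have z: "norm (hnth ?z \<alpha>) = (1 - r ^ length \<alpha>) * norm (hnth x \<alpha>)" for \<alpha>
    proof -
      have "hnth ?z \<alpha> = (r ^ length \<alpha> - 1) *\<^sub>R hnth x \<alpha>"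
        using elim by (simp add: hnth_radial scaleR_left_diff_distrib)
      thus ?thesis using elim by (simp add: power_le_one)
    qed
    have zle: "(norm (hnth ?z \<alpha>))\<^sup>2 \<le> (norm (hnth x \<alpha>))\<^sup>2" for \<alpha>
      unfolding z using elim by (intro power_mono mult_left_le_one_le) (auto simp: power_le_one)
    have "(\<Sum>\<alpha>\<in>G. (norm (hnth ?z \<alpha>))\<^sup>2) \<le> (sqrt (q r + e))\<^sup>2" if G: "finite G" for G
    proof -
      have "(\<Sum>\<alpha>\<in>G. (norm (hnth ?z \<alpha>))\<^sup>2) \<le> (\<Sum>\<alpha>\<in>F \<union> (G - F). (norm (hnth ?z \<alpha>))\<^sup>2)"
        using F(1) G by (intro sum_mono2) auto
      also have "\<dots> = q r + (\<Sum>\<alpha>\<in>G - F. (norm (hnth ?z \<alpha>))\<^sup>2)"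
        using F(1) G by (subst sum.union_disjoint) (auto simp: q_def simp flip: z)
      also have "\<dots> \<le> q r + (\<Sum>\<alpha>\<in>G - F. (norm (hnth x \<alpha>))\<^sup>2)"
        by (intro add_left_mono sum_mono zle)
      also have "(\<Sum>\<alpha>\<in>G - F. (norm (hnth x \<alpha>))\<^sup>2) \<le> e"
      proof -
        have "(\<Sum>\<alpha>\<in>F. (norm (hnth x \<alpha>))\<^sup>2) + (\<Sum>\<alpha>\<in>G - F. (norm (hnth x \<alpha>))\<^sup>2) =
            (\<Sum>\<alpha>\<in>F \<union> (G - F). (norm (hnth x \<alpha>))\<^sup>2)"
          using F(1) G by (subst sum.union_disjoint) auto
        also have "\<dots> \<le> (norm x)\<^sup>2" using F(1) G by (intro hnorm_finite_le) auto
        finally show ?thesis using F(2) by (simp add: dist_real_def)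
      qed
      also have "q r + e = (sqrt (q r + e))\<^sup>2" using e by (simp add: q_def sum_nonneg add_nonneg_nonneg)
      finally show ?thesis by simp
    qed
    from hnorm_le_finite(2)[OF this, unfolded hnth_inverse] have "norm ?z \<le> sqrt (q r + e)"
      using e by (simp add: q_def sum_nonneg add_nonneg_nonneg)
    also have "\<dots> < sqrt (a\<^sup>2)" using elim e by (intro real_sqrt_less_mono) (simp add: e_def)
    finally show ?case using a by simp
  qed
qed

section \<open>The characteristic function as the transfer function of an isometry\<close>

context contractive_tuple
begin

text \<open>The coordinates of \<open>(I - \<Sum> r \<Lambda>\<^sub>i \<otimes> f\<^sub>i(T)\<^sup>*)\<^sup>-\<^sup>1 [r \<Lambda>\<^sub>1, \<dots>, r \<Lambda>\<^sub>n] (I \<otimes> \<Delta>\<^sub>*) x\<close> solve a recursion that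
  appends letters on the right, hence the reversed words.\<close>

primrec state_rev :: "real \<Rightarrow> ('n list \<Rightarrow> ('n, 'h) hsum) \<Rightarrow> 'n list \<Rightarrow> 'h" where
  "state_rev r x [] = 0"
| "state_rev r x (i # \<delta>) = r *\<^sub>R (hnth (Ds (x (rev \<delta>))) i + cadj (A i) (state_rev r x \<delta>))"

definition state :: "real \<Rightarrow> ('n list \<Rightarrow> ('n, 'h) hsum) \<Rightarrow> 'n list \<Rightarrow> 'h" where
  "state r x \<beta> = state_rev r x (rev \<beta>)"

lemma state_simps [simp]:
  "state r x [] = 0"
  "state r x (\<gamma> @ [i]) = r *\<^sub>R (hnth (Ds (x \<gamma>)) i + cadj (A i) (state r x \<gamma>))"
  by (simp_all add: state_def)

lemmas cadj_eval_simps = bounded_clinear_simps[OF bounded_clinear_cadj[OF bounded_clinear_eval]]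
lemmas defect_simps = bounded_clinear_simps[OF bounded_clinear_defect]
lemmas defect_star_simps = bounded_clinear_simps[OF bounded_clinear_defect_star]
lemmas row_simps = bounded_clinear_simps[OF bounded_clinear_row]

lemma state_add: "state r (\<lambda>\<alpha>. x \<alpha> + y \<alpha>) \<beta> = state r x \<beta> + state r y \<beta>"
  by (induction \<beta> rule: rev_induct) (simp_all add: cadj_eval_simps defect_star_simps algebra_simps)

lemma state_scaleC: "state r (\<lambda>\<alpha>. c *\<^sub>C x \<alpha>) \<beta> = c *\<^sub>C state r x \<beta>"
  by (induction \<beta> rule: rev_induct)
    (simp_all add: cadj_eval_simps defect_star_simps scaleC_add_right
      bounded_clinear_simps(5)[OF bounded_clinear_scaleC[OF bounded_clinear_id]])

lemma state_radial: "state r (\<lambda>\<alpha>. r ^ length \<alpha> *\<^sub>R x \<alpha>) \<beta> = r ^ length \<beta> *\<^sub>R state 1 x \<beta>"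
  by (induction \<beta> rule: rev_induct) (simp_all add: cadj_eval_simps defect_star_simps scaleR_add_right)

text \<open>The operator matrix with rows \<open>(\<Delta>\<^sub>*, f(T)\<^sup>*)\<close> and \<open>(-f(T), \<Delta>)\<close> is isometric.\<close>

lemma julia: "(norm (Ds v + cadj Ar u))\<^sup>2 + (norm (- Ar v + D u))\<^sup>2 = (norm u)\<^sup>2 + (norm v)\<^sup>2"
proof -
  have "inner (Ds v) (cadj Ar u) = Re (cinner (Ar (Ds v)) u)"
    unfolding cadj[OF bounded_clinear_row] by (simp add: inner_eq_Re_cinner)
  also have "\<dots> = inner (Ar v) (D u)"
    unfolding row_defect_star defect_selfadj by (simp add: inner_eq_Re_cinner)
  finally have cross: "inner (Ds v) (cadj Ar u) = inner (Ar v) (D u)" .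
  have "(norm (Ds v + cadj Ar u))\<^sup>2 = (norm (Ds v))\<^sup>2 + (norm (cadj Ar u))\<^sup>2 + 2 * inner (Ds v) (cadj Ar u)"
    by (simp add: power2_norm_eq_inner inner_simps inner_commute)
  moreover have "(norm (- Ar v + D u))\<^sup>2 = (norm (Ar v))\<^sup>2 + (norm (D u))\<^sup>2 - 2 * inner (Ar v) (D u)"
    by (simp add: power2_norm_eq_inner inner_simps inner_commute)
  ultimately show ?thesis using cross by (simp add: norm_defect norm_defect_star)
qed

text \<open>An energy balance. By \<open>julia\<close>, state and input together have the energy of
  the output and of the unscaled next states; the factor r \<le> 1 can only lose energy, and the
  initial state is 0. Over all degrees the outputs therefore cannot exceed the inputs.\<close>

lemma julia_sum:
  assumes r: "0 < r" "r \<le> 1"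
  shows "(\<Sum>k\<le>m. \<Sum>\<beta>\<in>words k. (norm (- Ar (x \<beta>) + D (state r x \<beta>)))\<^sup>2) \<le>
    (\<Sum>k\<le>m. \<Sum>\<beta>\<in>words k. (norm (x \<beta>))\<^sup>2)"
proof -
  define Y where "Y k = (\<Sum>\<beta>\<in>words k. (norm (state r x \<beta>))\<^sup>2)" for k
  have step: "Y (Suc k) + (\<Sum>\<beta>\<in>words k. (norm (- Ar (x \<beta>) + D (state r x \<beta>)))\<^sup>2) \<le>
      Y k + (\<Sum>\<beta>\<in>words k. (norm (x \<beta>))\<^sup>2)" for k
  proof -
    have "(\<Sum>i\<in>UNIV. (norm (state r x (\<beta> @ [i])))\<^sup>2) \<le> (norm (Ds (x \<beta>) + cadj Ar (state r x \<beta>)))\<^sup>2" for \<beta>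
    proof -
      have "(\<Sum>i\<in>UNIV. (norm (state r x (\<beta> @ [i])))\<^sup>2) = r\<^sup>2 * (norm (Ds (x \<beta>) + cadj Ar (state r x \<beta>)))\<^sup>2"
        by (simp add: hnorm_sq_finite hnth_cadj_row power_mult_distrib sum_distrib_left)
      also have "\<dots> \<le> 1 * (norm (Ds (x \<beta>) + cadj Ar (state r x \<beta>)))\<^sup>2"
        using r by (intro mult_right_mono power_le_one) auto
      finally show ?thesis by simp
    qed
    hence "Y (Suc k) \<le> (\<Sum>\<beta>\<in>words k. (norm (Ds (x \<beta>) + cadj Ar (state r x \<beta>)))\<^sup>2)"
      unfolding Y_def sum_words_snoc by (rule sum_mono)
    hence "Y (Suc k) + (\<Sum>\<beta>\<in>words k. (norm (- Ar (x \<beta>) + D (state r x \<beta>)))\<^sup>2) \<le>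
      (\<Sum>\<beta>\<in>words k. (norm (Ds (x \<beta>) + cadj Ar (state r x \<beta>)))\<^sup>2 + (norm (- Ar (x \<beta>) + D (state r x \<beta>)))\<^sup>2)"
      by (simp add: sum.distrib)
    also have "\<dots> = Y k + (\<Sum>\<beta>\<in>words k. (norm (x \<beta>))\<^sup>2)"
      unfolding julia by (simp add: Y_def sum.distrib)
    finally show ?thesis .
  qed
  have Y: "0 \<le> Y k" "Y 0 = 0" for k by (simp_all add: Y_def sum_nonneg)
  have "Y (Suc m) + (\<Sum>k\<le>m. \<Sum>\<beta>\<in>words k. (norm (- Ar (x \<beta>) + D (state r x \<beta>)))\<^sup>2) \<le>
    (\<Sum>k\<le>m. \<Sum>\<beta>\<in>words k. (norm (x \<beta>))\<^sup>2)"
  proof (induction m)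
    case 0
    show ?case using step[of 0] Y by simp
  next
    case (Suc m)
    show ?case using Suc step[of "Suc m"] by simp
  qed
  thus ?thesis using Y(1)[of "Suc m"] by linarith
qed

text \<open>The coordinates come from the recursion instead of an inverse operator, so the formula
  also makes sense at r = 1.\<close>

definition Theta :: "real \<Rightarrow> ('n list, ('n, 'h) hsum) hsum \<Rightarrow> ('n list, 'h) hsum" where
  "Theta r x = Abs_hsum (\<lambda>\<beta>. - Ar (hnth x \<beta>) + D (state r (hnth x) \<beta>))"

lemma
  assumes r: "0 < r" "r \<le> 1"
  shows hnth_Theta: "hnth (Theta r x) \<beta> = - Ar (hnth x \<beta>) + D (state r (hnth x) \<beta>)"
    and norm_Theta: "norm (Theta r x) \<le> norm x"
proof -
  have "(\<Sum>k\<le>m. \<Sum>\<beta>\<in>words k. (norm (- Ar (hnth x \<beta>) + D (state r (hnth x) \<beta>)))\<^sup>2) \<le> (norm x)\<^sup>2" for m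
    using julia_sum[OF r, of "hnth x" m] words_sum_le_norm[of x m] by (rule order_trans)
  note * = words_hnorm_le[OF this norm_ge_zero]
  show "hnth (Theta r x) \<beta> = - Ar (hnth x \<beta>) + D (state r (hnth x) \<beta>)" "norm (Theta r x) \<le> norm x"
    unfolding Theta_def by (simp_all only: hnth_Abs[OF *(1)] *(2))
qed

lemma bounded_clinear_Theta:
  assumes r: "0 < r" "r \<le> 1" shows "bounded_clinear (Theta r)"
proof -
  have hnth_fun: "hnth (x + y) = (\<lambda>\<alpha>. hnth x \<alpha> + hnth y \<alpha>)" "hnth (c *\<^sub>C x) = (\<lambda>\<alpha>. c *\<^sub>C hnth x \<alpha>)"
    for x y :: "('n list, ('n, 'h) hsum) hsum" and c
    by (simp_all add: fun_eq_iff)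
  show ?thesis
  proof (rule bounded_clinearI[where K = 1])
    show "Theta r (x + y) = Theta r x + Theta r y" for x y
      by (rule hsum_eqI) (simp add: hnth_Theta[OF r] row_simps defect_simps state_add hnth_fun)
    show "Theta r (c *\<^sub>C x) = c *\<^sub>C Theta r x" for c x
      by (rule hsum_eqI) (simp add: hnth_Theta[OF r] row_simps defect_simps state_scaleC hnth_fun
          complex_vector.scale_right_diff_distrib scaleC_add_right)
    show "norm (Theta r x) \<le> norm x * 1" for x using norm_Theta[OF r] by simp
  qed
qed

lemma Theta_radial:
  assumes r: "0 < r" "r \<le> 1" shows "Theta r (radial r x) = radial r (Theta 1 x)"
proof (rule hsum_eqI)
  fix \<beta>
  have "hnth (radial r x) = (\<lambda>\<alpha>. r ^ length \<alpha> *\<^sub>R hnth x \<alpha>)"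
    using r by (intro ext hnth_radial) auto
  thus "hnth (Theta r (radial r x)) \<beta> = hnth (radial r (Theta 1 x)) \<beta>"
    using r by (simp add: hnth_Theta hnth_radial state_radial row_simps defect_simps scaleR_right_diff_distrib
        scaleR_add_right)
qed

text \<open>By \<open>Theta_radial\<close> the difference is \<open>Theta r\<close> applied to x
  minus its dilation, plus the dilation error of \<open>Theta 1 x\<close>. As all
  \<open>Theta r\<close> are contractions, convergence reduces to that of the dilation.\<close>

lemma Theta_tendsto: "((\<lambda>r. Theta r x) \<longlongrightarrow> Theta 1 x) (at_left 1)"
proof (rule Lim_null[THEN iffD2], rule Lim_null_comparison)
  have "((\<lambda>r. norm (radial r x - x) + norm (radial r (Theta 1 x) - Theta 1 x)) \<longlongrightarrow> norm (x - x) + norm (Theta 1 x - Theta 1 x)) (at_left 1)"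
    by (intro tendsto_intros radial_tendsto)
  thus "((\<lambda>r. norm (radial r x - x) + norm (radial r (Theta 1 x) - Theta 1 x)) \<longlongrightarrow> 0) (at_left 1)" by simp
  have "\<forall>\<^sub>F r in at_left 1. 0 < r \<and> r < (1 :: real)"
    using eventually_at_left_real[of 0 1] by simp
  thus "\<forall>\<^sub>F r in at_left 1. norm (Theta r x - Theta 1 x) \<le> norm (radial r x - x) + norm (radial r (Theta 1 x) - Theta 1 x)"
  proof eventually_elim
    case (elim r)
    hence r: "0 < r" "r \<le> 1" by auto
    have "Theta r x - Theta 1 x = - Theta r (radial r x - x) + (radial r (Theta 1 x) - Theta 1 x)"
      by (simp add: bounded_clinear_simps[OF bounded_clinear_Theta[OF r]] Theta_radial[OF r])
    also have "norm \<dots> \<le> norm (Theta r (radial r x - x)) + norm (radial r (Theta 1 x) - Theta 1 x)"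
      by (metis norm_minus_cancel norm_triangle_ineq)
    finally show ?case using norm_Theta[OF r, of "radial r x - x"] by linarith
  qed
qed

text \<open>\<open>inv\<close> chooses some preimage, so surjectivity of I - B suffices: the
  coordinates of any solution of y - B y = z obey the recursion of \<open>state\<close>, which
  determines them.\<close>

lemma char_fun_r_eq:
  assumes r: "0 < r" "r < 1" shows "char_fun_r f T r x = Theta r x"
proof -
  define B where "B y = (\<Sum>i\<in>UNIV. r *\<^sub>R right_mult i (ampl (cadj (A i)) y))" for y :: "('n list, 'h) hsum"
  note Aadj = bounded_clinear_cadj[OF bounded_clinear_eval]
  have B0: "hnth (B y) [] = 0" for y by (simp add: B_def hnth_right_mult)
  have BS: "hnth (B y) (\<gamma> @ [i]) = r *\<^sub>R cadj (A i) (hnth y \<gamma>)" for y \<gamma> i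
  proof -
    have "hnth (B y) (\<gamma> @ [i]) = (\<Sum>j\<in>UNIV. if j = i then r *\<^sub>R cadj (A i) (hnth y \<gamma>) else 0)"
      unfolding B_def hnth_sum by (intro sum.cong) (auto simp: hnth_right_mult Aadj)
    thus ?thesis by simp
  qed
  have Bdiff: "B y - B z = B (y - z)" for y z
  proof (rule hsum_eqI)
    show "hnth (B y - B z) \<beta> = hnth (B (y - z)) \<beta>" for \<beta>
      by (cases \<beta> rule: rev_cases) (simp_all add: B0 BS cadj_eval_simps algebra_simps)
  qed
  have Bnorm: "norm (B y) \<le> r * norm y" for y
  proof -
    have "(\<Sum>k\<le>m. \<Sum>\<alpha>\<in>words k. (norm (hnth (B y) \<alpha>))\<^sup>2) \<le> (r * norm y)\<^sup>2" for m
    proof -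
      have shift: "(\<Sum>\<alpha>\<in>words (Suc k). (norm (hnth (B y) \<alpha>))\<^sup>2) \<le> r\<^sup>2 * (\<Sum>\<alpha>\<in>words k. (norm (hnth y \<alpha>))\<^sup>2)" for k
      proof -
        have "(norm (cadj Ar u))\<^sup>2 \<le> (norm u)\<^sup>2" for u
          using norm_defect[of u] zero_le_power2[of "norm (D u)"] by linarith
        thus ?thesis unfolding sum_words_snoc BS
          by (simp add: power_mult_distrib sum_distrib_left[symmetric] norm_cadj_row[symmetric] mult_left_mono sum_mono)
      qed
      have "(\<Sum>k\<le>m. \<Sum>\<alpha>\<in>words k. (norm (hnth (B y) \<alpha>))\<^sup>2) \<le> (\<Sum>k\<le>Suc m. \<Sum>\<alpha>\<in>words k. (norm (hnth (B y) \<alpha>))\<^sup>2)"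
        by (simp add: sum_nonneg)
      also have "\<dots> = (\<Sum>k\<le>m. \<Sum>\<alpha>\<in>words (Suc k). (norm (hnth (B y) \<alpha>))\<^sup>2)"
        unfolding sum.atMost_Suc_shift by (simp add: B0)
      also have "\<dots> \<le> (\<Sum>k\<le>m. r\<^sup>2 * (\<Sum>\<alpha>\<in>words k. (norm (hnth y \<alpha>))\<^sup>2))"
        by (intro sum_mono shift)
      also have "\<dots> \<le> r\<^sup>2 * (norm y)\<^sup>2"
        unfolding sum_distrib_left[symmetric] by (intro mult_left_mono words_sum_le_norm) simp
      finally show ?thesis by (simp add: power_mult_distrib)
    qed
    from words_hnorm_le(2)[OF this, unfolded hnth_inverse] show ?thesis using r by simp
  qed
  have surj: "\<exists>y. y - B y = z" for z
  proof -
    \<comment> \<open>A solution is a fixed point of y \<mapsto> z + B y, a contraction with factor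
      r < 1.\<close>
    have "\<exists>!y. z + B y = y"
    proof (rule banach_fix_type)
      show "\<forall>x. \<forall>y. dist (z + B x) (z + B y) \<le> r * dist x y"
        using Bnorm by (simp add: dist_norm Bdiff)
    qed (use r in auto)
    then obtain y where "z + B y = y" by blast
    thus ?thesis by (intro exI[of _ y]) (metis add_diff_cancel_right')
  qed
  define z where "z = (\<Sum>i\<in>UNIV. r *\<^sub>R right_mult i (ampl (\<lambda>v. hnth v i) (ampl Ds x)))"
  have z0: "hnth z [] = 0" by (simp add: z_def hnth_right_mult)
  have zS: "hnth z (\<gamma> @ [i]) = r *\<^sub>R hnth (Ds (hnth x \<gamma>)) i" for \<gamma> i
  proof -
    have "hnth z (\<gamma> @ [i]) = (\<Sum>j\<in>UNIV. if j = i then r *\<^sub>R hnth (Ds (hnth x \<gamma>)) i else 0)"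
      unfolding z_def hnth_sum
      by (intro sum.cong) (auto simp: hnth_right_mult bounded_clinear_hnth bounded_clinear_defect_star)
    thus ?thesis by simp
  qed
  define y where "y = inv (\<lambda>y. y - B y) z"
  have "y - B y = z" unfolding y_def by (rule surj_f_inv_f) (use surj in \<open>metis surjI\<close>)
  hence y: "hnth y \<beta> = hnth z \<beta> + hnth (B y) \<beta>" for \<beta> by (metis diff_add_cancel hnth_simps(2))
  have ys: "hnth y \<beta> = state r (hnth x) \<beta>" for \<beta>
  proof (induction \<beta> rule: rev_induct)
    case Nil
    show ?case by (simp add: y z0 B0)
  next
    case (snoc i \<beta>)
    show ?case by (subst y) (simp add: zS BS snoc scaleR_add_right)
  qed
  have "char_fun_r f T r x = - ampl Ar x + ampl D y"
    unfolding char_fun_r_def y_def z_def B_def[abs_def] by simp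
  thus ?thesis using r
    by (intro hsum_eqI) (simp add: hnth_Theta bounded_clinear_row bounded_clinear_defect ys)
qed

lemma char_fun_eq: "char_fun f T = Theta 1"
proof
  fix x
  have "\<forall>\<^sub>F r in at_left 1. 0 < r \<and> r < (1 :: real)"
    using eventually_at_left_real[of 0 1] by simp
  hence "\<forall>\<^sub>F r in at_left 1. Theta r x = char_fun_r f T r x"
    by eventually_elim (simp add: char_fun_r_eq)
  with Theta_tendsto have "((\<lambda>r. char_fun_r f T r x) \<longlongrightarrow> Theta 1 x) (at_left 1)"
    by (rule Lim_transform_eventually)
  thus "char_fun f T x = Theta 1 x"
    unfolding char_fun_def by (rule tendsto_Lim[OF trivial_limit_at_left_real])
qed

end

section \<open>The curvature limit\<close>

text \<open>The contribution \<open>B\<close> of the first N errors is fixed, while weights of at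
  least 1 make the total weight unbounded; the remaining errors are below e / 2 in the mean.\<close>

lemma weighted_cesaro:
  fixes a w :: "nat \<Rightarrow> real"
  assumes a: "a \<longlonglongrightarrow> L" and w: "\<And>k. 1 \<le> w k"
  shows "(\<lambda>m. (\<Sum>k\<le>m. w k * a k) / (\<Sum>k\<le>m. w k)) \<longlonglongrightarrow> L"
proof (rule Lim_null[THEN iffD2], rule metric_LIMSEQ_I)
  fix e :: real assume "0 < e"
  then obtain N where N: "\<And>k. k \<ge> N \<Longrightarrow> \<bar>a k - L\<bar> < e / 2"
    using metric_LIMSEQ_D[OF a, of "e / 2"] by (auto simp: dist_real_def)
  define B where "B = (\<Sum>k<N. w k * \<bar>a k - L\<bar>)"
  obtain M where M: "B / (e / 2) < real M" using reals_Archimedean2 by blast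
  have w0: "0 \<le> w k" for k using w[of k] by simp
  have "\<bar>(\<Sum>k\<le>m. w k * a k) / (\<Sum>k\<le>m. w k) - L\<bar> < e" if "m \<ge> M" for m
  proof -
    define W where "W = (\<Sum>k\<le>m. w k)"
    have "real m + 1 = (\<Sum>k\<le>m. 1)" by simp
    also have "\<dots> \<le> W" unfolding W_def by (intro sum_mono w)
    finally have W: "real m + 1 \<le> W" .
    have "B < e / 2 * real M" using M \<open>0 < e\<close> by (simp add: pos_divide_less_eq mult.commute)
    also have "\<dots> \<le> e / 2 * W" using W that \<open>0 < e\<close> by (intro mult_left_mono) auto
    finally have BW: "B < e / 2 * W" .
    have "\<bar>\<Sum>k\<le>m. w k * (a k - L)\<bar> \<le> (\<Sum>k\<le>m. w k * \<bar>a k - L\<bar>)"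
      by (rule order_trans[OF sum_abs]) (simp add: abs_mult w0)
    also have "\<dots> \<le> (\<Sum>k\<le>m. (if k < N then w k * \<bar>a k - L\<bar> else 0) + w k * (e / 2))"
    proof (rule sum_mono)
      fix k
      show "w k * \<bar>a k - L\<bar> \<le> (if k < N then w k * \<bar>a k - L\<bar> else 0) + w k * (e / 2)"
        using mult_left_mono[OF less_imp_le[OF N[of k]] w0[of k]] w0[of k] \<open>0 < e\<close> by (cases "k < N") auto
    qed
    also have "\<dots> = (\<Sum>k\<le>m. if k < N then w k * \<bar>a k - L\<bar> else 0) + e / 2 * W"
      unfolding sum.distrib W_def sum_distrib_left by (simp add: mult.commute)
    also have "(\<Sum>k\<le>m. if k < N then w k * \<bar>a k - L\<bar> else 0) \<le> B"
    proof -
      have "(\<Sum>k\<le>m. if k < N then w k * \<bar>a k - L\<bar> else 0) = (\<Sum>k\<in>{..m} \<inter> {..<N}. w k * \<bar>a k - L\<bar>)"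
        by (simp add: sum.inter_restrict lessThan_def)
      also have "\<dots> \<le> B" unfolding B_def by (intro sum_mono2) (auto simp: w0)
      finally show ?thesis .
    qed
    finally have "\<bar>\<Sum>k\<le>m. w k * (a k - L)\<bar> < e * W" using BW by simp
    moreover have "(\<Sum>k\<le>m. w k * a k) / W - L = (\<Sum>k\<le>m. w k * (a k - L)) / W"
      using W by (simp add: field_simps sum_subtractf W_def sum_distrib_left sum_distrib_right)
    ultimately show ?thesis using W by (simp add: W_def[symmetric] abs_divide pos_divide_less_eq)
  qed
  thus "\<exists>M. \<forall>m\<ge>M. dist ((\<Sum>k\<le>m. w k * a k) / (\<Sum>k\<le>m. w k) - L) 0 < e"
    by (auto simp: dist_real_def)
qed

text \<open>With a_k = \<tau>_k / n^k the quotient is the mean of the a_k for the weights n^k, so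
  \<open>weighted_cesaro\<close> applies even for n = 1, where the weights do not grow.\<close>

lemma curvature_limit:
  fixes \<tau> :: "nat \<Rightarrow> real" and n :: real
  assumes n: "1 \<le> n" and \<tau>: "\<And>k. 0 \<le> \<tau> k" "\<And>k. \<tau> (Suc k) \<le> n * \<tau> k"
  obtains L where "(\<lambda>m. (\<Sum>k\<le>m. \<tau> k) / (\<Sum>k\<le>m. n ^ k)) \<longlonglongrightarrow> L"
    and "(\<lambda>k. (n * \<tau> k - \<tau> (Suc k)) / n ^ Suc k) sums (\<tau> 0 - L)"
proof -
  define a where "a k = \<tau> k / n ^ k" for k
  have np: "n ^ k > 0" for k using n by simp
  have "decseq a"
  proof (rule decseq_SucI)
    fix k
    have "\<tau> (Suc k) / n ^ Suc k \<le> n * \<tau> k / n ^ Suc k" using np[of "Suc k"] by (intro divide_right_mono \<tau>(2)) simp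
    thus "a (Suc k) \<le> a k" using n by (simp add: a_def)
  qed
  moreover have "0 \<le> a k" for k using \<tau>(1)[of k] np[of k] by (simp add: a_def)
  ultimately obtain L where L: "a \<longlonglongrightarrow> L" by (blast intro: decseq_convergent)
  have "(\<lambda>m. (\<Sum>k\<le>m. n ^ k * a k) / (\<Sum>k\<le>m. n ^ k)) \<longlonglongrightarrow> L"
    by (rule weighted_cesaro[OF L]) (use n in simp)
  moreover have "n ^ k * a k = \<tau> k" for k using n by (simp add: a_def)
  ultimately have 1: "(\<lambda>m. (\<Sum>k\<le>m. \<tau> k) / (\<Sum>k\<le>m. n ^ k)) \<longlonglongrightarrow> L" by simp
  have "(\<lambda>k. a k - a (Suc k)) sums (a 0 - L)" by (rule telescope_sums'[OF L])
  moreover have "a k - a (Suc k) = (n * \<tau> k - \<tau> (Suc k)) / n ^ Suc k" for k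
    using n by (simp add: a_def field_simps)
  ultimately have "(\<lambda>k. (n * \<tau> k - \<tau> (Suc k)) / n ^ Suc k) sums (\<tau> 0 - L)" by (simp add: a_def)
  with 1 show ?thesis by (rule that)
qed

section \<open>The graded trace\<close>

lemma Q_eq_fixed_iff: "Q_eq k x = x \<longleftrightarrow> (\<forall>\<alpha>. length \<alpha> \<noteq> k \<longrightarrow> hnth x \<alpha> = 0)"
proof
  show "\<forall>\<alpha>. length \<alpha> \<noteq> k \<longrightarrow> hnth x \<alpha> = 0" if "Q_eq k x = x"
    using arg_cong[OF that, of hnth] by (metis hnth_Q_eq)
qed (auto intro: hsum_eqI)

lemma weight_N_homogeneous:
  fixes e :: "('n :: finite list, 'k :: chilbert_space) hsum"
  assumes "Q_eq k e = e" shows "weight_N e = (1 / real CARD('n) ^ k) *\<^sub>R e"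
proof -
  have "Q_eq j e = 0" if "j \<noteq> k" for j
  proof (rule hsum_eqI)
    fix \<alpha>
    show "hnth (Q_eq j e) \<alpha> = hnth 0 \<alpha>"
      using that arg_cong[OF assms, of "\<lambda>x. hnth x \<alpha>"] by (auto split: if_splits)
  qed
  hence "(\<lambda>j. (1 / real CARD('n) ^ j) *\<^sub>R Q_eq j e) sums (\<Sum>j\<in>{k}. (1 / real CARD('n) ^ j) *\<^sub>R Q_eq j e)"
    by (intro sums_finite) auto
  thus ?thesis unfolding weight_N_def using assms by (simp add: sums_iff)
qed

lemma Q_eq_0: "Q_eq 0 x = hsingle [] (hnth x [])"
  by (rule hsum_eqI) auto

lemma homogeneous_degree_unique:
  assumes "Q_eq k e = e" "Q_eq j e = e" "e \<noteq> 0" shows "j = k"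
proof (rule ccontr)
  assume "j \<noteq> k"
  have "e = 0"
  proof (rule hsum_eqI)
    fix \<alpha>
    show "hnth e \<alpha> = hnth 0 \<alpha>"
      using \<open>j \<noteq> k\<close> arg_cong[OF assms(1), of "\<lambda>x. hnth x \<alpha>"] arg_cong[OF assms(2), of "\<lambda>x. hnth x \<alpha>"]
      by (auto split: if_splits)
  qed
  thus False using assms(3) by simp
qed

lemma homogeneous_cinner:
  fixes e e' :: "('n :: finite list, 'k :: chilbert_space) hsum"
  assumes "Q_eq k e = e"
  shows "cinner e' e = (\<Sum>\<alpha>\<in>words k. cinner (hnth e' \<alpha>) (hnth e \<alpha>))"
proof -
  have 0: "hnth e \<alpha> = 0" if "\<alpha> \<notin> words k" for \<alpha>
    using that arg_cong[OF assms, of "\<lambda>x. hnth x \<alpha>"] by (auto simp: words_def)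
  show ?thesis
    by (rule has_sum_unique[OF hsum_cinner], rule has_sum_finite_neutralI[of "words k"]) (auto simp: 0)
qed

lemma homogeneous_orthogonal:
  fixes e e' :: "('n :: finite list, 'k :: chilbert_space) hsum"
  assumes "Q_eq k e = e" "Q_eq j e' = e'" "j \<noteq> k"
  shows "cinner e' e = 0"
proof -
  have "hnth e' \<alpha> = 0" if "\<alpha> \<in> words k" for \<alpha>
    using that assms(3) arg_cong[OF assms(2), of "\<lambda>x. hnth x \<alpha>"] by (auto simp: words_def split: if_splits)
  thus ?thesis unfolding homogeneous_cinner[OF assms(1)] by simp
qed

section \<open>The degree zero coefficient of the adjoint of the characteristic function\<close>

context contractive_tuple
begin

lemma closed_defect_spaces: "closed (defect_space f T)" "csubspace (defect_space f T)"
  "closed (defect_star_space f T)" "csubspace (defect_star_space f T)"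
  unfolding defect_space_def defect_star_space_def
  by (simp_all add: csubspace_closure csubspace_range bounded_clinear_defect bounded_clinear_defect_star)

lemma
  assumes "e \<in> H2_tensor (defect_space f T)"
  shows char_fun_adj_mem: "char_fun_adj f T e \<in> H2_tensor (defect_star_space f T)"
    and char_fun_adj: "x \<in> H2_tensor (defect_star_space f T) \<Longrightarrow>
      cinner (char_fun f T x) e = cinner x (char_fun_adj f T e)"
proof -
  have b: "bounded_clinear (char_fun f T)" unfolding char_fun_eq by (rule bounded_clinear_Theta) auto
  note cl = closed_H2_tensor[OF closed_defect_spaces(3)] H2_tensor_subspace[OF closed_defect_spaces(4)]
  show "char_fun_adj f T e \<in> H2_tensor (defect_star_space f T)"
    unfolding char_fun_adj_def by (rule cadj_on_mem[OF b cl assms])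
  show "x \<in> H2_tensor (defect_star_space f T) \<Longrightarrow>
      cinner (char_fun f T x) e = cinner x (char_fun_adj f T e)"
    unfolding char_fun_adj_def by (rule cadj_on[OF b cl assms])
qed

text \<open>\<open>bottom k\<close> is the adjoint of \<open>v \<mapsto> \<Theta> (1 \<otimes> v)\<close> on the homogeneous component of degree \<open>k\<close>.\<close>

fun bottom :: "nat \<Rightarrow> ('n list, 'h) hsum \<Rightarrow> ('n, 'h) hsum" where
  "bottom 0 e = - cadj Ar (hnth e [])"
| "bottom (Suc k) e = Ds (Abs_hsum (\<lambda>i. \<Sum>\<delta>\<in>words k. op_power A \<delta> (D (hnth e (i # \<delta>)))))"

lemma bounded_clinear_bottom: "bounded_clinear (bottom k)"
proof (cases k)
  case 0
  have "bounded_clinear (\<lambda>e :: ('n list, 'h) hsum. 0 - cadj Ar (hnth e []))"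
    by (intro bounded_clinear_diff bounded_clinear_zero
        bounded_clinear_compose[OF bounded_clinear_cadj[OF bounded_clinear_row] bounded_clinear_hnth])
  moreover have "bottom 0 = (\<lambda>e. 0 - cadj Ar (hnth e []))" by (simp add: fun_eq_iff)
  ultimately show ?thesis using 0 by simp
next
  case (Suc j)
  have "bottom (Suc j) = (\<lambda>e. Ds (\<Sum>i\<in>UNIV. hsingle i (\<Sum>\<delta>\<in>words j. op_power A \<delta> (D (hnth e (i # \<delta>))))))"
    by (simp add: fun_eq_iff hsum_finite_expansion[of "Abs_hsum _", simplified])
  moreover have "bounded_clinear (\<lambda>e. Ds (\<Sum>i\<in>UNIV. hsingle i (\<Sum>\<delta>\<in>words j. op_power A \<delta> (D (hnth e (i # \<delta>))))))"
    by (intro bounded_clinear_compose[OF bounded_clinear_defect_star] bounded_clinear_sum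
        bounded_clinear_compose[OF bounded_clinear_hsingle]
        bounded_clinear_compose[OF bounded_clinear_op_power[OF bounded_clinear_eval]]
        bounded_clinear_compose[OF bounded_clinear_defect] bounded_clinear_hnth)
  ultimately show ?thesis using Suc by simp
qed

text \<open>A constant input enters the recursion at the first letter only; every further letter
  just applies the adjoint of its operator.\<close>

lemma state_single: "state 1 (\<lambda>\<alpha>. if \<alpha> = [] then v else 0) (i # \<delta>) = cadj (op_power A \<delta>) (hnth (Ds v) i)"
proof (induction \<delta> rule: rev_induct)
  case Nil
  show ?case using state_simps(2)[of 1 "\<lambda>\<alpha>. if \<alpha> = [] then v else 0" "[]" i]
    by (simp add: cadj_op_power_Nil cadj_eval_simps)
next
  case (snoc j \<delta>)
  show ?case using state_simps(2)[of 1 "\<lambda>\<alpha>. if \<alpha> = [] then v else 0" "i # \<delta>" j] snoc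
    by (simp add: cadj_op_power_snoc defect_star_simps)
qed

text \<open>Degree 0 sees only the term - f(T) v, the state at the empty word being 0; higher
  degrees see only the state, because the input vanishes there.\<close>

lemma char_fun_bottom:
  assumes e: "Q_eq k e = e"
  shows "cinner (char_fun f T (hsingle [] v)) e = cinner v (bottom k e)"
proof (cases k)
  case 0
  show ?thesis unfolding homogeneous_cinner[OF e] char_fun_eq
    by (simp add: 0 hnth_Theta defect_simps cadj[OF bounded_clinear_row])
next
  case (Suc j)
  have "hnth (hsingle [] v :: ('n list, ('n, 'h) hsum) hsum) = (\<lambda>\<alpha>. if \<alpha> = [] then v else 0)" by (rule ext) simp
  hence st: "state 1 (hnth (hsingle [] v)) (i # \<delta>) = cadj (op_power A \<delta>) (hnth (Ds v) i)" for i \<delta>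
    by (simp only: state_single)
  have "cinner (char_fun f T (hsingle [] v)) e =
      (\<Sum>i\<in>UNIV. \<Sum>\<delta>\<in>words j. cinner (D (cadj (op_power A \<delta>) (hnth (Ds v) i))) (hnth e (i # \<delta>)))"
    unfolding homogeneous_cinner[OF e] char_fun_eq Suc sum_words_Suc
    by (simp add: hnth_Theta row_simps st)
  also have "\<dots> = cinner (Ds v) (Abs_hsum (\<lambda>i. \<Sum>\<delta>\<in>words j. op_power A \<delta> (D (hnth e (i # \<delta>)))))"
    unfolding hsum_cinner_finite
    by (simp add: defect_selfadj cadj'[OF bounded_clinear_op_power[OF bounded_clinear_eval]] cinner_sum_right)
  finally show ?thesis by (simp add: Suc defect_star_selfadj)
qed

end

context finite_defect_tuple
begin

text \<open>In degree 0 the coordinate of e is exactly \<Delta> h for some h, because the range is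
  closed, and then \<open>cadj_row_defect\<close> places its image in the range of the other defect
  operator.\<close>

lemma bottom_mem:
  assumes "e \<in> H2_tensor (defect_space f T)" shows "bottom k e \<in> defect_star_space f T"
proof (cases k)
  case 0
  have "hnth e [] \<in> range D" using assms unfolding H2_tensor_def defect_space_eq by blast
  then obtain h where "hnth e [] = D h" by blast
  hence "bottom 0 e = Ds (- cadj Ar h)" by (simp add: cadj_row_defect defect_star_simps)
  thus ?thesis using 0 defect_mem(2) by metis
next
  case (Suc j)
  thus ?thesis by (simp add: defect_mem)
qed

text \<open>The adjoint is known only through pairings with vectors over
  \<open>defect_star_space\<close>. Both sides lie in that space, so their difference may be tested
  against itself.\<close>

lemma char_fun_adj_bottom:
  assumes e: "Q_eq k e = e" "e \<in> H2_tensor (defect_space f T)"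
  shows "hnth (char_fun_adj f T e) [] = bottom k e"
proof -
  let ?u = "hnth (char_fun_adj f T e) [] - bottom k e"
  have u: "?u \<in> defect_star_space f T"
    using char_fun_adj_mem[OF e(2)] bottom_mem[OF e(2)]
    by (intro complex_vector.subspace_diff closed_defect_spaces) (auto simp: H2_tensor_def)
  have single: "hsingle [] v \<in> H2_tensor (defect_star_space f T)" if "v \<in> defect_star_space f T" for v
    using that complex_vector.subspace_0[OF closed_defect_spaces(4)] by (simp add: H2_tensor_def)
  have "cinner v (hnth (char_fun_adj f T e) []) = cinner v (bottom k e)" if "v \<in> defect_star_space f T" for v
    using char_fun_adj[OF e(2) single[OF that]] char_fun_bottom[OF e(1), of v]
    by (simp add: cinner_hsingle_left)
  from this[OF u] have "cinner ?u ?u = 0" by (simp add: cinner_diff_right)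
  thus ?thesis by (simp add: cinner_self)
qed

text \<open>A homogeneous e is an eigenvector of \<open>weight_N\<close> with eigenvalue n^(-k), and
  moving \<Theta> to the other side pairs the degree zero coefficient with itself. Hence the
  diagonal entries are nonnegative.\<close>

lemma char_fun_diagonal:
  assumes e: "Q_eq k e = e" "e \<in> H2_tensor (defect_space f T)"
  shows "cinner (char_fun f T (Q_eq 0 (char_fun_adj f T (weight_N e)))) e =
    of_real ((norm (bottom k e))\<^sup>2 / real CARD('a) ^ k)"
proof -
  define c where "c = 1 / real CARD('a) ^ k"
  have we: "weight_N e = c *\<^sub>R e" using weight_N_homogeneous[OF e(1)] by (simp add: c_def)
  have hom: "Q_eq k (c *\<^sub>R e) = c *\<^sub>R e"
    using arg_cong[OF e(1), of hnth] by (intro hsum_eqI) (auto simp: fun_eq_iff split: if_splits)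
  have mem: "c *\<^sub>R e \<in> H2_tensor (defect_space f T)"
    by (rule subspace_mul[OF csubspace_imp_subspace[OF H2_tensor_subspace[OF closed_defect_spaces(2)]] e(2)])
  have "cinner (char_fun f T (Q_eq 0 (char_fun_adj f T (weight_N e)))) e = cinner (bottom k (c *\<^sub>R e)) (bottom k e)"
    unfolding Q_eq_0 we char_fun_adj_bottom[OF hom mem] by (rule char_fun_bottom[OF e(1)])
  thus ?thesis
    by (simp add: bounded_clinear_simps(5)[OF bounded_clinear_bottom] cinner_scaleR_left cinner_self c_def)
qed

section \<open>Homogeneous components and the graded trace\<close>

definition homogeneous :: "nat \<Rightarrow> ('a list, 'b) hsum set" where
  "homogeneous k = {x \<in> H2_tensor (defect_space f T). Q_eq k x = x}"

lemma homogeneous_subspace: "csubspace (homogeneous k)"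
proof -
  have "csubspace {x :: ('a list, 'b) hsum. Q_eq k x = x}"
  proof -
    show ?thesis unfolding Q_eq_fixed_iff by (simp add: complex_vector.subspace_def)
  qed
  moreover have "homogeneous k = H2_tensor (defect_space f T) \<inter> {x. Q_eq k x = x}"
    by (auto simp: homogeneous_def)
  ultimately show ?thesis
    by (simp add: complex_vector.subspace_inter H2_tensor_subspace closed_defect_spaces)
qed

definition word_basis :: "nat \<Rightarrow> ('a list, 'b) hsum set" where
  "word_basis k = (\<lambda>(\<alpha>, d). hsingle \<alpha> d) ` (words k \<times> C)"

lemma C_props: "d \<in> C \<Longrightarrow> norm d = 1" "d \<in> C \<Longrightarrow> d \<in> defect_space f T"
  using onb_norm[OF onb] is_onbD(1)[OF onb] by (auto simp: defect_space_eq)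

lemma inj_word_basis: "inj_on (\<lambda>(\<alpha>, d). hsingle \<alpha> d) (words k \<times> C)"
proof (rule inj_onI, clarify)
  fix \<alpha> \<alpha>' d d' assume *: "d \<in> C" "d' \<in> C" "hsingle \<alpha> d = hsingle \<alpha>' d'"
  have d0: "d \<noteq> 0" using C_props(1)[OF *(1)] by auto
  have "hnth (hsingle \<alpha> d) \<alpha> = hnth (hsingle \<alpha>' d') \<alpha>" using *(3) by simp
  thus "\<alpha> = \<alpha>' \<and> d = d'" using d0 by (simp split: if_splits)
qed

lemma word_basis_onb: "is_onb (homogeneous k) (word_basis k)" "finite (word_basis k)"
proof -
  show "finite (word_basis k)" unfolding word_basis_def using fin by simp
  show "is_onb (homogeneous k) (word_basis k)"
    unfolding is_onb_def
  proof (intro conjI ballI impI subsetI)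
    fix x assume "x \<in> word_basis k"
    then obtain \<alpha> d where x: "x = hsingle \<alpha> d" "\<alpha> \<in> words k" "d \<in> C" by (auto simp: word_basis_def)
    show "x \<in> homogeneous k"
      using x C_props(2)[OF x(3)] complex_vector.subspace_0[OF closed_defect_spaces(2)]
      by (auto simp: homogeneous_def H2_tensor_def words_def intro!: hsum_eqI)
    fix y assume "y \<in> word_basis k"
    then obtain \<beta> c where y: "y = hsingle \<beta> c" "\<beta> \<in> words k" "c \<in> C" by (auto simp: word_basis_def)
    have d0: "d \<noteq> 0" using C_props(1)[OF x(3)] by auto
    have "x = y \<longleftrightarrow> \<alpha> = \<beta> \<and> d = c"
      using inj_onD[OF inj_word_basis[of k], of "(\<alpha>, d)" "(\<beta>, c)"] x y by auto
    thus "cinner x y = (if x = y then 1 else 0)"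
      using is_onbD(2)[OF onb x(3) y(3)] unfolding x(1) y(1) by (auto simp: cinner_hsingle_left)
  next
    fix x assume x: "x \<in> homogeneous k" "\<forall>e\<in>word_basis k. cinner x e = 0"
    show "x = 0"
    proof (rule hsum_eqI)
      fix \<alpha>
      show "hnth x \<alpha> = hnth 0 \<alpha>"
      proof (cases "\<alpha> \<in> words k")
        case True
        have "hnth x \<alpha> = 0"
        proof (rule is_onbD(3)[OF onb])
          show "hnth x \<alpha> \<in> range D" using x(1) unfolding homogeneous_def H2_tensor_def defect_space_eq by blast
          fix d assume "d \<in> C"
          hence "hsingle \<alpha> d \<in> word_basis k" using True by (auto simp: word_basis_def)
          with x(2) show "cinner (hnth x \<alpha>) d = 0" by (metis cinner_hsingle_right)
        qed
        thus ?thesis by simp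
      next
        case False
        have "Q_eq k x = x" using x(1) by (simp add: homogeneous_def)
        from arg_cong[OF this, of "\<lambda>x. hnth x \<alpha>"] False show ?thesis by (simp add: words_def split: if_splits)
      qed
    qed
  qed
qed

lemma sum_word_basis: "(\<Sum>e\<in>word_basis k. F e) = (\<Sum>\<alpha>\<in>words k. \<Sum>d\<in>C. F (hsingle \<alpha> d))"
  unfolding word_basis_def sum.reindex[OF inj_word_basis] by (simp add: sum.cartesian_product case_prod_unfold)

lemma bottom_trace_0: "(\<Sum>e\<in>word_basis 0. (norm (bottom 0 e))\<^sup>2) = real (card C) - defect_trace 0"
proof -
  have "(norm (bottom 0 (hsingle [] d)))\<^sup>2 = 1 - (norm (D d))\<^sup>2" if "d \<in> C" for d
    using norm_defect[of d] C_props(1)[OF that] by simp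
  thus ?thesis by (simp add: sum_word_basis defect_trace_def sum_subtractf)
qed

text \<open>At the basis vector of i \<delta> and d, the defect operator acts on the tuple with the
  single entry u = A_\<delta> \<Delta> d at i, giving the squared norm |u|^2 - |A_i u|^2. Summing
  over i repeats the first term n times and lengthens the word in the second.\<close>

lemma bottom_trace_Suc:
  "(\<Sum>e\<in>word_basis (Suc k). (norm (bottom (Suc k) e))\<^sup>2) =
    real CARD('a) * defect_trace k - defect_trace (Suc k)"
proof -
  have eq: "(norm (bottom (Suc k) (hsingle (i # \<delta>) d)))\<^sup>2 =
      (norm (op_power A \<delta> (D d)))\<^sup>2 - (norm (A i (op_power A \<delta> (D d))))\<^sup>2" if "\<delta> \<in> words k" for i \<delta> d
  proof -
    have "(\<Sum>\<gamma>\<in>words k. op_power A \<gamma> (D (hnth (hsingle (i # \<delta>) d) (j # \<gamma>)))) =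
        (\<Sum>\<gamma>\<in>words k. if \<gamma> = \<delta> then (if j = i then op_power A \<delta> (D d) else 0) else 0)" for j
      by (intro sum.cong)
        (auto simp: defect_simps bounded_clinear_simps[OF bounded_clinear_op_power[OF bounded_clinear_eval]])
    hence "bottom (Suc k) (hsingle (i # \<delta>) d) = Ds (hsingle i (op_power A \<delta> (D d)))"
      using that by (auto simp: hsingle_def intro!: arg_cong[of _ _ Ds] arg_cong[of _ _ Abs_hsum])
    thus ?thesis by (simp only: norm_defect_star row_hsingle norm_hsingle)
  qed
  have "(\<Sum>e\<in>word_basis (Suc k). (norm (bottom (Suc k) e))\<^sup>2) =
      (\<Sum>i\<in>(UNIV :: 'a set). \<Sum>\<delta>\<in>words k. \<Sum>d\<in>C.
        (norm (op_power A \<delta> (D d)))\<^sup>2 - (norm (A i (op_power A \<delta> (D d))))\<^sup>2)"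
    unfolding sum_word_basis sum_words_Suc by (intro sum.cong refl eq)
  also have "\<dots> = real CARD('a) * defect_trace k - defect_trace (Suc k)"
    unfolding defect_trace_Suc by (simp add: sum_subtractf defect_trace_def)
  finally show ?thesis .
qed

text \<open>A homogeneous basis splits by degree into finite bases of the components, where the sum
  may be computed on the word basis. All entries are nonnegative, so the convergent series over the
  degrees gives unconditional summability over \<open>E\<close>.\<close>

lemma char_fun_graded_trace:
  assumes L: "(\<lambda>k. (real CARD('a) * defect_trace k - defect_trace (Suc k)) / real CARD('a) ^ Suc k) sums (defect_trace 0 - L)"
  shows "has_graded_trace (defect_space f T)
    (\<lambda>x. char_fun f T (Q_eq 0 (char_fun_adj f T (weight_N x)))) (of_real (real (card C) - L))"
  unfolding has_graded_trace_def
proof (intro allI impI, elim conjE)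
  fix E assume E: "is_onb (H2_tensor (defect_space f T)) E" "\<forall>e\<in>E. \<exists>k. Q_eq k e = (e :: ('a list, 'b) hsum)"
  define Ek where "Ek k = {e\<in>E. Q_eq k e = e}" for k
  have Ek: "is_onb (homogeneous k) (Ek k)" for k
    unfolding is_onb_def
  proof (intro conjI ballI impI)
    show "Ek k \<subseteq> homogeneous k" using is_onbD(1)[OF E(1)] by (auto simp: Ek_def homogeneous_def)
    show "cinner e e' = (if e = e' then 1 else 0)" if "e \<in> Ek k" "e' \<in> Ek k" for e e'
      by (rule is_onbD(2)[OF E(1)]) (use that in \<open>auto simp: Ek_def\<close>)
    fix x assume x: "x \<in> homogeneous k" "\<forall>e\<in>Ek k. cinner x e = 0"
    show "x = 0"
    \<comment> \<open>Basis vectors of other degrees are orthogonal to x automatically, so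
      maximality of \<open>E\<close> restricts to each degree.\<close>
    proof (rule is_onbD(3)[OF E(1)])
      show "x \<in> H2_tensor (defect_space f T)" using x(1) by (simp add: homogeneous_def)
      fix e assume e: "e \<in> E"
      then obtain j where j: "Q_eq j e = e" using E(2) by blast
      show "cinner x e = 0"
      proof (cases "j = k")
        case True
        thus ?thesis using x(2) e j by (simp add: Ek_def)
      next
        case False
        have "Q_eq k x = x" using x(1) by (simp add: homogeneous_def)
        from homogeneous_orthogonal[OF j this] False show ?thesis by simp
      qed
    qed
  qed
  have Ek_fin: "finite (Ek k)" for k
  proof (rule finite_dim_onb(1)[OF Ek homogeneous_subspace word_basis_onb(2)[of k]])
    show "homogeneous k \<subseteq> cspan (word_basis k)"
    proof
      fix x assume "x \<in> homogeneous k"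
      from onb_finite_expansion[OF word_basis_onb homogeneous_subspace this, symmetric]
      show "x \<in> cspan (word_basis k)"
        by (metis (mono_tags, lifting) complex_vector.span_base complex_vector.span_scale complex_vector.span_sum)
    qed
  qed
  define N where "N = real CARD('a)"
  define a where "a = (\<lambda>(k, e). (norm (bottom k e))\<^sup>2 / N ^ k)"
  define c where "c k = (\<Sum>e\<in>word_basis k. (norm (bottom k e))\<^sup>2) / N ^ k" for k
  have N: "N \<ge> 1" unfolding N_def using card_gt_0_iff[of "UNIV :: 'a set"] by simp
  have inner: "((\<lambda>e. a (k, e)) has_sum c k) (Ek k)" for k
  proof -
    have "c k = (\<Sum>e\<in>Ek k. a (k, e))"
      unfolding c_def a_def prod.case sum_divide_distrib[symmetric]
      using hilbert_schmidt_basis_independent[OF Ek Ek_fin word_basis_onb homogeneous_subspace bounded_clinear_bottom]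
      by simp
    thus ?thesis using Ek_fin by (simp add: has_sum_finite)
  qed
  have c_nonneg: "0 \<le> c k" for k unfolding c_def using N by (intro divide_nonneg_nonneg sum_nonneg) auto
  have "(\<lambda>k. c (Suc k)) sums (defect_trace 0 - L)"
    using L unfolding c_def bottom_trace_Suc N_def .
  \<comment> \<open>The series in \<open>L\<close> starts in degree 1; adding the degree 0 term
    cancels \<open>defect_trace 0\<close> and brings in the rank.\<close>
  hence "c sums (defect_trace 0 - L + c 0)" by (simp only: sums_Suc_iff)
  moreover have "defect_trace 0 - L + c 0 = real (card C) - L" unfolding c_def bottom_trace_0 by simp
  ultimately have c_sums: "c sums (real (card C) - L)" by simp
  have outer: "(c has_sum (real (card C) - L)) UNIV"
    by (rule norm_summable_imp_has_sum[OF _ c_sums]) (use c_sums c_nonneg in \<open>simp add: sums_iff\<close>)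
  have "a summable_on (SIGMA k:UNIV. Ek k)"
    by (rule summable_on_SigmaI[OF inner has_sum_imp_summable[OF outer]]) (use N in \<open>auto simp: a_def\<close>)
  hence Sigma: "(a has_sum (real (card C) - L)) (SIGMA k:UNIV. Ek k)"
    by (rule has_sum_SigmaI[OF inner outer])
  \<comment> \<open>Basis vectors are nonzero, so their degree is unique and \<open>E\<close>
    corresponds to the disjoint union of the \<open>Ek k\<close>.\<close>
  define deg where "deg e = (SOME k. Q_eq k e = e)" for e :: "('a list, 'b) hsum"
  have deg: "Q_eq (deg e) e = e" if "e \<in> E" for e
    unfolding deg_def by (rule someI_ex) (use E(2) that in blast)
  have deg_eq: "deg e = k" if "e \<in> Ek k" for e k
  proof -
    have "e \<noteq> 0" using that onb_norm[OF E(1), of e] by (auto simp: Ek_def)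
    thus ?thesis using that deg[of e] homogeneous_degree_unique[of k e "deg e"] by (simp add: Ek_def)
  qed
  have "((\<lambda>e. a (deg e, e)) has_sum (real (card C) - L)) E \<longleftrightarrow>
      (a has_sum (real (card C) - L)) (SIGMA k:UNIV. Ek k)"
    by (rule has_sum_reindex_bij_witness[where i = snd and j = "\<lambda>e. (deg e, e)"])
      (use deg deg_eq in \<open>auto simp: Ek_def\<close>)
  with Sigma have "((\<lambda>e. a (deg e, e)) has_sum (real (card C) - L)) E" by simp
  hence "((\<lambda>e. complex_of_real (a (deg e, e))) has_sum of_real (real (card C) - L)) E"
    by (rule has_sum_of_real)
  moreover have "cinner (char_fun f T (Q_eq 0 (char_fun_adj f T (weight_N e)))) e = of_real (a (deg e, e))"
    if "e \<in> E" for e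
    using char_fun_diagonal[OF deg[OF that]] is_onbD(1)[OF E(1)] that by (auto simp: a_def N_def)
  ultimately show "has_diagonal_sum (\<lambda>x. char_fun f T (Q_eq 0 (char_fun_adj f T (weight_N x)))) E
      (of_real (real (card C) - L))"
    unfolding has_diagonal_sum_def by (simp cong: has_sum_cong)
qed

end

section \<open>Left creation operators\<close>

text \<open>In coordinates for the basis f_\<alpha> this is left multiplication by f_j.\<close>

definition creation :: "'n \<Rightarrow> ('n list, 'k) hsum \<Rightarrow> ('n list, 'k :: chilbert_space) hsum" where
  "creation j x = Abs_hsum (\<lambda>\<beta>. if \<beta> \<noteq> [] \<and> hd \<beta> = j then hnth x (tl \<beta>) else 0)"

lemma hnth_creation: "hnth (creation j x) \<beta> = (if \<beta> \<noteq> [] \<and> hd \<beta> = j then hnth x (tl \<beta>) else 0)"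
  and norm_creation: "norm (creation j x) = norm x"
proof -
  let ?y = "\<lambda>\<beta>. if \<beta> \<noteq> [] \<and> hd \<beta> = j then hnth x (tl \<beta>) else 0"
  have "((\<lambda>\<beta>. (norm (hnth x \<beta>))\<^sup>2) has_sum (norm x)\<^sup>2) UNIV"
    unfolding hnorm_sq using hnth_l2[of x] unfolding l2_summable_def by (rule has_sum_infsum)
  hence "((\<lambda>\<beta>. (norm (?y \<beta>))\<^sup>2) has_sum (norm x)\<^sup>2) (range ((#) j))"
    by (subst has_sum_reindex) (auto simp: o_def)
  hence y: "((\<lambda>\<beta>. (norm (?y \<beta>))\<^sup>2) has_sum (norm x)\<^sup>2) UNIV"
  proof (rule has_sum_cong_neutral[THEN iffD1, rotated -1])
    fix \<beta> assume "\<beta> \<in> UNIV - range ((#) j)"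
    thus "(norm (?y \<beta>))\<^sup>2 = 0" by (cases \<beta>) auto
  qed auto
  hence l2: "l2_summable ?y" unfolding l2_summable_def by (rule has_sum_imp_summable)
  thus nth: "hnth (creation j x) \<beta> = ?y \<beta>" for \<beta> by (simp add: creation_def)
  have "(norm (creation j x))\<^sup>2 = (norm x)\<^sup>2"
    unfolding hnorm_sq[of "creation j x"] nth by (rule infsumI[OF y])
  thus "norm (creation j x) = norm x" by simp
qed

lemma hnth_creation_simps [simp]:
  "hnth (creation j x) [] = 0" "hnth (creation j x) (i # \<beta>) = (if i = j then hnth x \<beta> else 0)"
  by (simp_all add: hnth_creation)

lemma hsum_words_eqI:
  assumes "hnth x [] = hnth y []" "\<And>i \<beta>. hnth x (i # \<beta>) = hnth y (i # \<beta>)" shows "x = y"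
proof (rule hsum_eqI)
  show "hnth x \<beta> = hnth y \<beta>" for \<beta> using assms by (cases \<beta>) auto
qed

lemma bounded_clinear_creation: "bounded_clinear (creation j)"
  by (rule bounded_clinearI[where K = 1]) (auto intro: hsum_words_eqI simp: norm_creation)

lemma creation_hsingle: "creation j (hsingle \<alpha> v) = hsingle (j # \<alpha>) v"
  by (rule hsum_words_eqI) auto

lemma op_power_creation: "op_power creation \<alpha> (hsingle [] v) = hsingle \<alpha> v"
  by (induction \<alpha>) (auto simp: creation_hsingle)

text \<open>The creation operators are isometries, which preserve inner products by polarisation,
  with mutually orthogonal ranges.\<close>

lemma norm_row_creation: "norm (row_op creation x) = norm (x :: ('n :: finite, ('n list, 'k :: chilbert_space) hsum) hsum)"
proof -
  have "cinner (creation i u) (creation j v) = (if i = j then cinner u v else 0)" for i j and u v :: "('n list, 'k) hsum"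
  proof (cases "i = j")
    case True
    have "inner (creation i u) (creation i v) = inner u v" for u v :: "('n list, 'k) hsum"
    proof -
      have "(norm (creation i (u + v)))\<^sup>2 = (norm (u + v))\<^sup>2" by (simp add: norm_creation)
      thus ?thesis
        unfolding bounded_clinear_simps(1)[OF bounded_clinear_creation] power2_norm_eq_inner
        using norm_creation[of i u] norm_creation[of i v]
        by (simp add: inner_simps inner_commute norm_eq_sqrt_inner)
    qed
    from this[of u v] this[of "\<i> *\<^sub>C u" v] show ?thesis
      using True by (auto intro!: cinner_eq_iff_inner simp: bounded_clinear_simps[OF bounded_clinear_creation])
  next
    case False
    hence "cinner (hnth (creation i u) \<beta>) (hnth (creation j v) \<beta>) = 0" for \<beta> by (cases \<beta>) auto
    thus ?thesis using False by (simp add: cinner_hsum_def)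
  qed
  hence "cinner (row_op creation x) (row_op creation x) = cinner x x"
    unfolding row_op_def cinner_sum_left cinner_sum_right hsum_cinner_finite by simp
  hence "complex_of_real ((norm (row_op creation x))\<^sup>2) = of_real ((norm x)\<^sup>2)" by (simp only: cinner_self)
  thus ?thesis unfolding of_real_eq_iff by simp
qed

text \<open>The identity minus the sum of S_j S_j^* is the projection onto the constants. A
  projection is its own positive square root, so by uniqueness it is the defect operator; each of
  the n^k words of length k then contributes a unit vector.\<close>

lemma creation_model_trace:
  fixes M :: "'n :: finite \<Rightarrow> 'n H2 \<Rightarrow> 'n H2"
  assumes eval: "tuple_eval f M = creation"
  shows "poisson_trace f M m = of_real (\<Sum>k\<le>m. real CARD('n) ^ k)"
proof -
  have "onorm (row_op (creation :: 'n \<Rightarrow> 'n H2 \<Rightarrow> 'n H2)) \<le> 1"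
    by (rule onorm_bound) (simp_all add: norm_row_creation)
  then interpret contractive_tuple f M
    by unfold_locales (simp_all add: eval bounded_clinear_creation)
  have "positive_op (Q_eq 0 :: 'n H2 \<Rightarrow> _)"
    unfolding positive_op_def Q_eq_0
    by (auto intro: bounded_clinear_compose[OF bounded_clinear_hsingle bounded_clinear_hnth]
        simp: cinner_hsingle_left cinner_hsingle_right Re_cinner_self)
  moreover have "Q_eq 0 \<circ> Q_eq 0 = (\<lambda>x. x - row_op (tuple_eval f M) (cadj (row_op (tuple_eval f M)) x))"
  proof (rule ext, rule hsum_words_eqI)
    fix x :: "'n H2" and i \<beta>
    have cr: "hnth (cadj (creation i) x) \<beta> = hnth x (i # \<beta>)" for i \<beta>
    proof -
      have "cinner (hsingle \<beta> 1) (cadj (creation i) x) = cinner (hsingle (i # \<beta>) 1) x"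
        by (simp flip: creation_hsingle cadj[OF bounded_clinear_creation])
      hence "cnj (hnth (cadj (creation i) x) \<beta>) = cnj (hnth x (i # \<beta>))"
        by (simp add: cinner_hsingle_left cinner_complex_def)
      thus ?thesis by simp
    qed
    have row: "row_op (tuple_eval f M) (cadj (row_op (tuple_eval f M)) x) = (\<Sum>j\<in>UNIV. creation j (cadj (creation j) x))"
      unfolding row_op_def[of _ "cadj _ _"] hnth_cadj_row by (simp add: eval)
    show "hnth ((Q_eq 0 \<circ> Q_eq 0) x) [] = hnth (x - row_op (tuple_eval f M) (cadj (row_op (tuple_eval f M)) x)) []"
      unfolding row by simp
    show "hnth ((Q_eq 0 \<circ> Q_eq 0) x) (i # \<beta>) = hnth (x - row_op (tuple_eval f M) (cadj (row_op (tuple_eval f M)) x)) (i # \<beta>)"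
      unfolding row by (simp add: cr)
  qed
  ultimately have D: "defect f M = Q_eq 0"
    unfolding defect_eq by (rule R.sqrt_series_unique[symmetric])
  have D1: "Q_eq 0 (hsingle [] 1 :: 'n H2) = hsingle [] 1" by (rule hsum_eqI) auto
  have "is_onb (range (defect f M)) {hsingle [] 1}"
    unfolding is_onb_def D
  proof (intro conjI ballI impI)
    show "{hsingle [] 1} \<subseteq> range (Q_eq 0 :: 'n H2 \<Rightarrow> _)" using D1 by (metis empty_subsetI insert_subset rangeI)
    show "x = 0" if x: "x \<in> range (Q_eq 0)" "\<forall>e\<in>{hsingle [] 1}. cinner x e = 0" for x :: "'n H2"
    proof -
      have "hnth x [] = 0" using x(2) by (simp add: cinner_hsingle_right cinner_complex_def)
      with x(1) show ?thesis by (auto intro: hsum_eqI)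
    qed
  qed (auto simp: cinner_self)
  then interpret finite_defect_tuple f M "{hsingle [] 1}"
    by unfold_locales auto
  have "real (card (words k :: 'n list set)) = real CARD('n) ^ k" for k
    using card_lists_length_eq[of "UNIV :: 'n set" k] by (simp add: words_def)
  hence "defect_trace k = real CARD('n) ^ k" for k
    unfolding defect_trace_def by (simp add: D D1 eval op_power_creation)
  thus ?thesis unfolding poisson_trace_eq by simp
qed

section \<open>Noncommutative power series\<close>

lemma nc_mult_Nil [simp]: "nc_mult \<phi> \<psi> [] = \<phi> [] * \<psi> []"
  by (simp add: nc_mult_def)

text \<open>A factorisation of a nonempty word leaves everything to the right factor or gives its
  first letter to the left one. This turns product identities into inductions over the word.\<close>

lemma nc_mult_Cons: "nc_mult \<phi> \<psi> (b # \<beta>) = \<phi> [] * \<psi> (b # \<beta>) + nc_mult (\<lambda>\<gamma>. \<phi> (b # \<gamma>)) \<psi> \<beta>"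
  unfolding nc_mult_def length_Cons sum.atMost_Suc_shift by simp

lemma nc_mult_var: "nc_mult (nc_var i) \<psi> \<beta> = (if \<beta> \<noteq> [] \<and> hd \<beta> = i then \<psi> (tl \<beta>) else 0)"
proof (cases \<beta>)
  case (Cons b \<beta>')
  have 0: "nc_mult (\<lambda>\<gamma>. c * nc_one \<gamma>) \<psi> \<beta>' = c * \<psi> \<beta>'" for c
    by (cases \<beta>') (simp_all add: nc_mult_Cons nc_one_def, simp add: nc_mult_def)
  have "(\<lambda>\<gamma>. nc_var i (b # \<gamma>)) = (\<lambda>\<gamma>. (if b = i then 1 else 0) * nc_one \<gamma>)"
    by (auto simp: nc_var_def nc_one_def)
  thus ?thesis using Cons 0 by (simp add: nc_mult_Cons nc_var_def)
qed (simp add: nc_var_def)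

lemma nc_mult_one_left: "nc_mult nc_one \<psi> = \<psi>"
proof
  show "nc_mult nc_one \<psi> \<beta> = \<psi> \<beta>" for \<beta>
    by (cases \<beta>) (simp_all add: nc_mult_Cons nc_one_def, simp add: nc_mult_def)
qed

lemma nc_mult_linear_left:
  "nc_mult (\<lambda>\<gamma>. \<phi> \<gamma> + \<phi>' \<gamma>) \<psi> \<beta> = nc_mult \<phi> \<psi> \<beta> + nc_mult \<phi>' \<psi> \<beta>"
  "nc_mult (\<lambda>\<gamma>. c * \<phi> \<gamma>) \<psi> \<beta> = c * nc_mult \<phi> \<psi> \<beta>"
  by (simp_all add: nc_mult_def sum.distrib sum_distrib_left algebra_simps)

lemma nc_mult_assoc: "nc_mult (nc_mult \<phi> \<psi>) \<rho> = nc_mult \<phi> (nc_mult \<psi> \<rho>)"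
proof
  show "nc_mult (nc_mult \<phi> \<psi>) \<rho> \<beta> = nc_mult \<phi> (nc_mult \<psi> \<rho>) \<beta>" for \<beta>
  proof (induction \<beta> arbitrary: \<phi>)
    case (Cons b \<beta>)
    show ?case by (simp add: nc_mult_Cons nc_mult_linear_left Cons.IH algebra_simps)
  qed simp
qed

lemma nc_power_Nil [simp]: "nc_power f [] = nc_one"
  and nc_power_Cons [simp]: "nc_power f (i # \<alpha>) = nc_mult (f i) (nc_power f \<alpha>)"
  by (simp_all add: nc_power_def)

lemma nc_power_append: "nc_power f (\<alpha> @ \<beta>) = nc_mult (nc_power f \<alpha>) (nc_power f \<beta>)"
  by (induction \<alpha>) (simp_all add: nc_mult_one_left nc_mult_assoc)

text \<open>\<open>nc_compose\<close> is an infinite sum with default value 0 in the absence of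
  convergence, so its linearity rests on summability.\<close>

definition composable :: "'n ncfps \<Rightarrow> ('n \<Rightarrow> 'n ncfps) \<Rightarrow> bool" where
  "composable a f \<longleftrightarrow> (\<forall>\<beta>. (\<lambda>\<alpha>. a \<alpha> * nc_power f \<alpha> \<beta>) summable_on UNIV)"

lemma composable_has_sum:
  "composable a f \<Longrightarrow> ((\<lambda>\<alpha>. a \<alpha> * nc_power f \<alpha> \<beta>) has_sum nc_compose a f \<beta>) UNIV"
  unfolding composable_def nc_compose_def by (blast intro: has_sum_infsum)

lemma nc_compose_eqI: "((\<lambda>\<alpha>. a \<alpha> * nc_power f \<alpha> \<beta>) has_sum s) UNIV \<Longrightarrow> nc_compose a f \<beta> = s"
  unfolding nc_compose_def by (rule infsumI)

lemma nc_compose_diff: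
  assumes "composable a f" "composable b f"
  shows "nc_compose (\<lambda>\<alpha>. a \<alpha> - b \<alpha>) f \<beta> = nc_compose a f \<beta> - nc_compose b f \<beta>"
proof (rule nc_compose_eqI)
  show "((\<lambda>\<alpha>. (a \<alpha> - b \<alpha>) * nc_power f \<alpha> \<beta>) has_sum nc_compose a f \<beta> - nc_compose b f \<beta>) UNIV"
    using has_sum_add[OF composable_has_sum[OF assms(1)] has_sum_uminusI[OF composable_has_sum[OF assms(2)]]]
    by (simp add: left_diff_distrib)
qed

text \<open>As f_(j \<alpha>) = f_j f_\<alpha>, prepending j to the coordinates multiplies the
  represented series by f_j. The polynomial and formal series cases thereby reduce to injectivity of
  composition with f.\<close>

lemma nc_compose_creation:
  assumes "composable (hnth x) f"
  shows "nc_compose (hnth (creation j x)) f = nc_mult (f j) (nc_compose (hnth x) f)"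
proof
  fix \<beta>
  have "((\<lambda>\<alpha>. \<Sum>k\<le>length \<beta>. f j (take k \<beta>) * (hnth x \<alpha> * nc_power f \<alpha> (drop k \<beta>))) has_sum
      nc_mult (f j) (nc_compose (hnth x) f) \<beta>) UNIV"
    unfolding nc_mult_def by (intro has_sum_finite_sum has_sum_cmult_right composable_has_sum assms)
  moreover have "(\<Sum>k\<le>length \<beta>. f j (take k \<beta>) * (hnth x \<alpha> * nc_power f \<alpha> (drop k \<beta>))) =
      hnth (creation j x) (j # \<alpha>) * nc_power f (j # \<alpha>) \<beta>" for \<alpha>
    by (simp add: nc_mult_def sum_distrib_left algebra_simps)
  ultimately have "((\<lambda>\<gamma>. hnth (creation j x) \<gamma> * nc_power f \<gamma> \<beta>) has_sum
      nc_mult (f j) (nc_compose (hnth x) f) \<beta>) (range ((#) j))"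
    by (subst has_sum_reindex) (auto simp: o_def)
  hence "((\<lambda>\<gamma>. hnth (creation j x) \<gamma> * nc_power f \<gamma> \<beta>) has_sum
      nc_mult (f j) (nc_compose (hnth x) f) \<beta>) UNIV"
  proof (rule has_sum_cong_neutral[THEN iffD1, rotated -1])
    fix \<gamma> assume "\<gamma> \<in> UNIV - range ((#) j)"
    thus "hnth (creation j x) \<gamma> * nc_power f \<gamma> \<beta> = 0" by (cases \<gamma>) auto
  qed auto
  thus "nc_compose (hnth (creation j x)) f \<beta> = nc_mult (f j) (nc_compose (hnth x) f) \<beta>"
    by (rule nc_compose_eqI)
qed

subsection \<open>Power series without constant term\<close>

text \<open>A product of |\<alpha>| factors without constant term starts in degree
  |\<alpha>|.\<close>

lemma nc_power_short:
  assumes "\<And>i. f i [] = 0" shows "length \<beta> < length \<alpha> \<Longrightarrow> nc_power f \<alpha> \<beta> = 0"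
proof (induction \<alpha> arbitrary: \<beta>)
  case (Cons i \<alpha>)
  have "f i (take k \<beta>) * nc_power f \<alpha> (drop k \<beta>) = 0" for k
    using assms Cons by (cases "k = 0"; cases \<beta>) auto
  thus ?case unfolding nc_power_Cons nc_mult_def by (intro sum.neutral ballI)
qed simp

text \<open>In the lowest degree each factor contributes its linear part, so the coefficients are
  those of a tensor product of rows of the Jacobian.\<close>

lemma nc_power_same_length:
  assumes f0: "\<And>i. f i [] = 0" and "length \<alpha> = length \<beta>"
  shows "nc_power f (i # \<alpha>) (b # \<beta>) = f i [b] * nc_power f \<alpha> \<beta>"
proof -
  have "nc_mult (\<lambda>\<gamma>. f i (b # \<gamma>)) (nc_power f \<alpha>) \<beta> = f i [b] * nc_power f \<alpha> \<beta>"
  proof (cases \<beta>)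
    case (Cons c \<delta>)
    have "nc_mult (\<lambda>\<gamma>. f i (b # c # \<gamma>)) (nc_power f \<alpha>) \<delta> = 0"
      unfolding nc_mult_def
      using assms(2) Cons by (intro sum.neutral) (auto intro!: nc_power_short[where f = f, OF f0])
    thus ?thesis using Cons by (simp add: nc_mult_Cons)
  qed simp
  thus ?thesis by (simp add: nc_mult_Cons f0)
qed

lemma
  fixes f :: "'n :: finite \<Rightarrow> 'n ncfps"
  assumes f0: "\<And>i. f i [] = 0"
  shows composable_series: "composable a f"
    and nc_compose_series: "nc_compose a f \<beta> = (\<Sum>\<alpha> | length \<alpha> \<le> length \<beta>. a \<alpha> * nc_power f \<alpha> \<beta>)"
proof -
  have *: "((\<lambda>\<alpha>. a \<alpha> * nc_power f \<alpha> \<beta>) has_sum (\<Sum>\<alpha> | length \<alpha> \<le> length \<beta>. a \<alpha> * nc_power f \<alpha> \<beta>)) UNIV" for \<beta>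
    by (rule has_sum_finite_neutralI[of "{\<alpha>. length \<alpha> \<le> length \<beta>}"]) (auto simp: nc_power_short[where f = f, OF f0])
  show "composable a f" unfolding composable_def by (intro allI has_sum_imp_summable[OF *])
  show "nc_compose a f \<beta> = (\<Sum>\<alpha> | length \<alpha> \<le> length \<beta>. a \<alpha> * nc_power f \<alpha> \<beta>)" by (rule nc_compose_eqI[OF *])
qed

text \<open>The coefficients of f_\<alpha> at \<beta> with both words of length k form the k-th
  tensor power of the Jacobian, invertible with it. The induction removes the first tensor
  factor.\<close>

lemma jacobian_power_injective:
  fixes f :: "'n :: finite \<Rightarrow> 'n ncfps"
  assumes f0: "\<And>i. f i [] = 0" and J: "det (jacobian0 f) \<noteq> 0"
    and "\<And>\<beta>. \<beta> \<in> words k \<Longrightarrow> (\<Sum>\<alpha>\<in>words k. c \<alpha> * nc_power f \<alpha> \<beta>) = 0" and "\<alpha> \<in> words k"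
  shows "c \<alpha> = 0"
  using assms(3,4)
proof (induction k arbitrary: c \<alpha>)
  case 0
  thus ?case by (auto simp: nc_one_def)
next
  case (Suc k)
  obtain B where B: "jacobian0 f ** B = mat 1"
    using J unfolding invertible_det_nz[symmetric] invertible_def by blast
  \<comment> \<open>For a fixed first letter b of the tested word, the equations become those of
    degree k for these contracted coefficients.\<close>
  have col: "(\<Sum>i\<in>UNIV. c (i # \<gamma>) * f i [b]) = 0" if \<gamma>: "\<gamma> \<in> words k" for b \<gamma>
  proof (rule Suc.IH[OF _ \<gamma>])
    fix \<beta> :: "'n list" assume \<beta>: "\<beta> \<in> words k"
    have "(\<Sum>\<alpha>\<in>words k. (\<Sum>i\<in>UNIV. c (i # \<alpha>) * f i [b]) * nc_power f \<alpha> \<beta>) =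
        (\<Sum>i\<in>UNIV. \<Sum>\<alpha>\<in>words k. c (i # \<alpha>) * nc_power f (i # \<alpha>) (b # \<beta>))"
      unfolding sum_distrib_right
      by (subst sum.swap, intro sum.cong refl)
        (use \<beta> in \<open>simp add: nc_power_same_length[where f = f, OF f0] words_def del: nc_power_Cons\<close>)
    also have "\<dots> = (\<Sum>\<alpha>\<in>words (Suc k). c \<alpha> * nc_power f \<alpha> (b # \<beta>))"
      by (simp only: sum_words_Suc)
    also have "\<dots> = 0" by (rule Suc.prems(1)) (use \<beta> in \<open>simp add: words_def\<close>)
    finally show "(\<Sum>\<alpha>\<in>words k. (\<Sum>i\<in>UNIV. c (i # \<alpha>) * f i [b]) * nc_power f \<alpha> \<beta>) = 0" .
  qed
  obtain j \<gamma> where \<alpha>: "\<alpha> = j # \<gamma>" "\<gamma> \<in> words k" using Suc.prems(2) by (auto simp: words_def length_Suc_conv)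
  \<comment> \<open>The right inverse \<open>B\<close> recovers the coefficient from its
    contractions with the columns of the Jacobian.\<close>
  have "c (j # \<gamma>) = (\<Sum>i\<in>UNIV. c (i # \<gamma>) * (jacobian0 f ** B) $ i $ j)"
    unfolding B by (simp add: mat_def if_distrib[of "\<lambda>t. _ * t"] cong: if_cong)
  also have "\<dots> = (\<Sum>b\<in>UNIV. (\<Sum>i\<in>UNIV. c (i # \<gamma>) * f i [b]) * B $ b $ j)"
    unfolding matrix_matrix_mult_def jacobian0_def
    by (simp add: sum_distrib_left sum_distrib_right mult.assoc) (rule sum.swap)
  also have "\<dots> = 0" by (simp add: col[OF \<alpha>(2)])
  finally show ?case by (simp add: \<alpha>)
qed

text \<open>Composition is triangular in the degree: at words of length k longer \<alpha> do not
  contribute and shorter ones vanish by induction, which leaves the invertible part of degree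
  k.\<close>

lemma nc_compose_injective_series:
  fixes f :: "'n :: finite \<Rightarrow> 'n ncfps"
  assumes f0: "\<And>i. f i [] = 0" and J: "det (jacobian0 f) \<noteq> 0"
    and zero: "\<And>\<beta>. nc_compose a f \<beta> = 0"
  shows "a \<alpha> = 0"
proof (induction "length \<alpha>" arbitrary: \<alpha> rule: less_induct)
  case less
  define k where "k = length \<alpha>"
  have low: "a \<gamma> = 0" if "length \<gamma> < k" for \<gamma> using less that by (simp add: k_def)
  have "(\<Sum>\<gamma>\<in>words k. a \<gamma> * nc_power f \<gamma> \<beta>) = 0" if "\<beta> \<in> words k" for \<beta>
  proof -
    have "(\<Sum>\<gamma>\<in>words k. a \<gamma> * nc_power f \<gamma> \<beta>) = (\<Sum>\<gamma> | length \<gamma> \<le> length \<beta>. a \<gamma> * nc_power f \<gamma> \<beta>)"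
      using that low by (intro sum.mono_neutral_left) (auto simp: words_def)
    thus ?thesis using zero[of \<beta>] nc_compose_series[where f = f, OF f0, of a \<beta>] by simp
  qed
  from jacobian_power_injective[where f = f, OF f0 J this] show ?case by (simp add: words_def k_def)
qed

lemma model_series_eval:
  assumes "model_series f g M" shows "tuple_eval f M = creation"
proof (intro ext hsum_eqI)
  fix j x \<alpha>
  have f0: "f i [] = 0" and J: "det (jacobian0 f) \<noteq> 0"
    and ev: "nc_compose (hnth (tuple_eval f M j x)) f = nc_mult (f j) (nc_compose (hnth x) f)" for i
    using assms unfolding model_series_def by auto
  have "hnth (tuple_eval f M j x) \<alpha> - hnth (creation j x) \<alpha> = 0"
  proof (rule nc_compose_injective_series[where f = f, OF f0 J])
    show "nc_compose (\<lambda>\<alpha>. hnth (tuple_eval f M j x) \<alpha> - hnth (creation j x) \<alpha>) f \<beta> = 0" for \<beta>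
      by (simp add: nc_compose_diff composable_series[where f = f, OF f0] ev nc_compose_creation)
  qed
  thus "hnth (tuple_eval f M j x) \<alpha> = hnth (creation j x) \<alpha>" by simp
qed

subsection \<open>Free holomorphic functions\<close>

text \<open>Grouping words by their first letter writes the sum as the row operator applied to sums
  of one degree less, so each degree costs one factor \<open>q\<close>.\<close>

lemma op_power_row_bound:
  fixes Y :: "'n :: finite \<Rightarrow> 'h \<Rightarrow> 'h :: chilbert_space"
  assumes Y: "\<And>i. bounded_clinear (Y i)" and q: "\<And>x. norm (row_op Y x) \<le> q * norm x" "0 \<le> q"
  shows "(norm (\<Sum>\<alpha>\<in>words k. op_power Y \<alpha> (u \<alpha>)))\<^sup>2 \<le> (q ^ k)\<^sup>2 * (\<Sum>\<alpha>\<in>words k. (norm (u \<alpha>))\<^sup>2)"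
proof (induction k arbitrary: u)
  case (Suc k)
  define v where "v i = (\<Sum>\<alpha>\<in>words k. op_power Y \<alpha> (u (i # \<alpha>)))" for i
  have "(\<Sum>\<alpha>\<in>words (Suc k). op_power Y \<alpha> (u \<alpha>)) = row_op Y (Abs_hsum v)"
    unfolding sum_words_Suc row_op_def v_def by (simp add: bounded_clinear_simps[OF Y])
  hence "(norm (\<Sum>\<alpha>\<in>words (Suc k). op_power Y \<alpha> (u \<alpha>)))\<^sup>2 \<le> (q * norm (Abs_hsum v))\<^sup>2"
    using q by (auto intro!: power_mono)
  also have "\<dots> = q\<^sup>2 * (\<Sum>i\<in>UNIV. (norm (v i))\<^sup>2)" by (simp add: power_mult_distrib hnorm_sq_finite)
  also have "\<dots> \<le> q\<^sup>2 * (\<Sum>i\<in>UNIV. (q ^ k)\<^sup>2 * (\<Sum>\<alpha>\<in>words k. (norm (u (i # \<alpha>)))\<^sup>2))"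
    unfolding v_def by (intro mult_left_mono sum_mono Suc.IH) simp
  also have "\<dots> = (q ^ Suc k)\<^sup>2 * (\<Sum>\<alpha>\<in>words (Suc k). (norm (u \<alpha>))\<^sup>2)"
    unfolding sum_words_Suc sum_distrib_left[symmetric] by (simp add: power_mult_distrib)
  finally show ?case .
qed simp

text \<open>Take \<open>u \<alpha>\<close> as the coefficient times h: the squared coefficients of
  one degree add up to at most |x|^2, so the homogeneous parts are dominated by a geometric
  series.\<close>

lemma nc_homog_summable:
  fixes Y :: "'n :: finite \<Rightarrow> 'h \<Rightarrow> 'h :: chilbert_space"
  assumes Y: "Y \<in> row_ball 1"
  shows "summable (\<lambda>k. nc_homog (hnth (x :: 'n H2)) Y k h)"
proof -
  have bY: "bounded_clinear (Y i)" and "onorm (row_op Y) < 1" for i using Y by (auto simp: row_ball_def)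
  define q where "q = onorm (row_op Y)"
  have bl: "bounded_linear (row_op Y)" by (rule bounded_clinear_linear[OF bounded_clinear_row_op[OF bY]])
  have q: "norm (row_op Y x) \<le> q * norm x" "0 \<le> q" "q < 1" for x
    using onorm[OF bl] onorm_pos_le[OF bl] \<open>onorm (row_op Y) < 1\<close> by (auto simp: q_def)
  have bound: "norm (nc_homog (hnth x) Y k h) \<le> norm x * norm h * q ^ k" for k
  proof -
    have "(norm (nc_homog (hnth x) Y k h))\<^sup>2 = (norm (\<Sum>\<alpha>\<in>words k. op_power Y \<alpha> (hnth x \<alpha> *\<^sub>C h)))\<^sup>2"
      by (simp add: nc_homog_def bounded_clinear_simps[OF bounded_clinear_op_power[OF bY]])
    also have "\<dots> \<le> (q ^ k)\<^sup>2 * (\<Sum>\<alpha>\<in>words k. (norm (hnth x \<alpha> *\<^sub>C h))\<^sup>2)"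
      by (rule op_power_row_bound[OF bY q(1,2)])
    also have "\<dots> = (q ^ k)\<^sup>2 * ((\<Sum>\<alpha>\<in>words k. (norm (hnth x \<alpha>))\<^sup>2) * (norm h)\<^sup>2)"
      by (simp add: norm_scaleC power_mult_distrib sum_distrib_right)
    also have "\<dots> \<le> (q ^ k)\<^sup>2 * ((norm x)\<^sup>2 * (norm h)\<^sup>2)"
      by (intro mult_left_mono mult_right_mono hnorm_finite_le) auto
    also have "\<dots> = (norm x * norm h * q ^ k)\<^sup>2" by (simp add: power_mult_distrib)
    finally show ?thesis by (rule power2_le_imp_le) (use q(2) in simp)
  qed
  have "summable (\<lambda>k. norm x * norm h * q ^ k)"
    by (intro summable_mult summable_geometric) (use q(2,3) in simp)
  thus ?thesis by (rule summable_comparison_test'[where N = 0]) (rule bound)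
qed

lemma nc_eval_diff:
  assumes Y: "Y \<in> row_ball 1"
  shows "nc_eval (hnth (x - y)) Y h = nc_eval (hnth (x :: 'n :: finite H2)) Y h - nc_eval (hnth y) Y h"
proof -
  have "nc_homog (hnth (x - y)) Y k h = nc_homog (hnth x) Y k h - nc_homog (hnth y) Y k h" for k
    by (simp add: nc_homog_def complex_vector.scale_left_diff_distrib sum_subtractf)
  thus ?thesis unfolding nc_eval_def by (simp add: suminf_diff nc_homog_summable[OF Y])
qed

lemma nc_eval_creation:
  fixes Y :: "'n :: finite \<Rightarrow> 'h \<Rightarrow> 'h :: chilbert_space"
  assumes Y: "Y \<in> row_ball 1"
  shows "nc_eval (hnth (creation j x)) Y h = Y j (nc_eval (hnth (x :: 'n H2)) Y h)"
proof -
  have bY: "bounded_clinear (Y i)" for i using Y by (simp add: row_ball_def)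
  have S: "nc_homog (hnth (creation j x)) Y (Suc k) h = Y j (nc_homog (hnth x) Y k h)" for k
  proof -
    have "nc_homog (hnth (creation j x)) Y (Suc k) h =
        (\<Sum>i\<in>UNIV. if i = j then Y j (nc_homog (hnth x) Y k h) else 0)"
      unfolding nc_homog_def sum_words_Suc
      by (intro sum.cong) (auto simp: bounded_clinear_simps[OF bY] intro!: sum.cong)
    thus ?thesis by simp
  qed
  have "nc_homog (hnth (creation j x)) Y 0 h = 0" by (simp add: nc_homog_def)
  hence "nc_eval (hnth (creation j x)) Y h = (\<Sum>k. nc_homog (hnth (creation j x)) Y (Suc k) h)"
    unfolding nc_eval_def using suminf_split_head[OF nc_homog_summable[OF Y, of "creation j x" h]] by simp
  also have "\<dots> = Y j (nc_eval (hnth x) Y h)"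
    unfolding S nc_eval_def
    by (rule bounded_linear.suminf[OF bounded_clinear_linear[OF bY] nc_homog_summable[OF Y], symmetric])
  finally show ?thesis .
qed

text \<open>This makes the nondegeneracy condition of \<open>model_free\<close> applicable to
  differences of vectors of H^2(f).\<close>

lemma nc_radius_l2: "nc_radius (hnth (x :: 'n :: finite H2)) \<ge> 1"
proof -
  \<comment> \<open>The maximum with 1 keeps the base nonzero, so that its roots tend to 1 even for
    x = 0.\<close>
  define B where "B = max 1 ((norm x)\<^sup>2)"
  define s where "s k = (\<Sum>\<alpha>\<in>words k. (cmod (hnth x \<alpha>))\<^sup>2) powr (1 / (2 * real k))" for k
  have "s k \<le> B powr (1 / (2 * real k))" for k
    unfolding s_def
  proof (rule powr_mono2)
    show "(\<Sum>\<alpha>\<in>words k. (cmod (hnth x \<alpha>))\<^sup>2) \<le> B"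
      unfolding B_def by (rule max.coboundedI2, rule hnorm_finite_le) simp
  qed (auto intro: sum_nonneg)
  hence "limsup (\<lambda>k. ereal (s k)) \<le> limsup (\<lambda>k. ereal (B powr (1 / (2 * real k))))"
    by (intro Limsup_mono always_eventually) simp
  also have "\<dots> = ereal 1"
  proof (rule lim_imp_Limsup)
    have "(\<lambda>k. 1 / 2 * (1 / real k)) \<longlonglongrightarrow> 1 / 2 * 0" by (intro tendsto_intros lim_1_over_n)
    hence "(\<lambda>k. 1 / (2 * real k)) \<longlonglongrightarrow> 0" by simp
    hence "(\<lambda>k. B powr (1 / (2 * real k))) \<longlonglongrightarrow> B powr 0"
      by (intro tendsto_powr tendsto_const) (auto simp: B_def max_def)
    thus "(\<lambda>k. ereal (B powr (1 / (2 * real k)))) \<longlonglongrightarrow> ereal 1"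
      by (simp add: B_def max_def split: if_splits)
  qed simp
  finally have le: "limsup (\<lambda>k. ereal (s k)) \<le> 1" by (simp add: one_ereal_def)
  have "0 \<le> limsup (\<lambda>k. ereal (s k))"
    by (rule le_Limsup) (auto simp: s_def)
  from ereal_inverse_antimono[OF this le] show ?thesis
    unfolding nc_radius_def s_def by (simp add: one_ereal_def)
qed

text \<open>The difference of the two vectors evaluates to 0 at every f(X), so nondegeneracy makes
  its coordinates vanish.\<close>

lemma model_free_eval:
  fixes M :: "'n :: finite \<Rightarrow> 'n H2 \<Rightarrow> 'n H2"
  assumes "model_free f g M" shows "tuple_eval f M = creation"
proof (intro ext)
  fix j x
  obtain \<gamma> :: real where
    ball: "\<forall>X\<in>(row_ball \<gamma> :: ('n \<Rightarrow> (nat, complex) hsum \<Rightarrow> (nat, complex) hsum) set). free_image f X \<in> row_ball 1"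
    and inj: "\<forall>G. 1 \<le> nc_radius G \<and> G \<noteq> (\<lambda>_. 0) \<longrightarrow>
      (\<exists>X\<in>(row_ball \<gamma> :: ('n \<Rightarrow> (nat, complex) hsum \<Rightarrow> (nat, complex) hsum) set). nc_eval G (free_image f X) \<noteq> (\<lambda>_. 0))"
    and ev: "\<forall>j x. \<forall>X\<in>(row_ball \<gamma> :: ('n \<Rightarrow> (nat, complex) hsum \<Rightarrow> (nat, complex) hsum) set).
      nc_eval (hnth (tuple_eval f M j x)) (free_image f X) = free_image f X j \<circ> nc_eval (hnth x) (free_image f X)"
    using assms unfolding model_free_def Let_def by (elim exE conjE) (rule that)
  let ?b = "tuple_eval f M j x - creation j x"
  have "hnth ?b = (\<lambda>_. 0)"
  proof (rule ccontr)
    assume "hnth ?b \<noteq> (\<lambda>_. 0)"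
    with inj nc_radius_l2[of ?b] obtain X where X: "X \<in> (row_ball \<gamma> :: ('n \<Rightarrow> (nat, complex) hsum \<Rightarrow> (nat, complex) hsum) set)"
      "nc_eval (hnth ?b) (free_image f X) \<noteq> (\<lambda>_. 0)" by blast
    note Y = bspec[OF ball X(1)]
    have "nc_eval (hnth ?b) (free_image f X) = (\<lambda>_. 0)"
      using ev X(1) by (intro ext) (simp add: nc_eval_diff[OF Y] nc_eval_creation[OF Y])
    with X(2) show False by blast
  qed
  hence "hnth ?b \<alpha> = 0" for \<alpha> by (rule fun_cong)
  thus "tuple_eval f M j x = creation j x" by (intro hsum_eqI) simp
qed

subsection \<open>Polynomial automorphisms\<close>

text \<open>The monomial of the word \<open>\<alpha>\<close>. Expansion in monomials reduces
  products of polynomials to concatenation.\<close>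

definition nc_delta :: "'n list \<Rightarrow> 'n ncfps" where
  "nc_delta \<alpha> \<gamma> = (if \<gamma> = \<alpha> then 1 else 0)"

lemma nc_delta_Nil: "nc_delta [] = nc_one"
  by (simp add: fun_eq_iff nc_delta_def nc_one_def)

lemma nc_delta_Cons: "nc_delta (i # \<alpha>) = nc_mult (nc_var i) (nc_delta \<alpha>)"
proof
  show "nc_delta (i # \<alpha>) \<beta> = nc_mult (nc_var i) (nc_delta \<alpha>) \<beta>" for \<beta>
    by (cases \<beta>) (auto simp: nc_mult_var nc_delta_def nc_var_def)
qed

lemma nc_delta_append: "nc_mult (nc_delta \<alpha>) (nc_delta \<beta>) = nc_delta (\<alpha> @ \<beta>)"
  by (induction \<alpha>) (simp_all add: nc_delta_Nil nc_mult_one_left nc_delta_Cons nc_mult_assoc)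

lemma nc_mult_sum_left:
  "nc_mult (\<lambda>\<gamma>. \<Sum>p\<in>P. c p * \<phi> p \<gamma>) \<psi> = (\<lambda>\<gamma>. \<Sum>p\<in>P. c p * nc_mult (\<phi> p) \<psi> \<gamma>)"
proof
  fix \<beta>
  have "nc_mult (\<lambda>\<gamma>. \<Sum>p\<in>P. c p * \<phi> p \<gamma>) \<psi> \<beta> =
      (\<Sum>k\<le>length \<beta>. \<Sum>p\<in>P. c p * (\<phi> p (take k \<beta>) * \<psi> (drop k \<beta>)))"
    by (simp add: nc_mult_def sum_distrib_right mult.assoc)
  also have "\<dots> = (\<Sum>p\<in>P. c p * nc_mult (\<phi> p) \<psi> \<beta>)"
    unfolding nc_mult_def sum_distrib_left by (rule sum.swap)
  finally show "nc_mult (\<lambda>\<gamma>. \<Sum>p\<in>P. c p * \<phi> p \<gamma>) \<psi> \<beta> = (\<Sum>p\<in>P. c p * nc_mult (\<phi> p) \<psi> \<beta>)" .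
qed

lemma nc_mult_sum_right:
  "nc_mult \<phi> (\<lambda>\<gamma>. \<Sum>p\<in>P. c p * \<psi> p \<gamma>) = (\<lambda>\<gamma>. \<Sum>p\<in>P. c p * nc_mult \<phi> (\<psi> p) \<gamma>)"
proof
  fix \<beta>
  have "nc_mult \<phi> (\<lambda>\<gamma>. \<Sum>p\<in>P. c p * \<psi> p \<gamma>) \<beta> =
      (\<Sum>k\<le>length \<beta>. \<Sum>p\<in>P. c p * (\<phi> (take k \<beta>) * \<psi> p (drop k \<beta>)))"
    by (simp add: nc_mult_def sum_distrib_left mult.left_commute)
  also have "\<dots> = (\<Sum>p\<in>P. c p * nc_mult \<phi> (\<psi> p) \<beta>)"
    unfolding nc_mult_def sum_distrib_left by (rule sum.swap)
  finally show "nc_mult \<phi> (\<lambda>\<gamma>. \<Sum>p\<in>P. c p * \<psi> p \<gamma>) \<beta> = (\<Sum>p\<in>P. c p * nc_mult \<phi> (\<psi> p) \<beta>)" .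
qed

lemma nc_polynomial_expansion:
  assumes "nc_polynomial \<phi>"
  shows "(\<lambda>\<gamma>. \<Sum>\<alpha> | \<phi> \<alpha> \<noteq> 0. \<phi> \<alpha> * nc_delta \<alpha> \<gamma>) = \<phi>"
proof
  fix \<gamma>
  have "(\<Sum>\<alpha> | \<phi> \<alpha> \<noteq> 0. \<phi> \<alpha> * nc_delta \<alpha> \<gamma>) = (\<Sum>\<alpha> | \<phi> \<alpha> \<noteq> 0. if \<gamma> = \<alpha> then \<phi> \<gamma> else 0)"
    by (intro sum.cong) (auto simp: nc_delta_def)
  thus "(\<Sum>\<alpha> | \<phi> \<alpha> \<noteq> 0. \<phi> \<alpha> * nc_delta \<alpha> \<gamma>) = \<phi> \<gamma>"
    using assms by (simp add: nc_polynomial_def)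
qed

lemma nc_compose_finite:
  assumes "finite S" "\<And>\<alpha>. \<alpha> \<notin> S \<Longrightarrow> a \<alpha> = 0"
  shows "((\<lambda>\<alpha>. a \<alpha> * nc_power f \<alpha> \<beta>) has_sum (\<Sum>\<alpha>\<in>S. a \<alpha> * nc_power f \<alpha> \<beta>)) UNIV"
    and "nc_compose a f \<beta> = (\<Sum>\<alpha>\<in>S. a \<alpha> * nc_power f \<alpha> \<beta>)"
proof -
  show "((\<lambda>\<alpha>. a \<alpha> * nc_power f \<alpha> \<beta>) has_sum (\<Sum>\<alpha>\<in>S. a \<alpha> * nc_power f \<alpha> \<beta>)) UNIV"
    by (rule has_sum_finite_neutralI[of S]) (use assms in auto)
  thus "nc_compose a f \<beta> = (\<Sum>\<alpha>\<in>S. a \<alpha> * nc_power f \<alpha> \<beta>)" by (rule nc_compose_eqI)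
qed

lemma composable_polynomial: "nc_polynomial a \<Longrightarrow> composable a f"
  unfolding composable_def nc_polynomial_def
  by (intro allI has_sum_imp_summable[OF nc_compose_finite(1)]) auto

lemma nc_compose_delta: "nc_compose (nc_delta \<alpha>) g = nc_power g \<alpha>"
  using nc_compose_finite(2)[of "{\<alpha>}" "nc_delta \<alpha>" g] by (auto simp: nc_delta_def)

lemma nc_compose_sum:
  assumes P: "finite P" "\<And>p. p \<in> P \<Longrightarrow> nc_polynomial (\<phi> p)"
  shows "nc_compose (\<lambda>\<gamma>. \<Sum>p\<in>P. c p * \<phi> p \<gamma>) g \<beta> = (\<Sum>p\<in>P. c p * nc_compose (\<phi> p) g \<beta>)"
proof -
  define S where "S = (\<Union>p\<in>P. {\<alpha>. \<phi> p \<alpha> \<noteq> 0})"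
  have S: "finite S" using P by (auto simp: S_def nc_polynomial_def)
  have 0: "\<phi> p \<alpha> = 0" if "p \<in> P" "\<alpha> \<notin> S" for p \<alpha> using that by (auto simp: S_def)
  have "nc_compose (\<lambda>\<gamma>. \<Sum>p\<in>P. c p * \<phi> p \<gamma>) g \<beta> = (\<Sum>\<alpha>\<in>S. (\<Sum>p\<in>P. c p * \<phi> p \<alpha>) * nc_power g \<alpha> \<beta>)"
    by (rule nc_compose_finite(2)[OF S]) (simp add: 0)
  also have "\<dots> = (\<Sum>p\<in>P. c p * (\<Sum>\<alpha>\<in>S. \<phi> p \<alpha> * nc_power g \<alpha> \<beta>))"
    unfolding sum_distrib_right sum_distrib_left by (subst sum.swap) (simp add: mult.assoc)
  also have "\<dots> = (\<Sum>p\<in>P. c p * nc_compose (\<phi> p) g \<beta>)"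
    by (intro sum.cong refl) (simp add: nc_compose_finite(2)[OF S 0])
  finally show ?thesis .
qed

lemma nc_polynomial_delta: "nc_polynomial (nc_delta \<alpha>)"
  by (simp add: nc_polynomial_def nc_delta_def)

lemma nc_polynomial_sum:
  assumes "finite P" "\<And>p. p \<in> P \<Longrightarrow> nc_polynomial (\<phi> p)"
  shows "nc_polynomial (\<lambda>\<gamma>. \<Sum>p\<in>P. c p * \<phi> p \<gamma>)"
proof -
  have "{\<gamma>. (\<Sum>p\<in>P. c p * \<phi> p \<gamma>) \<noteq> 0} \<subseteq> (\<Union>p\<in>P. {\<alpha>. \<phi> p \<alpha> \<noteq> 0})"
  proof
    fix \<gamma> assume ne: "\<gamma> \<in> {\<gamma>. (\<Sum>p\<in>P. c p * \<phi> p \<gamma>) \<noteq> 0}"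
    show "\<gamma> \<in> (\<Union>p\<in>P. {\<alpha>. \<phi> p \<alpha> \<noteq> 0})"
    proof (rule ccontr)
      assume "\<not> ?thesis"
      hence "(\<Sum>p\<in>P. c p * \<phi> p \<gamma>) = 0" by (intro sum.neutral) auto
      with ne show False by simp
    qed
  qed
  thus ?thesis using assms unfolding nc_polynomial_def by (auto intro: finite_subset)
qed

lemma nc_mult_polynomial:
  assumes "nc_polynomial \<phi>" "nc_polynomial \<psi>"
  shows "nc_mult \<phi> \<psi> = (\<lambda>\<gamma>. \<Sum>(\<alpha>, \<beta>)\<in>{\<alpha>. \<phi> \<alpha> \<noteq> 0} \<times> {\<beta>. \<psi> \<beta> \<noteq> 0}. (\<phi> \<alpha> * \<psi> \<beta>) * nc_delta (\<alpha> @ \<beta>) \<gamma>)"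
proof -
  have "nc_mult \<phi> \<psi> = nc_mult (\<lambda>\<gamma>. \<Sum>\<alpha> | \<phi> \<alpha> \<noteq> 0. \<phi> \<alpha> * nc_delta \<alpha> \<gamma>) (\<lambda>\<gamma>. \<Sum>\<beta> | \<psi> \<beta> \<noteq> 0. \<psi> \<beta> * nc_delta \<beta> \<gamma>)"
    by (simp only: nc_polynomial_expansion assms)
  also have "\<dots> = (\<lambda>\<gamma>. \<Sum>\<alpha> | \<phi> \<alpha> \<noteq> 0. \<Sum>\<beta> | \<psi> \<beta> \<noteq> 0. (\<phi> \<alpha> * \<psi> \<beta>) * nc_delta (\<alpha> @ \<beta>) \<gamma>)"
    unfolding nc_mult_sum_left unfolding nc_mult_sum_right nc_delta_append
    by (simp add: sum_distrib_left mult.assoc)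
  finally show ?thesis by (simp only: sum.cartesian_product)
qed

lemma nc_polynomial_mult:
  assumes "nc_polynomial \<phi>" "nc_polynomial \<psi>" shows "nc_polynomial (nc_mult \<phi> \<psi>)"
  unfolding nc_mult_polynomial[OF assms] case_prod_unfold
  using assms by (intro nc_polynomial_sum nc_polynomial_delta) (simp add: nc_polynomial_def)

text \<open>Expansion in monomials reduces multiplicativity of substitution to powers at
  concatenated words; the supports are finite, so constant terms in \<open>g\<close> cause no
  convergence problem.\<close>

lemma nc_compose_mult:
  assumes "nc_polynomial \<phi>" "nc_polynomial \<psi>"
  shows "nc_compose (nc_mult \<phi> \<psi>) g = nc_mult (nc_compose \<phi> g) (nc_compose \<psi> g)"
proof
  fix \<gamma>
  let ?S = "{\<alpha>. \<phi> \<alpha> \<noteq> 0}" and ?S' = "{\<beta>. \<psi> \<beta> \<noteq> 0}"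
  have fin: "finite ?S" "finite ?S'" using assms by (simp_all add: nc_polynomial_def)
  have \<phi>: "nc_compose \<phi> g = (\<lambda>\<gamma>. \<Sum>\<alpha>\<in>?S. \<phi> \<alpha> * nc_power g \<alpha> \<gamma>)"
    and \<psi>: "nc_compose \<psi> g = (\<lambda>\<gamma>. \<Sum>\<beta>\<in>?S'. \<psi> \<beta> * nc_power g \<beta> \<gamma>)"
    using nc_compose_finite(2)[OF fin(1)] nc_compose_finite(2)[OF fin(2)] by auto
  have "nc_compose (nc_mult \<phi> \<psi>) g \<gamma> =
      (\<Sum>p\<in>?S \<times> ?S'. (\<phi> (fst p) * \<psi> (snd p)) * nc_compose (nc_delta (fst p @ snd p)) g \<gamma>)"
    unfolding nc_mult_polynomial[OF assms] case_prod_unfold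
    by (intro nc_compose_sum nc_polynomial_delta) (simp add: fin)
  also have "\<dots> = (\<Sum>\<alpha>\<in>?S. \<Sum>\<beta>\<in>?S'. (\<phi> \<alpha> * \<psi> \<beta>) * nc_power g (\<alpha> @ \<beta>) \<gamma>)"
    by (simp add: nc_compose_delta sum.cartesian_product case_prod_unfold)
  also have "\<dots> = nc_mult (nc_compose \<phi> g) (nc_compose \<psi> g) \<gamma>"
    unfolding \<phi> \<psi> nc_mult_sum_left unfolding nc_mult_sum_right nc_power_append
    by (simp add: sum_distrib_left mult.assoc)
  finally show "nc_compose (nc_mult \<phi> \<psi>) g \<gamma> = nc_mult (nc_compose \<phi> g) (nc_compose \<psi> g) \<gamma>" .
qed

lemma nc_polynomial_power: "(\<And>i. nc_polynomial (f i)) \<Longrightarrow> nc_polynomial (nc_power f \<alpha>)"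
  by (induction \<alpha>) (auto intro: nc_polynomial_mult simp: nc_polynomial_delta simp flip: nc_delta_Nil)

lemma nc_compose_power:
  assumes "\<And>i. nc_polynomial (f i)" "\<And>i. nc_compose (f i) g = nc_var i"
  shows "nc_compose (nc_power f \<alpha>) g = nc_delta \<alpha>"
proof (induction \<alpha>)
  case Nil
  show ?case using nc_compose_delta[of "[]" g] by (simp add: nc_delta_Nil)
next
  case (Cons i \<alpha>)
  thus ?case by (simp add: nc_compose_mult assms nc_polynomial_power nc_delta_Cons)
qed

lemma nc_compose_injective_polynomial:
  assumes f: "\<And>i. nc_polynomial (f i)" "\<And>i. nc_compose (f i) g = nc_var i"
    and a: "nc_polynomial a" and zero: "\<And>\<beta>. nc_compose a f \<beta> = 0"
  shows "a \<gamma> = 0"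
proof -
  let ?S = "{\<alpha>. a \<alpha> \<noteq> 0}"
  have fin: "finite ?S" using a by (simp add: nc_polynomial_def)
  have "a \<gamma> = (\<Sum>\<alpha>\<in>?S. a \<alpha> * nc_compose (nc_power f \<alpha>) g \<gamma>)"
    using fun_cong[OF nc_polynomial_expansion[OF a], of \<gamma>] by (simp add: nc_compose_power[OF f])
  also have "\<dots> = nc_compose (\<lambda>\<beta>. \<Sum>\<alpha>\<in>?S. a \<alpha> * nc_power f \<alpha> \<beta>) g \<gamma>"
    by (rule nc_compose_sum[symmetric]) (simp_all add: fin nc_polynomial_power f)
  also have "(\<lambda>\<beta>. \<Sum>\<alpha>\<in>?S. a \<alpha> * nc_power f \<alpha> \<beta>) = (\<lambda>_. 0)"
    using nc_compose_finite(2)[OF fin, of a f] zero by (simp add: fun_eq_iff)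
  also have "nc_compose (\<lambda>_. 0) g \<gamma> = 0" by (simp add: nc_compose_def)
  finally show ?thesis .
qed

lemma nc_homog_polynomial_sums:
  assumes "nc_polynomial \<phi>"
  shows "(\<lambda>k. nc_homog \<phi> X k h) sums (\<Sum>\<alpha> | \<phi> \<alpha> \<noteq> 0. \<phi> \<alpha> *\<^sub>C op_power X \<alpha> h)"
proof -
  let ?S = "{\<alpha>. \<phi> \<alpha> \<noteq> 0}"
  have fin: "finite ?S" using assms by (simp add: nc_polynomial_def)
  have homog: "nc_homog \<phi> X k h = (\<Sum>\<alpha> | \<alpha> \<in> ?S \<and> length \<alpha> = k. \<phi> \<alpha> *\<^sub>C op_power X \<alpha> h)" for k
    unfolding nc_homog_def by (rule sum.mono_neutral_right[OF finite_words]) (auto simp: words_def)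
  have "(\<lambda>k. nc_homog \<phi> X k h) sums (\<Sum>k\<in>length ` ?S. nc_homog \<phi> X k h)"
  proof (rule sums_finite)
    fix k assume k: "k \<notin> length ` ?S"
    show "nc_homog \<phi> X k h = 0" unfolding homog by (rule sum.neutral) (use k in auto)
  qed (simp add: fin)
  also have "(\<Sum>k\<in>length ` ?S. nc_homog \<phi> X k h) = (\<Sum>\<alpha>\<in>?S. \<phi> \<alpha> *\<^sub>C op_power X \<alpha> h)"
    unfolding homog by (rule sum.group) (auto simp: fin)
  finally show ?thesis .
qed

lemma bounded_clinear_tuple_eval:
  assumes "X \<in> C_SOT f \<union> C_rad f" shows "bounded_clinear (tuple_eval f X j)"
proof (cases "X \<in> C_SOT f")
  case True
  then obtain B where B: "bounded_clinear B" "\<And>h. (\<lambda>k. nc_homog (f j) X k h) sums B h"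
    unfolding C_SOT_def SOT_convergent_def by blast
  have "tuple_eval f X j = B"
    using True sums_unique[OF B(2)] by (simp add: fun_eq_iff tuple_eval_def nc_eval_def)
  thus ?thesis using B(1) by simp
next
  case False
  with assms obtain B where B: "bounded_clinear B"
    "\<And>h. ((\<lambda>r. nc_eval (f j) (scale_tuple r X) h) \<longlongrightarrow> B h) (at_left 1)"
    unfolding C_rad_def by blast
  have "tuple_eval f X j = B"
    using False tendsto_Lim[OF trivial_limit_at_left_real B(2)] by (simp add: fun_eq_iff tuple_eval_def)
  thus ?thesis using B(1) by simp
qed

text \<open>Agreement on basis vectors fixes the coordinates of the adjoints, and these determine
  the operators; no density argument is involved.\<close>

lemma hsingle_ext:
  fixes X Y :: "('i, complex) hsum \<Rightarrow> 'b :: chilbert_space"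
  assumes X: "bounded_clinear X" and Y: "bounded_clinear Y"
    and eq: "\<And>\<alpha>. X (hsingle \<alpha> 1) = Y (hsingle \<alpha> 1)"
  shows "X = Y"
proof -
  have "cadj X y = cadj Y y" for y
  proof (rule hsum_eqI)
    fix \<alpha>
    have "cinner (hsingle \<alpha> 1) (cadj X y) = cinner (hsingle \<alpha> 1) (cadj Y y)"
      by (simp add: eq flip: cadj[OF X] cadj[OF Y])
    thus "hnth (cadj X y) \<alpha> = hnth (cadj Y y) \<alpha>" by (simp add: cinner_hsingle_left cinner_complex_def)
  qed
  hence "cinner y (X x) = cinner y (Y x)" for x y
    by (simp flip: cadj'[OF X] cadj'[OF Y])
  note * = this
  show ?thesis by (rule ext, rule cinner_ext, rule *)
qed

text \<open>In this case the value of f_j at the model is not postulated. It is found on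
  polynomials, where products of the \<open>M i\<close> multiply the represented polynomial by
  monomials; basis vectors are polynomials, so \<open>hsingle_ext\<close> extends it to the
  completion.\<close>

lemma model_poly_eval:
  fixes M :: "'n :: finite \<Rightarrow> 'n H2 \<Rightarrow> 'n H2"
  assumes "model_poly f g M" shows "tuple_eval f M = creation"
proof
  fix j
  have f: "nc_polynomial (f i)" "nc_compose (f i) g = nc_var i" and bM: "bounded_clinear (M i)"
    and M: "nc_polynomial (hnth x) \<Longrightarrow> nc_polynomial (hnth (M i x))"
      "nc_polynomial (hnth x) \<Longrightarrow> nc_compose (hnth (M i x)) f = nc_mult (nc_var i) (nc_compose (hnth x) f)" for i x
    using assms by (simp_all add: model_poly_def)
  let ?S = "{\<gamma>. f j \<gamma> \<noteq> 0}"
  have fin: "finite ?S" using f(1)[of j] by (simp add: nc_polynomial_def)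
  \<comment> \<open>A polynomial has finitely many nonzero homogeneous parts, so its series at
    \<open>M\<close> converges and \<open>tuple_eval\<close> takes its first branch.\<close>
  have SOT: "M \<in> C_SOT f"
    unfolding C_SOT_def SOT_convergent_def
    using bM nc_homog_polynomial_sums[OF f(1)]
    by (auto intro!: exI[of _ "\<lambda>h. \<Sum>\<alpha> | f _ \<alpha> \<noteq> 0. f _ \<alpha> *\<^sub>C op_power M \<alpha> h"] bounded_clinear_sum
        bounded_clinear_scaleC bounded_clinear_op_power)
  have eval: "tuple_eval f M j x = (\<Sum>\<gamma>\<in>?S. f j \<gamma> *\<^sub>C op_power M \<gamma> x)" for x
    using SOT sums_unique[OF nc_homog_polynomial_sums[OF f(1)[of j], of M x]] by (simp add: tuple_eval_def nc_eval_def)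
  show "tuple_eval f M j = creation j"
  proof (rule hsingle_ext[OF bounded_clinear_tuple_eval bounded_clinear_creation])
    show "M \<in> C_SOT f \<union> C_rad f" using SOT by blast
    fix \<alpha>
    define x :: "'n H2" where "x = hsingle \<alpha> 1"
    have x: "nc_polynomial (hnth x)" by (simp add: x_def nc_polynomial_def)
    have pow: "nc_polynomial (hnth (op_power M \<gamma> x)) \<and>
        nc_compose (hnth (op_power M \<gamma> x)) f = nc_mult (nc_delta \<gamma>) (nc_compose (hnth x) f)" for \<gamma>
      by (induction \<gamma>) (simp_all add: x M nc_delta_Nil nc_mult_one_left nc_delta_Cons nc_mult_assoc)
    let ?y = "tuple_eval f M j x"
    have y: "hnth ?y = (\<lambda>\<delta>. \<Sum>\<gamma>\<in>?S. f j \<gamma> * hnth (op_power M \<gamma> x) \<delta>)"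
      by (simp add: fun_eq_iff eval)
    have y_poly: "nc_polynomial (hnth ?y)" unfolding y by (intro nc_polynomial_sum fin) (simp add: pow)
    have c_poly: "nc_polynomial (hnth (creation j x))"
      unfolding x_def creation_hsingle by (simp add: nc_polynomial_def)
    have "nc_compose (hnth ?y) f \<beta> = nc_mult (f j) (nc_compose (hnth x) f) \<beta>" for \<beta>
    proof -
      have "nc_compose (hnth ?y) f \<beta> = (\<Sum>\<gamma>\<in>?S. f j \<gamma> * nc_mult (nc_delta \<gamma>) (nc_compose (hnth x) f) \<beta>)"
        unfolding y by (subst nc_compose_sum) (simp_all add: fin pow)
      also have "\<dots> = nc_mult (\<lambda>\<delta>. \<Sum>\<gamma>\<in>?S. f j \<gamma> * nc_delta \<gamma> \<delta>) (nc_compose (hnth x) f) \<beta>"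
        by (simp add: nc_mult_sum_left)
      finally show ?thesis unfolding nc_polynomial_expansion[OF f(1)] .
    qed
    hence zero: "nc_compose (\<lambda>\<delta>. hnth ?y \<delta> - hnth (creation j x) \<delta>) f \<beta> = 0" for \<beta>
      by (simp add: nc_compose_diff composable_polynomial y_poly c_poly nc_compose_creation x)
    have "nc_polynomial (\<lambda>\<delta>. hnth ?y \<delta> - hnth (creation j x) \<delta>)"
      unfolding nc_polynomial_def
      by (rule finite_subset[OF _ finite_UnI[OF y_poly[unfolded nc_polynomial_def] c_poly[unfolded nc_polynomial_def]]]) auto
    from nc_compose_injective_polynomial[OF f this zero]
    have "hnth ?y \<delta> = hnth (creation j x) \<delta>" for \<delta> by simp
    thus "tuple_eval f M j (hsingle \<alpha> 1) = creation j (hsingle \<alpha> 1)" unfolding x_def by (rule hsum_eqI)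
  qed
qed

section \<open>The curvature formula\<close>

theorem theorem8p1:
  fixes f g :: "'n :: finite \<Rightarrow> 'n ncfps"
    and M :: "'n \<Rightarrow> 'n H2 \<Rightarrow> 'n H2"
    and T :: "'n \<Rightarrow> 'h \<Rightarrow> 'h :: chilbert_space"
  assumes "model f g M"
    and "T \<in> nc_domain f g"
    and "finite_rank (defect f T)"
  shows "convergent (curv_seq f M T) \<and>
    (\<exists>t. has_graded_trace (defect_space f T)
           (\<lambda>x. char_fun f T (Q_eq 0 (char_fun_adj f T (weight_N x)))) t \<and>
         curv f M T = of_nat (rank_f f T) - t)"
proof -
  \<comment> \<open>All three cases turn f_j(M) into creation operators, which fixes the
    denominators of the curvature sequence.\<close>
  have eval: "tuple_eval f M = creation"
    using assms(1) model_poly_eval model_series_eval model_free_eval unfolding model_def by blast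
  interpret contractive_tuple f T
    using assms(2) bounded_clinear_tuple_eval unfolding nc_domain_def by unfold_locales auto
  obtain B where B: "finite B" "range (defect f T) \<subseteq> cspan B"
    using assms(3) unfolding finite_rank_def by blast
  obtain C where C: "is_onb (range (defect f T)) C"
    using onb_exists[OF csubspace_range[OF bounded_clinear_defect]] by blast
  note dim = finite_dim_onb[OF C csubspace_range[OF bounded_clinear_defect] B]
  interpret finite_defect_tuple f T C
    by unfold_locales (fact C dim(1))+
  have "real CARD('n) \<ge> 1" using card_gt_0_iff[of "UNIV :: 'n set"] by simp
  from curvature_limit[where \<tau> = defect_trace, OF this defect_trace_nonneg defect_trace_Suc_le] obtain L
    where L: "(\<lambda>m. (\<Sum>k\<le>m. defect_trace k) / (\<Sum>k\<le>m. real CARD('n) ^ k)) \<longlonglongrightarrow> L"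
      and series: "(\<lambda>k. (real CARD('n) * defect_trace k - defect_trace (Suc k)) / real CARD('n) ^ Suc k)
        sums (defect_trace 0 - L)" by blast
  have "curv_seq f M T = (\<lambda>m. of_real ((\<Sum>k\<le>m. defect_trace k) / (\<Sum>k\<le>m. real CARD('n) ^ k)))"
    unfolding curv_seq_def poisson_trace_eq creation_model_trace[OF eval] by simp
  hence lim: "curv_seq f M T \<longlonglongrightarrow> of_real L" by (simp only:) (rule tendsto_of_real[OF L])
  have rank: "rank_f f T = card C" using dim(2) by (simp add: rank_f_def)
  show ?thesis
  proof (intro conjI exI)
    show "convergent (curv_seq f M T)" using lim by (rule convergentI)
    show "has_graded_trace (defect_space f T)
        (\<lambda>x. char_fun f T (Q_eq 0 (char_fun_adj f T (weight_N x)))) (of_real (real (card C) - L))"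
      by (rule char_fun_graded_trace[OF series])
    show "curv f M T = of_nat (rank_f f T) - of_real (real (card C) - L)"
      unfolding curv_def using limI[OF lim] by (simp add: rank)
  qed
qed

end
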